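(* Let $\mathcal T_h$ be any fixed mesh resolving the geometry of $\Gamma$ (in the sense of the context). Let $$c_*:=\inf_{0\ne u_h\in\mathbb U_h}\ \sup_{0\ne v_h\in\mathbb V_h}\frac{b_h(u_h,v_h)}{\|u_h\|_{1,*}\,\|v_h\|_{2,*}},\qquad c_b^-:=\frac{1}{\sqrt8\,(1+2T)},\qquad C_b^+:=\sqrt2 .$$ Then $$\frac{c_b^-}{\|P_h\|_{\mathcal L(H^1_* )}+C_{\mathrm{inv},h}}\ \le\ c_*\ \le\ \frac{C_b^+}{\|P_h\|_{\mathcal L(H^1_\Gamma)}} .$$
   Context: Geometry and finite elements. $\Gamma\subset\mathbb R^n$ is a closed (compact, boundaryless) hypersurface of class $C^2$ with principal curvatures $\kappa_1,\dots,\kappa_{n-1}$ and unit normal $\mathbf n$; integration and evaluation on $\Gamma$ are exact. $\mathcal T_h$ is the set of those elements $T$ (of diameter $h_T$) of a mesh of a region of $\mathbb R^n$ surrounding $\Gamma$ that intersect $\Gamma$; $\Omega_h$ is the union of the $T\in\mathcal T_h$, and $h=\max_T h_T$. Resolution of the geometry: $h_T\le C(\max_i\|\kappa_i\|_{L^\infty(\Gamma\cap T)})^{-1}$ for all $T\in\mathcal T_h$, with a generic constant $C$ such that the closest point projection $\mathbf p$ onto $\Gamma$ is well defined on $\Omega_h$. The normal is extended to $\Omega_h$ by $\mathbf n\circ\mathbf p$ (still denoted $\mathbf n$) and $\nabla_{\mathbf n}:=\mathbf n\cdot\nabla$. $V_h$ is a finite element space of continuous functions on $\Omega_h$, piecewise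 polynomial over $\mathcal T_h$, so that $V_h|_\Gamma\subset H^1(\Gamma)$. No shape-regularity or quasi-uniformity is assumed. Stabilized forms and norms. Write $L^2_\Gamma=L^2(\Gamma)$, $H^1_\Gamma=H^1(\Gamma)$, $|v|_{H^1_\Gamma}=\|\nabla_\Gamma v\|_{L^2_\Gamma}$, $\|v\|_{H^1_\Gamma}^2=\|v\|_{L^2_\Gamma}^2+|v|_{H^1_\Gamma}^2$; $H^{-1}_\Gamma$ is the dual of $H^1_\Gamma$ (no mean value constraint), with pairing $\langle\cdot,\cdot\rangle_\Gamma$ extending the inner product $(\cdot,\cdot)_\Gamma$ of $L^2_\Gamma$. For $j\in\{-1,0,1\}$ and $v_h,w_h\in V_h$ let $$s_{j,T}(v_h,w_h)=h_T^{1-2j}\int_T(\nabla_{\mathbf n}v_h)(\nabla_{\mathbf n}w_h)\,dx,\qquad s_j=\sum_{T\in\mathcal T_h}s_{j,T}.$$ Set $(v_h,w_h)_*=\langle v_h,w_h\rangle_*=(v_h,w_h)_\Gamma+s_0(v_h,w_h)$, $a_*(v_h,w_h)=(\nabla_\Gamma v_h,\nabla_\Gamma w_h)_\Gamma+s_1(v_h,w_h)$, $|v_h|_{H^1_*}^2=a_*(v_h,v_h)$, and $$\|v_h\|_{H^1_*}^2=\|v_h\|_{H^1_\Gamma}^2+s_1(v_h,v_h),\quad \|v_h\|_{L^2_*}^2=\|v_h\|_{L^2_\Gamma}^2+s_0(v_h,v_h),\quad \|v_h\|_{H^{-1}_*}^2=\|v_h\|_{H^{-1}_\Gamma}^2+s_{-1}(v_h,v_h).$$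 The local version of the middle norm is $\|v_h\|_{L^2_*(T)}^2=\|v_h\|_{L^2(\Gamma\cap T)}^2+s_{0,T}(v_h,v_h)$. The method is assumed well defined, i.e. $(\cdot,\cdot)_*$ is an inner product on $V_h$. Stabilized $L^2$-projection: $P_h:H^{-1}_\Gamma\to V_h$, $(P_hu,v_h)_*=\langle u,v_h\rangle_\Gamma$ for all $v_h\in V_h$; $$\|P_h\|_{\mathcal L(H^1_\Gamma)}=\sup_{0\neq v\in H^1_\Gamma}\frac{\|P_hv\|_{H^1_\Gamma}}{\|v\|_{H^1_\Gamma}},\qquad \|P_h\|_{\mathcal L(H^1_* )}=\sup_{0\neq v\in H^1_\Gamma}\frac{\|P_hv\|_{H^1_*}}{\|v\|_{H^1_\Gamma}}.$$ Discrete dual norm and inverse parameter: $$\|v_h\|_{V_h^{-1}}=\sup_{0\ne w_h\in V_h}\frac{(v_h,w_h)_*}{\|w_h\|_{H^1_*}},\qquad C_{\mathrm{inv},h}=\sup_{0\ne v_h\in V_h}\frac{\big(\sum_{T\in\mathcal T_h}h_T^2\|v_h\|_{L^2_*(T)}^2\big)^{1/2}}{\|v_h\|_{V_h^{-1}}}.$$ Parabolic setting. $I=(0,T)$ with $0<T<\infty$ (the letter $T$ is also used for elements); integrals over $I$ are in $t$. $\mathbb U_h=H^1(I;V_h)$, $\mathbb V_h=V_h\times L^2(I;V_h)$, and for $u_h\in\mathbb U_h$, $v_h=(v_{h,0},v_{h,1})\in\mathbb V_h$: $$b_h(u_h,v_h)=(u_h(0),v_{h,0})_*+\int_I\big(\langle\partial_tu_h,v_{h,1}\rangle_*+a_*(u_h,v_{h,1})\big),$$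 $$\|u_h\|_{1,*}^2=\|u_h(0)\|_{L^2_*}^2+\int_I\big(\|\partial_tu_h\|_{H^{-1}_*}^2+|u_h|_{H^1_*}^2\big),\qquad \|v_h\|_{2,*}^2=\|v_{h,0}\|_{L^2_*}^2+\int_I\|v_{h,1}\|_{H^1_*}^2 .$$ *)

theory Defs
  imports "HOL-Analysis.Analysis"
begin

section \<open>Closed hypersurfaces of class C2\<close>

definition C2_defining ::
    "'a::euclidean_space set \<Rightarrow> 'a set \<Rightarrow> ('a \<Rightarrow> real) \<Rightarrow> ('a \<Rightarrow> 'a) \<Rightarrow> bool" where
  "C2_defining \<Gamma> U \<phi> G \<longleftrightarrow>
     open U \<and>
     (\<forall>x\<in>U. GDERIV \<phi> x :> G x \<and> G x \<noteq> 0) \<and>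
     (\<exists>H :: 'a \<Rightarrow> 'a \<Rightarrow>\<^sub>L 'a. continuous_on U H \<and>
        (\<forall>x\<in>U. (G has_derivative blinfun_apply (H x)) (at x))) \<and>
     \<Gamma> \<inter> U = {x\<in>U. \<phi> x = 0}"

definition closed_C2_hypersurface :: "'a::euclidean_space set \<Rightarrow> bool" where
  "closed_C2_hypersurface \<Gamma> \<longleftrightarrow>
     compact \<Gamma> \<and> (\<forall>x\<in>\<Gamma>. \<exists>U \<phi> G. x \<in> U \<and> C2_defining \<Gamma> U \<phi> G)"

text \<open>The sign of a local defining function is free, so \<open>\<nu>\<close> may be any continuous unit
  normal field; the orientation may be chosen separately on each component.\<close>

definition unit_normal_field :: "'a::euclidean_space set \<Rightarrow> ('a \<Rightarrow> 'a) \<Rightarrow> bool" where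
  "unit_normal_field \<Gamma> \<nu> \<longleftrightarrow>
     (\<forall>x\<in>\<Gamma>. \<exists>U \<phi> G. x \<in> U \<and> C2_defining \<Gamma> U \<phi> G \<and>
        (\<forall>y\<in>\<Gamma> \<inter> U. \<nu> y = G y /\<^sub>R norm (G y)))"

text \<open>Principal curvatures are the eigenvalues of the Weingarten map, the derivative of \<open>\<nu>\<close>
  along \<open>\<Gamma>\<close>. A derivative within \<open>\<Gamma>\<close> is determined on the tangent space only, which is the
  only place where it is evaluated.\<close>

definition principal_curvatures :: "'a::euclidean_space set \<Rightarrow> ('a \<Rightarrow> 'a) \<Rightarrow> 'a \<Rightarrow> real set" where
  "principal_curvatures \<Gamma> \<nu> x =
     {\<kappa>. \<exists>w. w \<noteq> 0 \<and> w \<bullet> \<nu> x = 0 \<and> frechet_derivative \<nu> (at x within \<Gamma>) w = \<kappa> *\<^sub>R w}"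

section \<open>Surface measure\<close>

text \<open>Hausdorff measure, normalised so that it agrees with Lebesgue measure in dimension \<open>m\<close>.
  The outer measure is a metric outer measure, hence countably additive on the Borel sets.\<close>

definition hausdorff_premeasure :: "nat \<Rightarrow> real \<Rightarrow> 'a::metric_space set \<Rightarrow> ennreal" where
  "hausdorff_premeasure m \<delta> A =
     (INF C \<in> {C :: nat \<Rightarrow> 'a set. A \<subseteq> (\<Union>i. C i) \<and> (\<forall>i. bounded (C i) \<and> diameter (C i) \<le> \<delta>)}.
        \<Sum>i. if C i = {} then 0 else ennreal (unit_ball_vol m * (diameter (C i) / 2) ^ m))"

definition hausdorff_outer :: "nat \<Rightarrow> 'a::metric_space set \<Rightarrow> ennreal" where
  "hausdorff_outer m A = (SUP \<delta>\<in>{0<..}. hausdorff_premeasure m \<delta> A)"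

definition hausdorff_measure :: "nat \<Rightarrow> 'a::metric_space measure" where
  "hausdorff_measure m = measure_of UNIV (sets borel) (hausdorff_outer m)"

definition surface_measure :: "'a::euclidean_space set \<Rightarrow> 'a measure" where
  "surface_measure \<Gamma> = restrict_space (hausdorff_measure (DIM('a) - 1)) \<Gamma>"

section \<open>Sobolev spaces on the surface\<close>

text \<open>Functions on \<open>\<Gamma>\<close> are represented by functions on the ambient space of which only the
  values on \<open>\<Gamma>\<close> matter, and up to almost everywhere equality.\<close>

definition L2_space :: "'b measure \<Rightarrow> ('b \<Rightarrow> 'c::euclidean_space) set" where
  "L2_space M = {f \<in> borel_measurable M. integrable M (\<lambda>x. (norm (f x))\<^sup>2)}"

definition C1_tangential_field ::
    "'a::euclidean_space set \<Rightarrow> ('a \<Rightarrow> 'a) \<Rightarrow> ('a \<Rightarrow> 'a) \<Rightarrow> bool" where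
  "C1_tangential_field \<Gamma> \<nu> \<phi> \<longleftrightarrow>
     (\<exists>D :: 'a \<Rightarrow> 'a \<Rightarrow>\<^sub>L 'a. continuous_on UNIV D \<and>
        (\<forall>x. (\<phi> has_derivative blinfun_apply (D x)) (at x))) \<and>
     (\<forall>x\<in>\<Gamma>. \<phi> x \<bullet> \<nu> x = 0)"

text \<open>Trace of the derivative composed with the orthogonal projection onto the tangent space.\<close>

definition surf_div :: "('a::euclidean_space \<Rightarrow> 'a) \<Rightarrow> ('a \<Rightarrow> 'a) \<Rightarrow> 'a \<Rightarrow> real" where
  "surf_div \<nu> \<phi> x = (\<Sum>b\<in>Basis. frechet_derivative \<phi> (at x) (b - (b \<bullet> \<nu> x) *\<^sub>R \<nu> x) \<bullet> b)"

definition weak_surf_grad ::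
    "'a::euclidean_space set \<Rightarrow> ('a \<Rightarrow> 'a) \<Rightarrow> ('a \<Rightarrow> real) \<Rightarrow> ('a \<Rightarrow> 'a) \<Rightarrow> bool" where
  "weak_surf_grad \<Gamma> \<nu> v g \<longleftrightarrow>
     g \<in> L2_space (surface_measure \<Gamma>) \<and>
     (AE x in surface_measure \<Gamma>. g x \<bullet> \<nu> x = 0) \<and>
     (\<forall>\<phi>. C1_tangential_field \<Gamma> \<nu> \<phi> \<longrightarrow>
        (LINT x|surface_measure \<Gamma>. g x \<bullet> \<phi> x) =
        - (LINT x|surface_measure \<Gamma>. v x * surf_div \<nu> \<phi> x))"

definition surf_grad ::
    "'a::euclidean_space set \<Rightarrow> ('a \<Rightarrow> 'a) \<Rightarrow> ('a \<Rightarrow> real) \<Rightarrow> 'a \<Rightarrow> 'a" where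
  "surf_grad \<Gamma> \<nu> v = (SOME g. weak_surf_grad \<Gamma> \<nu> v g)"

definition H1_surf :: "'a::euclidean_space set \<Rightarrow> ('a \<Rightarrow> 'a) \<Rightarrow> ('a \<Rightarrow> real) set" where
  "H1_surf \<Gamma> \<nu> = {v \<in> L2_space (surface_measure \<Gamma>). \<exists>g. weak_surf_grad \<Gamma> \<nu> v g}"

definition ip_surf :: "'a::euclidean_space set \<Rightarrow> ('a \<Rightarrow> real) \<Rightarrow> ('a \<Rightarrow> real) \<Rightarrow> real" where
  "ip_surf \<Gamma> v w = (LINT x|surface_measure \<Gamma>. v x * w x)"

definition grad_ip_surf ::
    "'a::euclidean_space set \<Rightarrow> ('a \<Rightarrow> 'a) \<Rightarrow> ('a \<Rightarrow> real) \<Rightarrow> ('a \<Rightarrow> real) \<Rightarrow> real" where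
  "grad_ip_surf \<Gamma> \<nu> v w =
     (LINT x|surface_measure \<Gamma>. surf_grad \<Gamma> \<nu> v x \<bullet> surf_grad \<Gamma> \<nu> w x)"

definition H1_surf_norm :: "'a::euclidean_space set \<Rightarrow> ('a \<Rightarrow> 'a) \<Rightarrow> ('a \<Rightarrow> real) \<Rightarrow> real" where
  "H1_surf_norm \<Gamma> \<nu> v = sqrt (ip_surf \<Gamma> v v + grad_ip_surf \<Gamma> \<nu> v v)"

text \<open>Elements of the dual of \<open>H1_surf\<close> are represented by functionals on functions, the pairing
  being application; \<open>ip_surf \<Gamma> v\<close> is the functional representing the L2 function \<open>v\<close>.\<close>

definition Hm1_surf_norm ::
    "'a::euclidean_space set \<Rightarrow> ('a \<Rightarrow> 'a) \<Rightarrow> (('a \<Rightarrow> real) \<Rightarrow> real) \<Rightarrow> real" where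
  "Hm1_surf_norm \<Gamma> \<nu> f = (SUP w \<in> {w \<in> H1_surf \<Gamma> \<nu>. H1_surf_norm \<Gamma> \<nu> w \<le> 1}. \<bar>f w\<bar>)"

section \<open>Mesh and finite element space\<close>

definition mesh_surrounding :: "'a::euclidean_space set \<Rightarrow> 'a set set \<Rightarrow> bool" where
  "mesh_surrounding \<Gamma> M \<longleftrightarrow>
     finite M \<and>
     (\<forall>K\<in>M. compact K \<and> interior K \<noteq> {} \<and> closure (interior K) = K \<and> negligible (frontier K)) \<and>
     (\<forall>K\<in>M. \<forall>K'\<in>M. K \<noteq> K' \<longrightarrow> interior K \<inter> interior K' = {}) \<and>
     \<Gamma> \<subseteq> interior (\<Union>M)"

definition active_mesh :: "'a::euclidean_space set \<Rightarrow> 'a set set \<Rightarrow> 'a set set" where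
  "active_mesh \<Gamma> M = {K\<in>M. K \<inter> \<Gamma> \<noteq> {}}"

text \<open>The largest of the norms of the principal curvatures in L-infinity of \<open>\<Gamma> \<inter> K\<close>.\<close>

definition curvature_bound :: "'a::euclidean_space set \<Rightarrow> ('a \<Rightarrow> 'a) \<Rightarrow> 'a set \<Rightarrow> ennreal" where
  "curvature_bound \<Gamma> \<nu> K =
     (INF c \<in> {c. AE x in surface_measure \<Gamma>. x \<in> K \<longrightarrow>
                    (\<forall>\<kappa>\<in>principal_curvatures \<Gamma> \<nu> x. ennreal \<bar>\<kappa>\<bar> \<le> c)}. c)"

text \<open>The quotient of a positive number by \<open>0\<close> is infinite in \<open>ennreal\<close>, so the first condition is
  void on elements in which \<open>\<Gamma>\<close> is flat.\<close>

definition resolves_geometry ::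
    "'a::euclidean_space set \<Rightarrow> ('a \<Rightarrow> 'a) \<Rightarrow> 'a set set \<Rightarrow> real \<Rightarrow> bool" where
  "resolves_geometry \<Gamma> \<nu> Th C \<longleftrightarrow>
     0 < C \<and>
     (\<forall>K\<in>Th. ennreal (diameter K) \<le> ennreal C / curvature_bound \<Gamma> \<nu> K) \<and>
     (\<forall>x\<in>\<Union>Th. \<exists>!y. y \<in> \<Gamma> \<and> (\<forall>z\<in>\<Gamma>. dist x y \<le> dist x z))"

text \<open>Elements of the space are functions on the union of the active elements; they are extended
  by zero to make the representation by functions on the whole space unique.\<close>

definition fe_space ::
    "'a::euclidean_space set \<Rightarrow> ('a \<Rightarrow> 'a) \<Rightarrow> 'a set set \<Rightarrow> ('a \<Rightarrow> real) set \<Rightarrow> bool" where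
  "fe_space \<Gamma> \<nu> Th V \<longleftrightarrow>
     (\<exists>(N::nat) \<phi>. V = {v. \<exists>c :: nat \<Rightarrow> real. v = (\<lambda>x. \<Sum>i<N. c i * \<phi> i x)}) \<and>
     (\<forall>v\<in>V. continuous_on (\<Union>Th) v \<and>
        (\<forall>x. x \<notin> \<Union>Th \<longrightarrow> v x = 0) \<and>
        (\<forall>K\<in>Th. \<exists>q. real_polynomial_function q \<and> (\<forall>x\<in>K. v x = q x)) \<and>
        v \<in> H1_surf \<Gamma> \<nu>)"

definition inner_product_on ::
    "('a \<Rightarrow> real) set \<Rightarrow> (('a \<Rightarrow> real) \<Rightarrow> ('a \<Rightarrow> real) \<Rightarrow> real) \<Rightarrow> bool" where
  "inner_product_on V B \<longleftrightarrow>
     (\<forall>u\<in>V. \<forall>v\<in>V. B u v = B v u) \<and>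
     (\<forall>u\<in>V. \<forall>v\<in>V. \<forall>w\<in>V. \<forall>a. B (\<lambda>x. a * u x + v x) w = a * B u w + B v w) \<and>
     (\<forall>v\<in>V. v \<noteq> (\<lambda>x. 0) \<longrightarrow> 0 < B v v)"

section \<open>Stabilised forms and norms\<close>

definition normal_deriv ::
    "'a::euclidean_space set \<Rightarrow> ('a \<Rightarrow> 'a) \<Rightarrow> ('a \<Rightarrow> real) \<Rightarrow> 'a \<Rightarrow> real" where
  "normal_deriv \<Gamma> \<nu> v x = frechet_derivative v (at x) (\<nu> (closest_point \<Gamma> x))"

text \<open>On the boundary of \<open>K\<close>, a null set, the Frechet derivative may fail to exist; the complete
  measure \<open>lebesgue\<close> makes its values there irrelevant also for measurability.\<close>

definition stab_local ::
    "'a::euclidean_space set \<Rightarrow> ('a \<Rightarrow> 'a) \<Rightarrow> int \<Rightarrow> 'a set \<Rightarrow> ('a \<Rightarrow> real) \<Rightarrow> ('a \<Rightarrow> real) \<Rightarrow> real" where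
  "stab_local \<Gamma> \<nu> j K v w =
     diameter K powi (1 - 2 * j) *
     (LINT x:K|lebesgue. normal_deriv \<Gamma> \<nu> v x * normal_deriv \<Gamma> \<nu> w x)"

definition stab ::
    "'a::euclidean_space set \<Rightarrow> ('a \<Rightarrow> 'a) \<Rightarrow> 'a set set \<Rightarrow> int \<Rightarrow> ('a \<Rightarrow> real) \<Rightarrow> ('a \<Rightarrow> real) \<Rightarrow> real" where
  "stab \<Gamma> \<nu> Th j v w = (\<Sum>K\<in>Th. stab_local \<Gamma> \<nu> j K v w)"

definition ip_star ::
    "'a::euclidean_space set \<Rightarrow> ('a \<Rightarrow> 'a) \<Rightarrow> 'a set set \<Rightarrow> ('a \<Rightarrow> real) \<Rightarrow> ('a \<Rightarrow> real) \<Rightarrow> real" where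
  "ip_star \<Gamma> \<nu> Th v w = ip_surf \<Gamma> v w + stab \<Gamma> \<nu> Th 0 v w"

definition a_star ::
    "'a::euclidean_space set \<Rightarrow> ('a \<Rightarrow> 'a) \<Rightarrow> 'a set set \<Rightarrow> ('a \<Rightarrow> real) \<Rightarrow> ('a \<Rightarrow> real) \<Rightarrow> real" where
  "a_star \<Gamma> \<nu> Th v w = grad_ip_surf \<Gamma> \<nu> v w + stab \<Gamma> \<nu> Th 1 v w"

definition H1_star_seminorm ::
    "'a::euclidean_space set \<Rightarrow> ('a \<Rightarrow> 'a) \<Rightarrow> 'a set set \<Rightarrow> ('a \<Rightarrow> real) \<Rightarrow> real" where
  "H1_star_seminorm \<Gamma> \<nu> Th v = sqrt (a_star \<Gamma> \<nu> Th v v)"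

definition H1_star_norm ::
    "'a::euclidean_space set \<Rightarrow> ('a \<Rightarrow> 'a) \<Rightarrow> 'a set set \<Rightarrow> ('a \<Rightarrow> real) \<Rightarrow> real" where
  "H1_star_norm \<Gamma> \<nu> Th v = sqrt ((H1_surf_norm \<Gamma> \<nu> v)\<^sup>2 + stab \<Gamma> \<nu> Th 1 v v)"

definition L2_star_norm ::
    "'a::euclidean_space set \<Rightarrow> ('a \<Rightarrow> 'a) \<Rightarrow> 'a set set \<Rightarrow> ('a \<Rightarrow> real) \<Rightarrow> real" where
  "L2_star_norm \<Gamma> \<nu> Th v = sqrt (ip_surf \<Gamma> v v + stab \<Gamma> \<nu> Th 0 v v)"

definition Hm1_star_norm ::
    "'a::euclidean_space set \<Rightarrow> ('a \<Rightarrow> 'a) \<Rightarrow> 'a set set \<Rightarrow> ('a \<Rightarrow> real) \<Rightarrow> real" where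
  "Hm1_star_norm \<Gamma> \<nu> Th v =
     sqrt ((Hm1_surf_norm \<Gamma> \<nu> (ip_surf \<Gamma> v))\<^sup>2 + stab \<Gamma> \<nu> Th (-1) v v)"

definition L2_star_norm_local ::
    "'a::euclidean_space set \<Rightarrow> ('a \<Rightarrow> 'a) \<Rightarrow> 'a set \<Rightarrow> ('a \<Rightarrow> real) \<Rightarrow> real" where
  "L2_star_norm_local \<Gamma> \<nu> K v =
     sqrt ((LINT x:\<Gamma> \<inter> K|surface_measure \<Gamma>. (v x)\<^sup>2) + stab_local \<Gamma> \<nu> 0 K v v)"

section \<open>Projection, discrete dual norm and inverse parameter\<close>

definition proj_star ::
    "'a::euclidean_space set \<Rightarrow> ('a \<Rightarrow> 'a) \<Rightarrow> 'a set set \<Rightarrow> ('a \<Rightarrow> real) set \<Rightarrow>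
     (('a \<Rightarrow> real) \<Rightarrow> real) \<Rightarrow> 'a \<Rightarrow> real" where
  "proj_star \<Gamma> \<nu> Th V f = (THE w. w \<in> V \<and> (\<forall>v\<in>V. ip_star \<Gamma> \<nu> Th w v = f v))"

definition proj_norm_H1 ::
    "'a::euclidean_space set \<Rightarrow> ('a \<Rightarrow> 'a) \<Rightarrow> 'a set set \<Rightarrow> ('a \<Rightarrow> real) set \<Rightarrow> ennreal" where
  "proj_norm_H1 \<Gamma> \<nu> Th V =
     (SUP v \<in> {v \<in> H1_surf \<Gamma> \<nu>. H1_surf_norm \<Gamma> \<nu> v \<noteq> 0}.
        ennreal (H1_surf_norm \<Gamma> \<nu> (proj_star \<Gamma> \<nu> Th V (ip_surf \<Gamma> v)) / H1_surf_norm \<Gamma> \<nu> v))"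

definition proj_norm_H1_star ::
    "'a::euclidean_space set \<Rightarrow> ('a \<Rightarrow> 'a) \<Rightarrow> 'a set set \<Rightarrow> ('a \<Rightarrow> real) set \<Rightarrow> ennreal" where
  "proj_norm_H1_star \<Gamma> \<nu> Th V =
     (SUP v \<in> {v \<in> H1_surf \<Gamma> \<nu>. H1_surf_norm \<Gamma> \<nu> v \<noteq> 0}.
        ennreal (H1_star_norm \<Gamma> \<nu> Th (proj_star \<Gamma> \<nu> Th V (ip_surf \<Gamma> v)) / H1_surf_norm \<Gamma> \<nu> v))"

definition discrete_dual_norm ::
    "'a::euclidean_space set \<Rightarrow> ('a \<Rightarrow> 'a) \<Rightarrow> 'a set set \<Rightarrow> ('a \<Rightarrow> real) set \<Rightarrow>
     ('a \<Rightarrow> real) \<Rightarrow> real" where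
  "discrete_dual_norm \<Gamma> \<nu> Th V v =
     (SUP w \<in> V - {\<lambda>x. 0}. ip_star \<Gamma> \<nu> Th v w / H1_star_norm \<Gamma> \<nu> Th w)"

definition inverse_parameter ::
    "'a::euclidean_space set \<Rightarrow> ('a \<Rightarrow> 'a) \<Rightarrow> 'a set set \<Rightarrow> ('a \<Rightarrow> real) set \<Rightarrow> ennreal" where
  "inverse_parameter \<Gamma> \<nu> Th V =
     (SUP v \<in> V - {\<lambda>x. 0}.
        ennreal (sqrt (\<Sum>K\<in>Th. (diameter K)\<^sup>2 * (L2_star_norm_local \<Gamma> \<nu> K v)\<^sup>2)
                 / discrete_dual_norm \<Gamma> \<nu> Th V v))"

section \<open>Bochner spaces and the parabolic form\<close>

text \<open>Functions of time take values in a finite-dimensional space \<open>V\<close> of functions. Measurability,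
  square integrability, continuity and weak differentiability are expressed through the linear
  functionals on \<open>V\<close>; as \<open>V\<close> is finite-dimensional, they are all continuous for its norm topology
  and this agrees with the strong notions.\<close>

definition linear_functional_on :: "('a \<Rightarrow> real) set \<Rightarrow> (('a \<Rightarrow> real) \<Rightarrow> real) \<Rightarrow> bool" where
  "linear_functional_on V l \<longleftrightarrow>
     (\<forall>u\<in>V. \<forall>v\<in>V. \<forall>a. l (\<lambda>x. a * u x + v x) = a * l u + l v)"

definition L2_time :: "('a \<Rightarrow> real) set \<Rightarrow> real \<Rightarrow> (real \<Rightarrow> 'a \<Rightarrow> real) set" where
  "L2_time V T = {v. (\<forall>t\<in>{0<..<T}. v t \<in> V) \<and>
     (\<forall>l. linear_functional_on V l \<longrightarrow>
        set_borel_measurable lborel {0<..<T} (\<lambda>t. l (v t)) \<and>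
        set_integrable lborel {0<..<T} (\<lambda>t. (l (v t))\<^sup>2))}"

definition time_test_function :: "real \<Rightarrow> (real \<Rightarrow> real) \<Rightarrow> bool" where
  "time_test_function T \<phi> \<longleftrightarrow>
     (\<forall>t. \<phi> field_differentiable at t) \<and> continuous_on UNIV (deriv \<phi>) \<and>
     (\<exists>a b. 0 < a \<and> b < T \<and> (\<forall>t. t \<notin> {a..b} \<longrightarrow> \<phi> t = 0))"

definition weak_time_deriv ::
    "('a \<Rightarrow> real) set \<Rightarrow> real \<Rightarrow> (real \<Rightarrow> 'a \<Rightarrow> real) \<Rightarrow> (real \<Rightarrow> 'a \<Rightarrow> real) \<Rightarrow> bool" where
  "weak_time_deriv V T u g \<longleftrightarrow>
     g \<in> L2_time V T \<and>
     (\<forall>l. linear_functional_on V l \<longrightarrow> (\<forall>\<phi>. time_test_function T \<phi> \<longrightarrow>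
        (LINT t:{0<..<T}|lborel. deriv \<phi> t * l (u t)) =
        - (LINT t:{0<..<T}|lborel. \<phi> t * l (g t))))"

definition time_deriv ::
    "('a \<Rightarrow> real) set \<Rightarrow> real \<Rightarrow> (real \<Rightarrow> 'a \<Rightarrow> real) \<Rightarrow> real \<Rightarrow> 'a \<Rightarrow> real" where
  "time_deriv V T u = (SOME g. weak_time_deriv V T u g)"

text \<open>Elements of the trial space are taken as their representatives that are continuous on the
  closed time interval, so that the initial value is meaningful.\<close>

definition trial_space :: "('a \<Rightarrow> real) set \<Rightarrow> real \<Rightarrow> (real \<Rightarrow> 'a \<Rightarrow> real) set" where
  "trial_space V T = {u. (\<forall>t\<in>{0..T}. u t \<in> V) \<and>
     (\<forall>l. linear_functional_on V l \<longrightarrow> continuous_on {0..T} (\<lambda>t. l (u t))) \<and>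
     (\<exists>g. weak_time_deriv V T u g)}"

definition test_space ::
    "('a \<Rightarrow> real) set \<Rightarrow> real \<Rightarrow> (('a \<Rightarrow> real) \<times> (real \<Rightarrow> 'a \<Rightarrow> real)) set" where
  "test_space V T = V \<times> L2_time V T"

definition nonzero_trials :: "('a \<Rightarrow> real) set \<Rightarrow> real \<Rightarrow> (real \<Rightarrow> 'a \<Rightarrow> real) set" where
  "nonzero_trials V T = {u \<in> trial_space V T. \<exists>t\<in>{0..T}. u t \<noteq> (\<lambda>x. 0)}"

definition nonzero_tests ::
    "('a \<Rightarrow> real) set \<Rightarrow> real \<Rightarrow> (('a \<Rightarrow> real) \<times> (real \<Rightarrow> 'a \<Rightarrow> real)) set" where
  "nonzero_tests V T = {(v0, v1) \<in> test_space V T.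
     \<not> (v0 = (\<lambda>x. 0) \<and> (AE t in lborel. t \<in> {0<..<T} \<longrightarrow> v1 t = (\<lambda>x. 0)))}"

definition b_form ::
    "'a::euclidean_space set \<Rightarrow> ('a \<Rightarrow> 'a) \<Rightarrow> 'a set set \<Rightarrow> ('a \<Rightarrow> real) set \<Rightarrow> real \<Rightarrow>
     (real \<Rightarrow> 'a \<Rightarrow> real) \<Rightarrow> ('a \<Rightarrow> real) \<times> (real \<Rightarrow> 'a \<Rightarrow> real) \<Rightarrow> real" where
  "b_form \<Gamma> \<nu> Th V T u v =
     ip_star \<Gamma> \<nu> Th (u 0) (fst v) +
     (LINT t:{0<..<T}|lborel.
        ip_star \<Gamma> \<nu> Th (time_deriv V T u t) (snd v t) + a_star \<Gamma> \<nu> Th (u t) (snd v t))"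

definition trial_norm ::
    "'a::euclidean_space set \<Rightarrow> ('a \<Rightarrow> 'a) \<Rightarrow> 'a set set \<Rightarrow> ('a \<Rightarrow> real) set \<Rightarrow> real \<Rightarrow>
     (real \<Rightarrow> 'a \<Rightarrow> real) \<Rightarrow> real" where
  "trial_norm \<Gamma> \<nu> Th V T u =
     sqrt ((L2_star_norm \<Gamma> \<nu> Th (u 0))\<^sup>2 +
       (LINT t:{0<..<T}|lborel.
          (Hm1_star_norm \<Gamma> \<nu> Th (time_deriv V T u t))\<^sup>2 + (H1_star_seminorm \<Gamma> \<nu> Th (u t))\<^sup>2))"

definition test_norm ::
    "'a::euclidean_space set \<Rightarrow> ('a \<Rightarrow> 'a) \<Rightarrow> 'a set set \<Rightarrow> real \<Rightarrow>
     ('a \<Rightarrow> real) \<times> (real \<Rightarrow> 'a \<Rightarrow> real) \<Rightarrow> real" where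
  "test_norm \<Gamma> \<nu> Th T v =
     sqrt ((L2_star_norm \<Gamma> \<nu> Th (fst v))\<^sup>2 +
       (LINT t:{0<..<T}|lborel. (H1_star_norm \<Gamma> \<nu> Th (snd v t))\<^sup>2))"

definition inf_sup_constant ::
    "'a::euclidean_space set \<Rightarrow> ('a \<Rightarrow> 'a) \<Rightarrow> 'a set set \<Rightarrow> ('a \<Rightarrow> real) set \<Rightarrow> real \<Rightarrow> ereal" where
  "inf_sup_constant \<Gamma> \<nu> Th V T =
     (INF u \<in> nonzero_trials V T. SUP v \<in> nonzero_tests V T.
        ereal (b_form \<Gamma> \<nu> Th V T u v / (trial_norm \<Gamma> \<nu> Th V T u * test_norm \<Gamma> \<nu> Th T v)))"

end

theory Submission
  imports Defs
begin

text \<open>Throughout, \<open>B = (\<cdot>,\<cdot>)\<^sub>*\<close>, \<open>a = a\<^sub>*\<close>, and \<open>K\<close> is the inner product of the norm \<open>H\<^sup>1\<^sub>*\<close>; let \<open>R\<close> map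
  \<open>v\<close> in \<open>V\<close> to the Riesz representer of \<open>B v\<close> in the inner product \<open>K\<close>. Then the discrete dual norm
  of \<open>v\<close> is \<open>sqrt (K (R v) (R v))\<close>.

  Lower bound. For a trial function \<open>u\<close> with initial value \<open>u\<^sub>0\<close> and derivative \<open>u'\<close>, let \<open>X\<close> be the
  square of its trial norm with the discrete dual norm of \<open>u'\<close> in place of the stabilised norm of
  order minus one. The test function \<open>(u\<^sub>0, u + R u')\<close> gives \<open>b \<ge> X / 2\<close>, and the energy equation bounds
  its norm by \<open>sqrt 2 (1 + 2 T) sqrt X\<close> (lemma \<open>discrete_inf_sup_estimate\<close>). The two dual norms are
  compared by \<open>discrete dual \<le> H\<^sup>-\<^sup>1\<^sub>* \<le> (\<parallel>P\<parallel> + C\<^sub>i\<^sub>n\<^sub>v) discrete dual\<close> (lemmas \<open>dual_le_Hm1_star\<close> and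
  \<open>Hm1_star_le_dual\<close>): the projection enters through \<open>(v, w)\<^sub>\<Gamma> = (v, P w)\<^sub>*\<close>, the inverse parameter
  through \<open>s\<^sub>-\<^sub>1 = \<Sum> h\<^sub>T\<^sup>2 s\<^sub>0\<^sub>,\<^sub>T\<close>. In particular \<open>\<parallel>P\<parallel> + C\<^sub>i\<^sub>n\<^sub>v \<ge> 1\<close>, so that the same factor also serves for
  the remaining terms of the trial norm.

  Upper bound. Given \<open>z\<close> in \<open>H\<^sup>1(\<Gamma>)\<close>, choose \<open>w\<close> in \<open>V\<close> with \<open>R w = P z\<close> and the trial function
  \<open>t\<^sup>m w\<close>. For large \<open>m\<close> its time derivative dominates: the supremum over the test functions is at
  most \<open>sqrt 2\<close> times the discrete dual norm of the derivative, square integrated in time, while the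
  trial norm is bounded below by the \<open>H\<^sup>-\<^sup>1(\<Gamma>)\<close> norm of the derivative, hence by its pairing with \<open>z\<close>.
  Without the factor \<open>sqrt 2\<close>, the quotient of the two is at most \<open>\<parallel>z\<parallel> / \<parallel>P z\<parallel>\<close> (lemma \<open>upper_bound_trial\<close>).

  What these arguments take for granted has to be derived from the definitions. The surface gradient
  is a choice among weak gradients, so its linearity rests on uniqueness (lemma
  \<open>weak_surf_grad_unique\<close>); this needs finite surface measure (\<open>finite_surface_measure\<close>) and enough
  tangential test fields (\<open>chart_test_field\<close>). The time derivative is likewise a choice, and the
  energy equation for it rests on the fundamental theorem of calculus for weak derivatives
  (\<open>weak_derivative_integral\<close>).\<close>

section \<open>Finiteness of the surface measure\<close>

text \<open>Finite upper Minkowski content of dimension \<open>m\<close>, up to constants: at every scale \<open>r\<close>, of the order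
  of \<open>r\<^sup>-\<^sup>m\<close> sets of diameter at most \<open>r\<close> suffice to cover. The number of sets is controlled at all
  small scales, and not only for a sequence of them, so that finite unions are immediate.\<close>
definition finite_content :: "nat \<Rightarrow> 'a::metric_space set \<Rightarrow> bool" where
  "finite_content m A \<longleftrightarrow>
     (\<exists>c. \<forall>r. 0 < r \<and> r \<le> 1 \<longrightarrow>
        (\<exists>\<C>. finite \<C> \<and> real (card \<C>) * r ^ m \<le> c \<and> A \<subseteq> \<Union>\<C> \<and>
              (\<forall>C\<in>\<C>. bounded C \<and> diameter C \<le> r)))"

lemma finite_content_empty: "finite_content m {}"
  unfolding finite_content_def by (intro exI[of _ 0] allI impI exI[of _ "{}"]) simp

lemma finite_content_subset: "finite_content m B \<Longrightarrow> A \<subseteq> B \<Longrightarrow> finite_content m A"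
  unfolding finite_content_def by (meson subset_trans)

lemma finite_content_Un:
  assumes "finite_content m A" "finite_content m B"
  shows "finite_content m (A \<union> B)"
proof -
  obtain c where c: "\<And>r. 0 < r \<and> r \<le> 1 \<Longrightarrow>
        (\<exists>\<C>. finite \<C> \<and> real (card \<C>) * r ^ m \<le> c \<and> A \<subseteq> \<Union>\<C> \<and> (\<forall>C\<in>\<C>. bounded C \<and> diameter C \<le> r))"
    using assms(1) unfolding finite_content_def by blast
  obtain d where d: "\<And>r. 0 < r \<and> r \<le> 1 \<Longrightarrow>
        (\<exists>\<C>. finite \<C> \<and> real (card \<C>) * r ^ m \<le> d \<and> B \<subseteq> \<Union>\<C> \<and> (\<forall>C\<in>\<C>. bounded C \<and> diameter C \<le> r))"
    using assms(2) unfolding finite_content_def by blast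
  show ?thesis unfolding finite_content_def
  proof (intro exI[of _ "c + d"] allI impI)
    fix r :: real assume r: "0 < r \<and> r \<le> 1"
    obtain \<A> where \<A>: "finite \<A>" "real (card \<A>) * r ^ m \<le> c" "A \<subseteq> \<Union>\<A>"
        "\<forall>C\<in>\<A>. bounded C \<and> diameter C \<le> r" using c[OF r] by blast
    obtain \<B> where \<B>: "finite \<B>" "real (card \<B>) * r ^ m \<le> d" "B \<subseteq> \<Union>\<B>"
        "\<forall>C\<in>\<B>. bounded C \<and> diameter C \<le> r" using d[OF r] by blast
    have "real (card (\<A> \<union> \<B>)) * r ^ m \<le> (real (card \<A>) + real (card \<B>)) * r ^ m"
      using r by (intro mult_right_mono) (metis card_Un_le of_nat_add of_nat_mono, simp)
    also have "\<dots> \<le> c + d" using \<A>(2) \<B>(2) by (simp add: distrib_right)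
    finally show "\<exists>\<C>. finite \<C> \<and> real (card \<C>) * r ^ m \<le> c + d \<and> A \<union> B \<subseteq> \<Union>\<C> \<and>
        (\<forall>C\<in>\<C>. bounded C \<and> diameter C \<le> r)"
      using \<A> \<B> by (intro exI[of _ "\<A> \<union> \<B>"]) auto
  qed
qed

lemma finite_content_UN:
  assumes "finite I" "\<And>i. i \<in> I \<Longrightarrow> finite_content m (A i)"
  shows "finite_content m (\<Union>i\<in>I. A i)"
  using assms
proof (induction I rule: finite_induct)
  case (insert i I)
  then show ?case using finite_content_Un[of m "A i" "\<Union>i\<in>I. A i"] by auto
qed (simp add: finite_content_empty)

lemma hausdorff_outer_finite:
  fixes A :: "'a::metric_space set"
  assumes "finite_content m A"
  shows "hausdorff_outer m A < \<infinity>"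
proof -
  obtain c where c: "\<And>r. 0 < r \<and> r \<le> 1 \<Longrightarrow>
        (\<exists>\<C>. finite \<C> \<and> real (card \<C>) * r ^ m \<le> c \<and> A \<subseteq> \<Union>\<C> \<and> (\<forall>C\<in>\<C>. bounded C \<and> diameter C \<le> r))"
    using assms unfolding finite_content_def by blast
  have "hausdorff_premeasure m \<delta> A \<le> ennreal (unit_ball_vol m * c)" if "0 < \<delta>" for \<delta>
  proof -
    define r where "r = min \<delta> 1"
    have r: "0 < r \<and> r \<le> 1" "r \<le> \<delta>" using that by (auto simp: r_def)
    obtain \<A> where \<A>: "finite \<A>" "real (card \<A>) * r ^ m \<le> c" "A \<subseteq> \<Union>\<A>"
        "\<forall>C\<in>\<A>. bounded C \<and> diameter C \<le> r" using c[OF r(1)] by blast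
    obtain f where f: "bij_betw f {0..<card \<A>} \<A>" using ex_bij_betw_nat_finite[OF \<A>(1)] by blast
    define F where "F i = (if i < card \<A> then f i else {})" for i
    have FA: "F i \<in> \<A>" if "i < card \<A>" for i
      using that f by (auto simp: F_def bij_betw_def)
    have cover: "A \<subseteq> (\<Union>i. F i)"
    proof
      fix x assume "x \<in> A"
      then obtain C where "C \<in> \<A>" "x \<in> C" using \<A>(3) by blast
      then have "C \<in> f ` {0..<card \<A>}" using bij_betw_imp_surj_on[OF f] by simp
      then obtain i where "i < card \<A>" "C = f i" by auto
      then show "x \<in> (\<Union>i. F i)" using \<open>x \<in> C\<close> by (auto simp: F_def)
    qed
    have small: "bounded (F i) \<and> diameter (F i) \<le> \<delta>" for i
      using \<A>(4) FA[of i] r(2) that by (cases "i < card \<A>") (force simp: F_def)+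
    let ?t = "\<lambda>i. if F i = {} then 0 else ennreal (unit_ball_vol m * (diameter (F i) / 2) ^ m)"
    have "hausdorff_premeasure m \<delta> A \<le> (\<Sum>i. ?t i)"
      unfolding hausdorff_premeasure_def by (rule INF_lower) (use cover small in auto)
    also have "(\<Sum>i. ?t i) = (\<Sum>i<card \<A>. ?t i)"
      by (rule suminf_finite) (auto simp: F_def)
    also have "\<dots> \<le> (\<Sum>i<card \<A>. ennreal (unit_ball_vol m * r ^ m))"
    proof (rule sum_mono)
      fix i assume "i \<in> {..<card \<A>}"
      then have "diameter (F i) \<le> r" "bounded (F i)" using FA \<A>(4) by auto
      then have "(diameter (F i) / 2) ^ m \<le> r ^ m" using diameter_ge_0[of "F i"]
        by (intro power_mono) auto
      then show "?t i \<le> ennreal (unit_ball_vol m * r ^ m)"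
        by (auto intro!: ennreal_leI mult_left_mono)
    qed
    also have "\<dots> = ennreal (real (card \<A>) * (unit_ball_vol m * r ^ m))"
      using r by (subst sum_ennreal) auto
    also have "\<dots> \<le> ennreal (unit_ball_vol m * c)"
      using mult_left_mono[OF \<A>(2), of "unit_ball_vol m"] by (intro ennreal_leI) (simp add: mult_ac)
    finally show ?thesis .
  qed
  then have "hausdorff_outer m A \<le> ennreal (unit_ball_vol m * c)"
    unfolding hausdorff_outer_def by (intro SUP_least) auto
  then show ?thesis by (simp add: order_le_less_trans)
qed

text \<open>The hypothesis says that the projection along \<open>b\<close> has a Lipschitz inverse on \<open>A\<close>. A cell consists
  of the points whose projections lie in the same cube of side \<open>s\<close>.\<close>
lemma finite_content_graph:
  fixes A :: "'a::euclidean_space set"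
  assumes b: "b \<in> Basis" and bA: "bounded A" and L: "0 < L"
    and lip: "\<And>y z. y \<in> A \<Longrightarrow> z \<in> A \<Longrightarrow> norm (y - z) \<le> L * (\<Sum>i\<in>Basis - {b}. \<bar>(y - z) \<bullet> i\<bar>)"
  shows "finite_content (DIM('a) - 1) A"
proof -
  let ?I = "Basis - {b}" and ?n = "DIM('a) - 1"
  obtain R where R: "R > 0" "\<And>x. x \<in> A \<Longrightarrow> norm x \<le> R"
    using bA by (meson bounded_pos)
  have cI: "card ?I = ?n" using b by simp
  define q where "q = L * (1 + real ?n)"
  have q: "q > 0" unfolding q_def using L by (intro mult_pos_pos) auto
  show ?thesis unfolding finite_content_def
  proof (intro exI[of _ "(2 * R * q + 5) ^ ?n"] allI impI)
    fix r :: real assume r: "0 < r \<and> r \<le> 1"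
    define s where "s = r / q"
    have s: "s > 0" using r q by (simp add: s_def)
    define M where "M = \<lceil>R / s\<rceil> + 1"
    have M: "M \<ge> 1" "real_of_int M \<le> R / s + 2" 
    proof -
      have "0 \<le> R / s" using R(1) s by simp
      then show "M \<ge> 1" "real_of_int M \<le> R / s + 2" unfolding M_def by linarith+
    qed
    define D where "D = PiE ?I (\<lambda>_. {-M..M})"
    define cell where "cell k = {y\<in>A. \<forall>i\<in>?I. \<lfloor>y \<bullet> i / s\<rfloor> = k i}" for k
    have finD: "finite D" unfolding D_def by (intro finite_PiE) auto
    have "card D = (nat (2 * M + 1)) ^ ?n"
      unfolding D_def using cI by (simp add: card_PiE)
    then have "real (card D) = (2 * real_of_int M + 1) ^ ?n" using M(1) by simp
    moreover have "(2 * real_of_int M + 1) * r \<le> 2 * R * q + 5"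
    proof -
      have "(2 * real_of_int M + 1) * r \<le> (2 * (R / s) + 5) * r"
        using M r by (intro mult_right_mono) auto
      also have "\<dots> = 2 * R * q + 5 * r" using r q by (simp add: s_def field_simps)
      finally show ?thesis using r by linarith
    qed
    ultimately have cardD: "real (card D) * r ^ ?n \<le> (2 * R * q + 5) ^ ?n"
      using M r by (simp add: power_mult_distrib[symmetric] power_mono)
    have 1: "card (cell ` D) \<le> card D" by (rule card_image_le[OF finD])
    have "real (card (cell ` D)) * r ^ ?n \<le> real (card D) * r ^ ?n"
      using 1 r by (intro mult_right_mono) auto
    with cardD have card: "real (card (cell ` D)) * r ^ ?n \<le> (2 * R * q + 5) ^ ?n" by linarith
    have cover: "A \<subseteq> \<Union>(cell ` D)"
    proof
      fix y assume y: "y \<in> A"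
      let ?k = "\<lambda>i\<in>?I. \<lfloor>y \<bullet> i / s\<rfloor>"
      have "\<lfloor>y \<bullet> i / s\<rfloor> \<in> {-M..M}" if "i \<in> ?I" for i
      proof -
        have "\<bar>y \<bullet> i\<bar> \<le> R" using R(2)[OF y] Basis_le_norm[of i y] that by auto
        then have "- (R / s) \<le> y \<bullet> i / s" "y \<bullet> i / s \<le> R / s"
          using s by (auto simp: field_simps)
        then have "- \<lceil>R / s\<rceil> - 1 \<le> \<lfloor>y \<bullet> i / s\<rfloor>" "\<lfloor>y \<bullet> i / s\<rfloor> \<le> \<lceil>R / s\<rceil> + 1" by linarith+
        then show ?thesis by (simp add: M_def)
      qed
      then have "?k \<in> D" unfolding D_def by auto
      moreover have "y \<in> cell ?k" using y by (auto simp: cell_def)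
      ultimately show "y \<in> \<Union>(cell ` D)" by blast
    qed
    have small: "bounded (cell k) \<and> diameter (cell k) \<le> r" for k
    proof
      show "bounded (cell k)" by (rule bounded_subset[OF bA]) (auto simp: cell_def)
      show "diameter (cell k) \<le> r"
      proof (rule diameter_le)
        show "cell k \<noteq> {} \<or> 0 \<le> r" using r by auto
        fix y z assume y: "y \<in> cell k" and z: "z \<in> cell k"
        have "\<bar>(y - z) \<bullet> i\<bar> \<le> s" if "i \<in> ?I" for i
        proof -
          have "\<lfloor>y \<bullet> i / s\<rfloor> = \<lfloor>z \<bullet> i / s\<rfloor>" using y z that by (auto simp: cell_def)
          then have "\<bar>y \<bullet> i / s - z \<bullet> i / s\<bar> \<le> 1" by linarith
          then have "\<bar>(y - z) \<bullet> i / s\<bar> \<le> 1" by (simp add: inner_diff_left diff_divide_distrib)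
          then show ?thesis using s by simp
        qed
        then have "(\<Sum>i\<in>?I. \<bar>(y - z) \<bullet> i\<bar>) \<le> real ?n * s"
          using sum_bounded_above[of ?I "\<lambda>i. \<bar>(y - z) \<bullet> i\<bar>" s] cI by simp
        then have "L * (\<Sum>i\<in>?I. \<bar>(y - z) \<bullet> i\<bar>) \<le> L * (real ?n * s)"
          using L by (intro mult_left_mono) auto
        moreover have "y \<in> A" "z \<in> A" using y z by (auto simp: cell_def)
        ultimately have "norm (y - z) \<le> L * (real ?n * s)" using lip[of y z] by linarith
        also have "\<dots> \<le> q * s" unfolding q_def using L s by (simp add: algebra_simps)
        also have "\<dots> = r" using q by (simp add: s_def)
        finally show "norm (y - z) \<le> r" .
      qed
    qed
    show "\<exists>\<C>. finite \<C> \<and> real (card \<C>) * r ^ ?n \<le> (2 * R * q + 5) ^ ?n \<and> A \<subseteq> \<Union>\<C> \<and>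
        (\<forall>C\<in>\<C>. bounded C \<and> diameter C \<le> r)"
      using finD card cover small by (intro exI[of _ "cell ` D"]) auto
  qed
qed

lemma C2_defining_continuous:
  assumes "C2_defining \<Gamma> U \<phi> G"
  shows "continuous_on U G"
proof -
  obtain H :: "'a \<Rightarrow> 'a \<Rightarrow>\<^sub>L 'a" where H: "\<And>x. x \<in> U \<Longrightarrow> (G has_derivative blinfun_apply (H x)) (at x)"
    using assms by (auto simp: C2_defining_def)
  show ?thesis by (rule has_derivative_continuous_on[OF has_derivative_at_withinI[OF H]])
qed

text \<open>No implicit function is needed: for two points of a level set near \<open>x0\<close>, the mean value theorem
  makes the gradient at \<open>x0\<close> almost orthogonal to their difference, which bounds one coordinate of the
  difference by the others.\<close>
lemma finite_content_chart:
  fixes \<Gamma> :: "'a::euclidean_space set"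
  assumes C2: "C2_defining \<Gamma> U \<phi> G" and x: "x0 \<in> U"
  shows "\<exists>W. open W \<and> x0 \<in> W \<and> finite_content (DIM('a) - 1) (\<Gamma> \<inter> W)"
proof -
  have opU: "open U" and der: "\<And>x. x \<in> U \<Longrightarrow> (\<phi> has_derivative (\<lambda>h. h \<bullet> G x)) (at x)"
    and nz: "G x0 \<noteq> 0" and zero: "\<Gamma> \<inter> U = {x\<in>U. \<phi> x = 0}"
    using C2 x unfolding C2_defining_def gderiv_def by auto
  obtain b where b: "b \<in> Basis" "G x0 \<bullet> b \<noteq> 0"
    using nz euclidean_all_zero_iff by blast
  define g where "g = \<bar>G x0 \<bullet> b\<bar>"
  have g: "g > 0" using b by (simp add: g_def)
  have "isCont G x0" using C2_defining_continuous[OF C2] opU x continuous_on_eq_continuous_at by blast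
  then obtain d where d: "d > 0" "\<And>x. dist x x0 < d \<Longrightarrow> dist (G x) (G x0) < g / 2"
    using g unfolding continuous_at_eps_delta by (metis half_gt_zero)
  obtain e where e: "e > 0" "ball x0 e \<subseteq> U" using opU x openE by blast
  define \<rho> where "\<rho> = min d e"
  have \<rho>: "\<rho> > 0" using d e by (simp add: \<rho>_def)
  let ?B = "ball x0 \<rho>"
  have BU: "?B \<subseteq> U" using e by (auto simp: \<rho>_def)
  define N where "N = norm (G x0)"
  define L where "L = 1 + (g / 2 + N) / (g / 2)"
  have N: "N \<ge> 0" by (simp add: N_def)
  have Lpos: "L > 0" unfolding L_def using g N by (intro add_pos_nonneg) auto
  have lip: "norm (y - z) \<le> L * (\<Sum>i\<in>Basis - {b}. \<bar>(y - z) \<bullet> i\<bar>)"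
    if y: "y \<in> \<Gamma> \<inter> ?B" and z: "z \<in> \<Gamma> \<inter> ?B" for y z
  proof -
    have "norm (\<phi> y - \<phi> z - (y - z) \<bullet> G x0) \<le> norm (y - z) * (g / 2)"
    proof (rule differentiable_bound_linearization[where S = ?B and f' = "\<lambda>x h. h \<bullet> G x"])
      show "z + t *\<^sub>R (y - z) \<in> ?B" if "t \<in> {0..1}" for t
      proof -
        have "(1 - t) *\<^sub>R z + t *\<^sub>R y \<in> ?B" using y z that
          by (intro convexD[OF convex_ball]) auto
        then show ?thesis by (simp add: algebra_simps)
      qed
      show "(\<phi> has_derivative (\<lambda>h. h \<bullet> G x)) (at x within ?B)" if "x \<in> ?B" for x
        using der BU that has_derivative_at_withinI by blast
      show "onorm ((\<lambda>h. h \<bullet> G x) - (\<lambda>h. h \<bullet> G x0)) \<le> g / 2" if "x \<in> ?B" for x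
      proof -
        have "dist (G x) (G x0) < g / 2" using d(2)[of x] that by (simp add: \<rho>_def dist_commute)
        then show ?thesis
          by (intro onorm_le) (smt (verit) Cauchy_Schwarz_ineq2 dist_norm fun_diff_def inner_diff_right
              mult.commute mult_left_mono norm_ge_zero real_norm_def)
      qed
      show "x0 \<in> ?B" using \<rho> by simp
    qed
    moreover have "\<phi> y = 0" "\<phi> z = 0" using y z zero BU by auto
    ultimately have small: "\<bar>(y - z) \<bullet> G x0\<bar> \<le> norm (y - z) * (g / 2)" by simp
    define w where "w = y - z"
    define S where "S = (\<Sum>i\<in>Basis - {b}. \<bar>w \<bullet> i\<bar>)"
    define u where "u = w - (w \<bullet> b) *\<^sub>R b"
    have bb: "b \<bullet> b = 1" using b(1) by simp
    have "norm u \<le> (\<Sum>i\<in>Basis. \<bar>u \<bullet> i\<bar>)" by (rule norm_le_l1)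
    also have "\<dots> = (\<Sum>i\<in>Basis - {b}. \<bar>u \<bullet> i\<bar>)"
      using b(1) bb by (subst sum.remove[of _ b]) (auto simp: u_def inner_diff_left)
    also have "\<dots> = S" unfolding S_def using b(1)
      by (intro sum.cong) (auto simp: u_def inner_diff_left inner_Basis)
    finally have u: "norm u \<le> S" .
    have w: "w = u + (w \<bullet> b) *\<^sub>R b" by (simp add: u_def)
    have nw: "norm w \<le> S + \<bar>w \<bullet> b\<bar>"
    proof -
      have "norm w \<le> norm u + norm ((w \<bullet> b) *\<^sub>R b)" using norm_triangle_ineq w by metis
      then show ?thesis using u b(1) by simp
    qed
    have "(w \<bullet> b) * (b \<bullet> G x0) = w \<bullet> G x0 - u \<bullet> G x0"
      by (simp add: u_def inner_diff_left)
    then have "\<bar>w \<bullet> b\<bar> * g = \<bar>w \<bullet> G x0 - u \<bullet> G x0\<bar>"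
      by (simp add: g_def abs_mult[symmetric] inner_commute)
    also have "\<dots> \<le> norm w * (g / 2) + S * N"
      using small Cauchy_Schwarz_ineq2[of u "G x0"] mult_right_mono[OF u, of N]
      by (auto simp: w_def N_def)
    also have "\<dots> \<le> (S + \<bar>w \<bullet> b\<bar>) * (g / 2) + S * N"
      using nw g by (intro add_right_mono mult_right_mono) auto
    finally have "\<bar>w \<bullet> b\<bar> * (g / 2) \<le> S * (g / 2 + N)" by (simp add: algebra_simps)
    then have "\<bar>w \<bullet> b\<bar> \<le> S * (g / 2 + N) / (g / 2)" using g by (simp add: pos_le_divide_eq)
    then have "norm w \<le> S + S * (g / 2 + N) / (g / 2)" using nw by linarith
    also have "\<dots> = L * S" by (simp add: L_def algebra_simps)
    finally show ?thesis by (simp add: w_def S_def)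
  qed
  have "finite_content (DIM('a) - 1) (\<Gamma> \<inter> ?B)"
    by (rule finite_content_graph[OF b(1) _ Lpos lip]) (auto intro: bounded_subset[OF bounded_ball])
  then show ?thesis using \<rho> by (intro exI[of _ ?B]) auto
qed

lemma space_surface_measure [simp]: "space (surface_measure \<Gamma>) = \<Gamma>"
  by (simp add: surface_measure_def hausdorff_measure_def space_restrict_space)

lemma sets_hausdorff_measure [simp]: "sets (hausdorff_measure m :: 'a::metric_space measure) = sets borel"
proof -
  have "sigma_sets UNIV (sets (borel :: 'a measure)) = sets borel"
    using sets.sigma_sets_eq[of "borel :: 'a measure"] by simp
  then show ?thesis by (simp add: hausdorff_measure_def sets_measure_of_conv)
qed

lemma sets_surface_measure: "sets (surface_measure \<Gamma>) = sets (restrict_space borel \<Gamma>)"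
  by (simp add: surface_measure_def sets_restrict_space)

text \<open>If the outer measure failed to be a measure on the Borel sets, the measure built from it would
  vanish; hence its value is at most that of the outer measure in any case.\<close>
lemma finite_surface_measure:
  fixes \<Gamma> :: "'a::euclidean_space set"
  assumes "closed_C2_hypersurface \<Gamma>"
  shows "finite_measure (surface_measure \<Gamma>)"
proof -
  let ?n = "DIM('a) - 1"
  have cpt: "compact \<Gamma>" using assms by (simp add: closed_C2_hypersurface_def)
  have "\<forall>x\<in>\<Gamma>. \<exists>W. open W \<and> x \<in> W \<and> finite_content ?n (\<Gamma> \<inter> W)"
    using assms finite_content_chart unfolding closed_C2_hypersurface_def by blast
  then obtain W where W: "\<And>x. x \<in> \<Gamma> \<Longrightarrow> open (W x) \<and> x \<in> W x \<and> finite_content ?n (\<Gamma> \<inter> W x)"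
    by metis
  obtain F where F: "F \<subseteq> \<Gamma>" "finite F" "\<Gamma> \<subseteq> (\<Union>x\<in>F. W x)"
    using compactE_image[OF cpt, of \<Gamma> W] W by blast
  have "finite_content ?n (\<Union>x\<in>F. \<Gamma> \<inter> W x)"
    using F W by (intro finite_content_UN) auto
  then have "finite_content ?n \<Gamma>" by (rule finite_content_subset) (use F in auto)
  then have fin: "hausdorff_outer ?n \<Gamma> < \<infinity>" by (rule hausdorff_outer_finite)
  have bor: "\<Gamma> \<in> sets borel" using cpt by (simp add: compact_imp_closed)
  have "emeasure (surface_measure \<Gamma>) \<Gamma> = emeasure (hausdorff_measure ?n) \<Gamma>"
    unfolding surface_measure_def using bor by (subst emeasure_restrict_space) auto
  also have "\<dots> \<le> hausdorff_outer ?n \<Gamma>"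
    unfolding hausdorff_measure_def by (subst emeasure_measure_of_conv) auto
  finally show ?thesis using fin by (intro finite_measureI) auto
qed

section \<open>Functions with vanishing integral over boxes\<close>

text \<open>The boxes form a generator of the Borel sets that is stable under intersection.\<close>
lemma AE_zero_if_box_integrals_zero:
  fixes f :: "'a::euclidean_space \<Rightarrow> real"
  assumes int: "integrable M f" and sM: "sets M = sets (restrict_space borel S)"
    and zero: "\<And>a b. (LINT x|M. indicator (box a b) x * f x) = 0"
  shows "AE x in M. f x = 0"
proof -
  have sp: "space M = S" using sets_eq_imp_space_eq[OF sM] by (simp add: space_restrict_space)
  have sets: "A \<inter> S \<in> sets M" if "A \<in> sets borel" for A
    using that unfolding sM sets_restrict_space by auto
  have ind: "(LINT x:A \<inter> S|M. f x) = (LINT x|M. indicator A x * f x)" for A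
    unfolding set_lebesgue_integral_def using sp
    by (intro Bochner_Integration.integral_cong) (auto simp: indicator_def)
  have inti: "integrable M (\<lambda>x. indicator A x * f x)" if "A \<in> sets borel" for A
  proof -
    have "integrable M (\<lambda>x. indicator (A \<inter> S) x *\<^sub>R f x)"
      using sets[OF that] int by (rule integrable_mult_indicator)
    then show ?thesis using sp
      by (subst Bochner_Integration.integrable_cong[where N=M and g="\<lambda>x. indicator (A \<inter> S) x *\<^sub>R f x"])
         (auto simp: indicator_def)
  qed
  have univ: "(LINT x|M. f x) = 0"
  proof -
    let ?B = "\<lambda>k::nat. box (- (real k *\<^sub>R One)) (real k *\<^sub>R One) :: 'a set"
    have "(\<lambda>k. LINT x|M. indicator (?B k) x * f x) \<longlonglongrightarrow> (LINT x|M. f x)"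
    proof (rule integral_dominated_convergence[where w = "\<lambda>x. \<bar>f x\<bar>"])
      show "f \<in> borel_measurable M" using int by auto
      show "(\<lambda>x. indicator (?B k) x * f x) \<in> borel_measurable M" for k using inti[of "?B k"] by auto
      show "integrable M (\<lambda>x. \<bar>f x\<bar>)" using int by auto
      show "AE x in M. norm (indicator (?B k) x * f x) \<le> \<bar>f x\<bar>" for k by (auto simp: indicator_def)
      show "AE x in M. (\<lambda>k. indicator (?B k) x * f x) \<longlonglongrightarrow> f x"
      proof (rule AE_I2)
        fix x :: 'a
        obtain k where k: "norm x < real k" using reals_Archimedean2 by blast
        have "x \<in> ?B j" if "k \<le> j" for j
        proof -
          have "\<bar>x \<bullet> i\<bar> < real j" if "i \<in> Basis" for i
            using Basis_le_norm[OF that, of x] k \<open>k \<le> j\<close> by linarith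
          then show ?thesis by (auto simp: mem_box abs_less_iff) (smt (verit))
        qed
        then have "\<forall>\<^sub>F j in sequentially. indicator (?B j) x * f x = f x"
          unfolding eventually_sequentially by (intro exI[of _ k]) auto
        then show "(\<lambda>k. indicator (?B k) x * f x) \<longlonglongrightarrow> f x" by (rule tendsto_eventually)
      qed
    qed
    then show ?thesis by (simp add: zero LIMSEQ_const_iff)
  qed
  have key: "(LINT x|M. indicator A x * f x) = 0" if "A \<in> sets borel" for A
  proof -
    let ?G = "range (\<lambda>(a, b). box a b :: 'a set)"
    have bor: "sets (borel :: 'a measure) = sigma_sets UNIV ?G"
      by (subst borel_eq_box) (simp add: sets_measure_of_conv)
    have "Int_stable ?G"
      by (auto simp: Int_stable_def box_Int_box)
    moreover have "?G \<subseteq> Pow UNIV" by simp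
    moreover have "A \<in> sigma_sets UNIV ?G" using that bor by simp
    ultimately show ?thesis
    proof (induction A rule: sigma_sets_induct_disjoint)
      case (basic A) then show ?case using zero by auto
    next
      case empty then show ?case by simp
    next
      case (compl A)
      then have A: "A \<in> sets borel" using bor by simp
      have "(LINT x|M. indicator (UNIV - A) x * f x) = (LINT x|M. f x - indicator A x * f x)"
        by (intro Bochner_Integration.integral_cong) (auto simp: indicator_def)
      also have "\<dots> = 0" using int inti[OF A] univ compl by (subst Bochner_Integration.integral_diff) auto
      finally show ?case .
    next
      case (union A)
      then have A: "A i \<in> sets borel" for i using bor by auto
      have "(LINT x:(\<Union>i. A i) \<inter> S|M. f x) = (LINT x:(\<Union>i. A i \<inter> S)|M. f x)" by (simp add: Int_UN_distrib2)
      also have "\<dots> = (\<Sum>i. (LINT x:(A i \<inter> S)|M. f x))"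
      proof (rule lebesgue_integral_countable_add)
        show "A i \<inter> S \<in> sets M" for i using sets A by blast
        show "A i \<inter> S \<inter> (A j \<inter> S) = {}" if "i \<noteq> j" for i j
          using union(1) that by (auto simp: disjoint_family_on_def)
        have "(\<Union>i. A i \<inter> S) \<in> sets M" using sets A by blast
        then show "set_integrable M (\<Union>i. A i \<inter> S) f"
          unfolding set_integrable_def using int by (rule integrable_mult_indicator)
      qed
      also have "\<dots> = 0" using union(3) by (simp add: ind)
      finally show ?case by (simp add: ind)
    qed
  qed
  show ?thesis
  proof (rule density_unique_real[OF int])
    fix A assume "A \<in> sets M"
    then obtain B where "B \<in> sets borel" "A = B \<inter> S" unfolding sM sets_restrict_space by auto
    then show "(LINT x:A|M. f x) = (LINT x:A|M. 0)"
      using ind[of B] key[of B] by (simp add: set_lebesgue_integral_def)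
  qed simp
qed

section \<open>Square integrable functions\<close>

lemma L2_space_inner_integrable:
  fixes f g :: "'b \<Rightarrow> 'c::euclidean_space"
  assumes "f \<in> L2_space M" "g \<in> L2_space M"
  shows "integrable M (\<lambda>x. f x \<bullet> g x)"
proof (rule Bochner_Integration.integrable_bound)
  show "integrable M (\<lambda>x. (norm (f x))\<^sup>2 + (norm (g x))\<^sup>2)"
    using assms by (simp add: L2_space_def)
  show "(\<lambda>x. f x \<bullet> g x) \<in> borel_measurable M"
    using assms by (intro borel_measurable_inner) (auto simp: L2_space_def)
  have "\<bar>f x \<bullet> g x\<bar> \<le> (norm (f x))\<^sup>2 + (norm (g x))\<^sup>2" for x
    using Cauchy_Schwarz_ineq2[of "f x" "g x"] sum_squares_bound[of "norm (f x)" "norm (g x)"]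
      mult_nonneg_nonneg[of "norm (f x)" "norm (g x)"] by simp
  then show "AE x in M. norm (f x \<bullet> g x) \<le> norm ((norm (f x))\<^sup>2 + (norm (g x))\<^sup>2)" by auto
qed

lemma L2_space_mult_integrable:
  fixes f g :: "'b \<Rightarrow> real"
  shows "f \<in> L2_space M \<Longrightarrow> g \<in> L2_space M \<Longrightarrow> integrable M (\<lambda>x. f x * g x)"
  using L2_space_inner_integrable[of f M g] by simp

lemma L2_space_combine:
  fixes f g :: "'b \<Rightarrow> 'c::euclidean_space"
  assumes f: "f \<in> L2_space M" and g: "g \<in> L2_space M"
  shows "(\<lambda>x. a *\<^sub>R f x + g x) \<in> L2_space M"
proof -
  have "integrable M (\<lambda>x. a\<^sup>2 * (f x \<bullet> f x) + 2 * a * (f x \<bullet> g x) + g x \<bullet> g x)"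
    using L2_space_inner_integrable[OF f f] L2_space_inner_integrable[OF f g]
      L2_space_inner_integrable[OF g g] by auto
  moreover have "(norm (a *\<^sub>R f x + g x))\<^sup>2 = a\<^sup>2 * (f x \<bullet> f x) + 2 * a * (f x \<bullet> g x) + g x \<bullet> g x" for x
    unfolding power2_norm_eq_inner
    by (simp add: inner_add_left inner_add_right inner_commute power2_eq_square algebra_simps)
  ultimately show ?thesis using f g
    by (auto simp: L2_space_def intro!: borel_measurable_add borel_measurable_scaleR)
qed

lemma L2_space_bounded:
  fixes f :: "'b \<Rightarrow> 'c::euclidean_space"
  assumes "finite_measure M" "f \<in> borel_measurable M" "\<And>x. x \<in> space M \<Longrightarrow> norm (f x) \<le> K"
  shows "f \<in> L2_space M"
proof -
  interpret finite_measure M by fact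
  have "integrable M (\<lambda>x. (norm (f x))\<^sup>2)"
    by (rule integrable_const_bound[where B = "K\<^sup>2"])
       (use assms in \<open>auto intro!: AE_I2 power_mono\<close>)
  then show ?thesis using assms by (simp add: L2_space_def)
qed

lemma measurable_surface_continuous:
  fixes f :: "'a::euclidean_space \<Rightarrow> 'b::euclidean_space"
  assumes "continuous_on \<Gamma> f"
  shows "f \<in> borel_measurable (surface_measure \<Gamma>)"
  using borel_measurable_continuous_on_restrict[OF assms]
  by (subst measurable_cong_sets[OF sets_surface_measure refl])

lemma measurable_surface_borel:
  assumes "f \<in> borel_measurable borel"
  shows "f \<in> borel_measurable (surface_measure \<Gamma>)"
  using measurable_restrict_space1[OF assms]
  by (subst measurable_cong_sets[OF sets_surface_measure refl])

lemma L2_space_continuous: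
  fixes f :: "'a::euclidean_space \<Rightarrow> 'b::euclidean_space"
  assumes "closed_C2_hypersurface \<Gamma>" "continuous_on \<Gamma> f"
  shows "f \<in> L2_space (surface_measure \<Gamma>)"
proof -
  have "compact (f ` \<Gamma>)" using assms by (intro compact_continuous_image) (auto simp: closed_C2_hypersurface_def)
  then obtain K where "\<forall>y\<in>f ` \<Gamma>. norm y \<le> K" using compact_imp_bounded bounded_iff by blast
  then show ?thesis
    using finite_surface_measure[OF assms(1)] measurable_surface_continuous[OF assms(2)]
    by (intro L2_space_bounded[where K=K]) auto
qed

section \<open>Tangential test fields\<close>

text \<open>Continuously differentiable functions. Continuity of the derivative is required in each fixed
  direction, which in finite dimension is the same as continuity in the operator norm.\<close>
definition C1_scalar :: "('a::euclidean_space \<Rightarrow> real) \<Rightarrow> bool" where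
  "C1_scalar f \<longleftrightarrow> (\<exists>f'. (\<forall>x. (f has_derivative f' x) (at x)) \<and> (\<forall>h. continuous_on UNIV (\<lambda>x. f' x h)))"

lemma C1_scalar_continuous: "C1_scalar f \<Longrightarrow> continuous_on UNIV f"
  unfolding C1_scalar_def using has_derivative_at_withinI by (blast intro: has_derivative_continuous_on)

lemma C1_scalar_const: "C1_scalar (\<lambda>x. c)"
  unfolding C1_scalar_def by (intro exI[of _ "\<lambda>x h. 0"]) auto

lemma C1_scalar_mult:
  assumes "C1_scalar f" "C1_scalar g"
  shows "C1_scalar (\<lambda>x. f x * g x)"
proof -
  obtain f' g' where f': "\<forall>x. (f has_derivative f' x) (at x)" "\<forall>h. continuous_on UNIV (\<lambda>x. f' x h)"
    and g': "\<forall>x. (g has_derivative g' x) (at x)" "\<forall>h. continuous_on UNIV (\<lambda>x. g' x h)"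
    using assms unfolding C1_scalar_def by auto
  note c = C1_scalar_continuous[OF assms(1)] C1_scalar_continuous[OF assms(2)]
  show ?thesis unfolding C1_scalar_def
    using f' g' c
    by (intro exI[of _ "\<lambda>x h. f x * g' x h + f' x h * g x"])
       (auto intro!: continuous_intros has_derivative_mult)
qed

lemma C1_scalar_prod:
  assumes "finite I" "\<And>i. i \<in> I \<Longrightarrow> C1_scalar (f i)"
  shows "C1_scalar (\<lambda>x. \<Prod>i\<in>I. f i x)"
  using assms by (induction I rule: finite_induct) (auto intro!: C1_scalar_const C1_scalar_mult)

lemma C1_scalar_compose:
  assumes f: "C1_scalar f" and \<theta>: "\<And>s. (\<theta> has_real_derivative \<theta>' s) (at s)" "continuous_on UNIV \<theta>'"
  shows "C1_scalar (\<lambda>x. \<theta> (f x))"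
proof -
  obtain f' where f': "\<forall>x. (f has_derivative f' x) (at x)" "\<forall>h. continuous_on UNIV (\<lambda>x. f' x h)"
    using f unfolding C1_scalar_def by auto
  have "((\<lambda>x. \<theta> (f x)) has_derivative (\<lambda>h. \<theta>' (f x) * f' x h)) (at x)" for x
    using has_derivative_compose[of f "f' x" x UNIV \<theta> "(*) (\<theta>' (f x))"] f' \<theta>
    by (auto simp: has_field_derivative_def)
  moreover have "continuous_on UNIV (\<lambda>x. \<theta>' (f x) * f' x h)" for h
    using f' C1_scalar_continuous[OF f] \<theta>(2)
    by (auto intro!: continuous_intros continuous_on_compose2[of UNIV \<theta>'])
  ultimately show ?thesis unfolding C1_scalar_def by (intro exI[of _ "\<lambda>x h. \<theta>' (f x) * f' x h"]) auto
qed

lemma C1_scalar_coordinate: "C1_scalar (\<lambda>x. c * (x \<bullet> i) + d)"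
  unfolding C1_scalar_def
  by (intro exI[of _ "\<lambda>x h. c * (h \<bullet> i)"]) (auto intro!: derivative_eq_intros)

lemma has_real_derivative_pos_part_square:
  "((\<lambda>s::real. (max 0 s)\<^sup>2) has_real_derivative 2 * max 0 s) (at s)"
proof -
  consider "s > 0" | "s < 0" | "s = 0" by linarith
  then show ?thesis
  proof cases
    case 1
    have "((\<lambda>s::real. s\<^sup>2) has_real_derivative 2 * s) (at s)"
      by (auto intro!: derivative_eq_intros)
    then show ?thesis
      by (rule has_field_derivative_transform_within_open[of _ _ _ "{0<..}", THEN DERIV_cong])
         (use 1 in auto)
  next
    case 2
    have "((\<lambda>s::real. 0) has_real_derivative 0) (at s)" by simp
    then show ?thesis
      by (rule has_field_derivative_transform_within_open[of _ _ _ "{..<0}", THEN DERIV_cong])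
         (use 2 in auto)
  next
    case 3
    have "(\<lambda>h::real. max 0 h) \<midarrow>0\<rightarrow> max 0 0" by (intro tendsto_intros)
    then have "(\<lambda>h::real. ((max 0 (0 + h))\<^sup>2 - (max 0 0)\<^sup>2) / h) \<midarrow>0\<rightarrow> 0"
      unfolding max.idem
      by (rule Lim_transform_eventually)
         (auto simp: eventually_at power2_eq_square max_def intro!: exI[of _ 1])
    then show ?thesis using 3 by (simp add: DERIV_def)
  qed
qed

text \<open>The product of the squared positive parts of the distances to the faces.\<close>
lemma box_bump:
  fixes a b :: "'a::euclidean_space"
  obtains q where "C1_scalar q" "\<And>x. q x \<ge> 0" "\<And>x. q x > 0 \<longleftrightarrow> x \<in> box a b"
proof -
  let ?p = "\<lambda>i x. (max 0 (1 * (x \<bullet> i) + (- (a \<bullet> i))))\<^sup>2 * (max 0 ((-1) * (x \<bullet> i) + b \<bullet> i))\<^sup>2"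
  let ?q = "\<lambda>x. \<Prod>i\<in>Basis. ?p i x"
  have cont: "continuous_on UNIV (\<lambda>s::real. 2 * max 0 s)" by (intro continuous_intros)
  have "C1_scalar (?p i)" for i :: 'a
    by (intro C1_scalar_mult C1_scalar_compose[OF C1_scalar_coordinate has_real_derivative_pos_part_square cont])
  then have 1: "C1_scalar ?q" by (intro C1_scalar_prod) auto
  have 2: "?q x \<ge> 0" for x by (intro prod_nonneg) auto
  have p: "?p i x \<noteq> 0 \<longleftrightarrow> a \<bullet> i < x \<bullet> i \<and> x \<bullet> i < b \<bullet> i" for i x by (auto simp: max_def)
  have "?q x > 0 \<longleftrightarrow> ?q x \<noteq> 0" for x using 2[of x] by linarith
  also have "\<dots> x \<longleftrightarrow> x \<in> box a b" for x
    by (subst prod_zero_iff) (use p in \<open>auto simp: mem_box\<close>)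
  finally show ?thesis using that 1 2 by blast
qed

text \<open>On a chart with gradient \<open>G\<close>, the field \<open>|G|\<^sup>2 c - (c \<bullet> G) G\<close> is tangential and its product with
  a tangential vector is that of \<open>|G|\<^sup>2 c\<close>.\<close>
lemma chart_test_field:
  fixes \<Gamma> :: "'a::euclidean_space set"
  assumes C2: "C2_defining \<Gamma> U \<phi> G" and nu: "\<forall>y\<in>\<Gamma> \<inter> U. \<nu> y = G y /\<^sub>R norm (G y)"
    and ab: "cbox a b \<subseteq> U" and psi: "C1_scalar \<psi>" "\<And>x. x \<notin> cbox a b \<Longrightarrow> \<psi> x = 0"
  shows "C1_tangential_field \<Gamma> \<nu> (\<lambda>x. if x \<in> U then \<psi> x *\<^sub>R ((G x \<bullet> G x) *\<^sub>R c - (c \<bullet> G x) *\<^sub>R G x) else 0)"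
    (is "C1_tangential_field \<Gamma> \<nu> ?F")
proof -
  have opU: "open U" and nz: "\<And>x. x \<in> U \<Longrightarrow> G x \<noteq> 0" using C2 by (auto simp: C2_defining_def)
  obtain H :: "'a \<Rightarrow> 'a \<Rightarrow>\<^sub>L 'a" where H: "continuous_on U H" "\<And>x. x \<in> U \<Longrightarrow> (G has_derivative blinfun_apply (H x)) (at x)"
    using C2 by (auto simp: C2_defining_def)
  obtain \<psi>' where \<psi>': "\<And>x. (\<psi> has_derivative \<psi>' x) (at x)" "\<And>h. continuous_on UNIV (\<lambda>x. \<psi>' x h)"
    using psi(1) by (auto simp: C1_scalar_def)
  have cG: "continuous_on U G" by (rule C2_defining_continuous[OF C2])
  let ?R = "\<lambda>x. (G x \<bullet> G x) *\<^sub>R c - (c \<bullet> G x) *\<^sub>R G x"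
  let ?R' = "\<lambda>x h. (2 * (G x \<bullet> H x h)) *\<^sub>R c - ((c \<bullet> H x h) *\<^sub>R G x + (c \<bullet> G x) *\<^sub>R H x h)"
  define D where "D x h = (if x \<in> U then \<psi> x *\<^sub>R ?R' x h + \<psi>' x h *\<^sub>R ?R x else 0)" for x h
  let ?O = "- cbox a b"
  have opO: "open ?O" by (simp add: closed_cbox open_Compl)
  have cover: "U \<union> ?O = UNIV" using ab by auto
  have derU: "(?F has_derivative D x) (at x)" if x: "x \<in> U" for x
  proof -
    have "((\<lambda>y. \<psi> y *\<^sub>R ?R y) has_derivative D x) (at x)"
      using x by (auto simp: D_def inner_commute algebra_simps intro!: derivative_eq_intros H \<psi>')
    then show ?thesis
      by (rule has_derivative_transform_within_open[OF _ opU x]) auto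
  qed
  have derO: "(?F has_derivative (\<lambda>h. 0)) (at x)" if x: "x \<in> ?O" for x
  proof -
    have "((\<lambda>y. 0) has_derivative (\<lambda>h. 0)) (at x)" by simp
    then show ?thesis
      by (rule has_derivative_transform_within_open[OF _ opO x]) (use psi(2) in auto)
  qed
  \<comment> \<open>The two expressions for the derivative agree on the overlap of the open sets \<open>U\<close> and \<open>?O\<close>.\<close>
  have D0: "D x = (\<lambda>h. 0)" if x: "x \<in> ?O" for x
  proof (cases "x \<in> U")
    case True
    show ?thesis by (rule has_derivative_unique[OF derU[OF True] derO[OF x]])
  qed (auto simp: D_def)
  have der: "(?F has_derivative D x) (at x)" for x
  proof (cases "x \<in> U")
    case True
    then show ?thesis by (rule derU)
  next
    case False
    then have xO: "x \<in> ?O" using cover by blast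
    show ?thesis unfolding D0[OF xO] by (rule derO[OF xO])
  qed
  have contD: "continuous_on UNIV (\<lambda>x. D x h)" for h
  proof -
    have "continuous_on U (\<lambda>x. \<psi> x *\<^sub>R ?R' x h + \<psi>' x h *\<^sub>R ?R x)"
      using C1_scalar_continuous[OF psi(1)] \<psi>'(2)[of h]
      by (intro continuous_intros cG H(1)) (auto intro: continuous_on_subset)
    then have "continuous_on U (\<lambda>x. D x h)"
      by (rule continuous_on_eq) (auto simp: D_def)
    moreover have "continuous_on ?O (\<lambda>x. D x h)"
      by (rule continuous_on_eq[of _ "\<lambda>_. 0"]) (use D0 in auto)
    ultimately show ?thesis
      using continuous_on_open_Un[OF opU opO] cover by metis
  qed
  have bl: "bounded_linear (D x)" for x using der has_derivative_bounded_linear by blast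
  show ?thesis unfolding C1_tangential_field_def
  proof (intro conjI exI[of _ "\<lambda>x. Blinfun (D x)"] allI ballI)
    show "continuous_on UNIV (\<lambda>x. Blinfun (D x))"
      by (rule continuous_on_blinfun_componentwise) (use contD bl in \<open>simp add: bounded_linear_Blinfun_apply\<close>)
    show "(?F has_derivative blinfun_apply (Blinfun (D x))) (at x)" for x
      using der bl by (simp add: bounded_linear_Blinfun_apply)
    show "?F x \<bullet> \<nu> x = 0" if "x \<in> \<Gamma>" for x
    proof (cases "x \<in> U")
      case True
      then have "\<nu> x = G x /\<^sub>R norm (G x)" using nu that by auto
      then show ?thesis using True by (simp add: inner_diff_left)
    qed simp
  qed
qed

section \<open>Uniqueness and linearity of the weak surface gradient\<close>

lemma unit_normal_continuous:
  fixes \<Gamma> :: "'a::euclidean_space set"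
  assumes "unit_normal_field \<Gamma> \<nu>"
  shows "continuous_on \<Gamma> \<nu>"
  unfolding continuous_on_eq_continuous_within
proof
  fix x assume x: "x \<in> \<Gamma>"
  then obtain U \<phi> G where U: "x \<in> U" "C2_defining \<Gamma> U \<phi> G" "\<forall>y\<in>\<Gamma> \<inter> U. \<nu> y = G y /\<^sub>R norm (G y)"
    using assms by (auto simp: unit_normal_field_def)
  have opU: "open U" and nz: "\<And>x. x \<in> U \<Longrightarrow> G x \<noteq> 0" using U(2) by (auto simp: C2_defining_def)
  have "continuous_on U (\<lambda>y. G y /\<^sub>R norm (G y))"
    using C2_defining_continuous[OF U(2)] nz by (intro continuous_intros) auto
  then have "continuous_on (\<Gamma> \<inter> U) \<nu>"
    by (rule continuous_on_eq[OF continuous_on_subset]) (use U in auto)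
  then have "continuous (at x within (\<Gamma> \<inter> U)) \<nu>"
    using x U(1) by (simp add: continuous_on_eq_continuous_within)
  then show "continuous (at x within \<Gamma>) \<nu>"
    using opU U(1) at_within_nhd[of x U "\<Gamma> \<inter> U" \<Gamma>] by (simp add: continuous_within Int_assoc)
qed

lemma surf_div_continuous:
  fixes \<Gamma> :: "'a::euclidean_space set"
  assumes nu: "continuous_on \<Gamma> \<nu>" and t: "C1_tangential_field \<Gamma> \<nu> \<phi>"
  shows "continuous_on \<Gamma> (surf_div \<nu> \<phi>)"
proof -
  obtain D :: "'a \<Rightarrow> 'a \<Rightarrow>\<^sub>L 'a" where D: "continuous_on UNIV D"
      "\<And>x. (\<phi> has_derivative blinfun_apply (D x)) (at x)"
    using t by (auto simp: C1_tangential_field_def)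
  have eq: "frechet_derivative \<phi> (at x) = blinfun_apply (D x)" for x
    using frechet_derivative_at[OF D(2)] by simp
  show ?thesis unfolding surf_div_def[abs_def] eq
    by (intro continuous_intros nu continuous_on_subset[OF D(1)]) auto
qed

context
  fixes \<Gamma> :: "'a::euclidean_space set" and \<nu> :: "'a \<Rightarrow> 'a"
  assumes hyp: "closed_C2_hypersurface \<Gamma>" and nor: "unit_normal_field \<Gamma> \<nu>"
begin

lemma tangential_field_L2:
  assumes "C1_tangential_field \<Gamma> \<nu> \<phi>"
  shows "\<phi> \<in> L2_space (surface_measure \<Gamma>)" "surf_div \<nu> \<phi> \<in> L2_space (surface_measure \<Gamma>)"
proof -
  obtain D :: "'a \<Rightarrow> 'a \<Rightarrow>\<^sub>L 'a" where D: "\<And>x. (\<phi> has_derivative blinfun_apply (D x)) (at x)"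
    using assms unfolding C1_tangential_field_def by blast
  have "continuous_on \<Gamma> \<phi>"
    by (rule has_derivative_continuous_on[OF has_derivative_at_withinI[OF D]])
  then show "\<phi> \<in> L2_space (surface_measure \<Gamma>)" by (rule L2_space_continuous[OF hyp])
  show "surf_div \<nu> \<phi> \<in> L2_space (surface_measure \<Gamma>)"
    by (rule L2_space_continuous[OF hyp surf_div_continuous[OF unit_normal_continuous[OF nor] assms]])
qed

text \<open>The test fields \<open>1 - exp (- k q)\<close> times a chart field, with \<open>q\<close> a bump on a box, converge to the
  indicator of the box times the chart field. So each component of \<open>|G|\<^sup>2 d\<close> has vanishing integrals over
  the boxes in a chart.\<close>
lemma tangential_L2_zero:
  assumes d: "d \<in> L2_space (surface_measure \<Gamma>)" and tan: "AE x in surface_measure \<Gamma>. d x \<bullet> \<nu> x = 0"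
    and orth: "\<And>\<phi>. C1_tangential_field \<Gamma> \<nu> \<phi> \<Longrightarrow> (LINT x|surface_measure \<Gamma>. d x \<bullet> \<phi> x) = 0"
  shows "AE x in surface_measure \<Gamma>. d x = 0"
proof -
  let ?\<mu> = "surface_measure \<Gamma>"
  interpret finite_measure ?\<mu> by (rule finite_surface_measure[OF hyp])
  have dm: "d \<in> borel_measurable ?\<mu>" using d by (simp add: L2_space_def)
  have loc: "\<exists>a b. x0 \<in> box a b \<and> (AE x in ?\<mu>. x \<in> box a b \<longrightarrow> d x = 0)" if x0: "x0 \<in> \<Gamma>" for x0
  proof -
    obtain U \<phi> G where U: "x0 \<in> U" "C2_defining \<Gamma> U \<phi> G" "\<forall>y\<in>\<Gamma> \<inter> U. \<nu> y = G y /\<^sub>R norm (G y)"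
      using nor x0 by (auto simp: unit_normal_field_def)
    have opU: "open U" and nz: "\<And>x. x \<in> U \<Longrightarrow> G x \<noteq> 0" using U(2) by (auto simp: C2_defining_def)
    have cG: "continuous_on U G" by (rule C2_defining_continuous[OF U(2)])
    obtain a b where ab: "x0 \<in> box a b" "cbox a b \<subseteq> U"
      using opU U(1) by (meson open_contains_cbox)
    have bU: "box a b \<subseteq> U" using ab(2) box_subset_cbox by blast
    have comp: "compact ((\<lambda>x. G x \<bullet> G x) ` cbox a b)"
      by (intro compact_continuous_image continuous_intros continuous_on_subset[OF cG ab(2)]) auto
    then obtain K where "\<forall>y\<in>(\<lambda>x. G x \<bullet> G x) ` cbox a b. norm y \<le> K"
      using compact_imp_bounded bounded_iff by blast
    then have K: "\<And>x. x \<in> cbox a b \<Longrightarrow> \<bar>G x \<bullet> G x\<bar> \<le> K" by auto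
    let ?w = "\<lambda>x. indicator (box a b) x *\<^sub>R (G x \<bullet> G x)"
    have wb: "\<bar>?w x\<bar> \<le> \<bar>K\<bar>" for x
      using K[of x] box_subset_cbox[of a b] by (cases "x \<in> box a b") auto
    have wm: "?w \<in> borel_measurable ?\<mu>"
      by (intro measurable_surface_borel borel_measurable_continuous_on_indicator)
         (auto intro!: continuous_intros continuous_on_subset[OF cG bU])
    have wL: "?w \<in> L2_space ?\<mu>"
      by (rule L2_space_bounded[OF _ wm, where K="\<bar>K\<bar>"]) (use wb finite_measure_axioms in auto)
    have comp_zero: "AE x in ?\<mu>. ?w x * (d x \<bullet> c) = 0" for c
    proof (rule AE_zero_if_box_integrals_zero[OF _ sets_surface_measure])
      have "(\<lambda>x. ?w x *\<^sub>R c) \<in> L2_space ?\<mu>"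
        by (rule L2_space_bounded[where K="\<bar>K\<bar> * norm c"])
           (use wb finite_measure_axioms wm in \<open>auto intro!: mult_right_mono simp del: real_scaleR_def\<close>)
      then have "integrable ?\<mu> (\<lambda>x. d x \<bullet> (?w x *\<^sub>R c))" by (rule L2_space_inner_integrable[OF d])
      then show int: "integrable ?\<mu> (\<lambda>x. ?w x * (d x \<bullet> c))" by (simp add: mult_ac)
      fix a' b' :: 'a
      obtain a'' b'' where ab'': "box a' b' \<inter> box a b = box a'' b''" using box_Int_box by blast
      obtain q where q: "C1_scalar q" "\<And>x. q x \<ge> 0" "\<And>x. q x > 0 \<longleftrightarrow> x \<in> box a'' b''"
        using box_bump[of a'' b''] by blast
      let ?\<psi> = "\<lambda>k x. 1 - exp (- real k * q x)"
      have psi: "C1_scalar (?\<psi> k)" for k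
        by (rule C1_scalar_compose[OF q(1), where \<theta>'="\<lambda>s. real k * exp (- real k * s)"])
           (auto intro!: derivative_eq_intros continuous_intros)
      have q0: "q x = 0" if "x \<notin> box a'' b''" for x using q(2)[of x] q(3)[of x] that by linarith
      have sub: "box a'' b'' \<subseteq> cbox a b" using ab'' box_subset_cbox by blast
      have psi0: "?\<psi> k x = 0" if "x \<notin> cbox a b" for k x using q0 sub that by auto
      have I0: "(LINT x|?\<mu>. ?\<psi> k x * (?w x * (d x \<bullet> c))) = 0" for k
      proof -
        let ?F = "\<lambda>x. if x \<in> U then ?\<psi> k x *\<^sub>R ((G x \<bullet> G x) *\<^sub>R c - (c \<bullet> G x) *\<^sub>R G x) else 0"
        have F: "C1_tangential_field \<Gamma> \<nu> ?F"
          by (rule chart_test_field[OF U(2,3) ab(2) psi psi0])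
        have "AE x in ?\<mu>. ?\<psi> k x * (?w x * (d x \<bullet> c)) = d x \<bullet> ?F x"
          using tan AE_space
        proof eventually_elim
          case (elim x)
          then have x: "x \<in> \<Gamma>" by simp
          show ?case
          proof (cases "x \<in> box a'' b''")
            case True
            then have xU: "x \<in> U" "x \<in> box a b" using ab'' bU by auto
            then have "\<nu> x = G x /\<^sub>R norm (G x)" "G x \<noteq> 0" using U(3) x nz by auto
            then have "d x \<bullet> G x = 0" using elim(1) by auto
            then show ?thesis using xU by (simp add: inner_diff_right)
          qed (simp add: q0)
        qed
        then have "(LINT x|?\<mu>. ?\<psi> k x * (?w x * (d x \<bullet> c))) = (LINT x|?\<mu>. d x \<bullet> ?F x)"
        proof (rule integral_cong_AE[rotated 2])
          have "?\<psi> k \<in> borel_measurable ?\<mu>"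
            by (intro measurable_surface_borel borel_measurable_continuous_onI C1_scalar_continuous psi)
          then show "(\<lambda>x. ?\<psi> k x * (?w x * (d x \<bullet> c))) \<in> borel_measurable ?\<mu>"
            using wm dm by measurable
          show "(\<lambda>x. d x \<bullet> ?F x) \<in> borel_measurable ?\<mu>"
            using L2_space_inner_integrable[OF d tangential_field_L2(1)[OF F]] by auto
        qed
        then show ?thesis using orth[OF F] by simp
      qed
      have "(\<lambda>k. LINT x|?\<mu>. ?\<psi> k x * (?w x * (d x \<bullet> c))) \<longlonglongrightarrow>
            (LINT x|?\<mu>. indicator (box a' b') x * (?w x * (d x \<bullet> c)))"
      proof (rule integral_dominated_convergence[where w="\<lambda>x. \<bar>?w x * (d x \<bullet> c)\<bar>"])
        show "integrable ?\<mu> (\<lambda>x. \<bar>?w x * (d x \<bullet> c)\<bar>)" using int by auto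
        have "(indicator (box a' b') :: 'a \<Rightarrow> real) \<in> borel_measurable ?\<mu>"
          by (intro measurable_surface_borel) auto
        then show "(\<lambda>x. indicator (box a' b') x * (?w x * (d x \<bullet> c))) \<in> borel_measurable ?\<mu>"
          using int by measurable
        fix k
        have "?\<psi> k \<in> borel_measurable ?\<mu>"
          by (intro measurable_surface_borel borel_measurable_continuous_onI C1_scalar_continuous psi)
        then show "(\<lambda>x. ?\<psi> k x * (?w x * (d x \<bullet> c))) \<in> borel_measurable ?\<mu>"
          using int by measurable
        have "\<bar>?\<psi> k x\<bar> \<le> 1" for x using q(2)[of x] by auto
        then show "AE x in ?\<mu>. norm (?\<psi> k x * (?w x * (d x \<bullet> c))) \<le> \<bar>?w x * (d x \<bullet> c)\<bar>"
          by (intro AE_I2) (metis abs_ge_zero abs_mult mult_left_le_one_le real_norm_def)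
      next
        show "AE x in ?\<mu>. (\<lambda>k. ?\<psi> k x * (?w x * (d x \<bullet> c))) \<longlonglongrightarrow>
            indicator (box a' b') x * (?w x * (d x \<bullet> c))"
        proof (rule AE_I2)
          fix x
          show "(\<lambda>k. ?\<psi> k x * (?w x * (d x \<bullet> c))) \<longlonglongrightarrow> indicator (box a' b') x * (?w x * (d x \<bullet> c))"
          proof (cases "x \<in> box a'' b''")
            case True
            then have "q x > 0" and x: "x \<in> box a' b'" using q(3) ab'' by auto
            then have "(\<lambda>k. exp (- q x) ^ k) \<longlonglongrightarrow> 0" by (intro LIMSEQ_power_zero) auto
            then have "(\<lambda>k. exp (- real k * q x)) \<longlonglongrightarrow> 0"
              by (simp add: exp_of_nat_mult[symmetric] mult_ac)
            then have "(\<lambda>k. ?\<psi> k x * (?w x * (d x \<bullet> c))) \<longlonglongrightarrow> (1 - 0) * (?w x * (d x \<bullet> c))"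
              by (intro tendsto_intros)
            then show ?thesis using x by simp
          next
            case False
            then have "indicator (box a' b') x * (?w x * (d x \<bullet> c)) = 0" using ab'' by (auto simp: indicator_def)
            then show ?thesis using q0[OF False] by (simp only:) simp
          qed
        qed
      qed
      then show "(LINT x|?\<mu>. indicator (box a' b') x * (?w x * (d x \<bullet> c))) = 0"
        by (simp only: I0 LIMSEQ_const_iff)
    qed
    have "AE x in ?\<mu>. \<forall>c\<in>Basis. ?w x * (d x \<bullet> c) = 0"
      using comp_zero by (intro AE_finite_allI) auto
    then have "AE x in ?\<mu>. x \<in> box a b \<longrightarrow> d x = 0"
    proof eventually_elim
      case (elim x)
      show ?case
      proof
        assume x: "x \<in> box a b"
        then have "G x \<bullet> G x \<noteq> 0" using nz bU by auto
        then have "d x \<bullet> c = 0" if "c \<in> Basis" for c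
          using bspec[OF elim that] x by simp
        then show "d x = 0" using euclidean_all_zero_iff by blast
      qed
    qed
    then show ?thesis using ab(1) by blast
  qed
  have nbhd: "\<forall>x\<in>\<Gamma>. \<exists>W. open W \<and> x \<in> W \<and> (AE y in ?\<mu>. y \<in> W \<longrightarrow> d y = 0)"
  proof
    fix x assume "x \<in> \<Gamma>"
    then obtain a b where "x \<in> box a b" "AE y in ?\<mu>. y \<in> box a b \<longrightarrow> d y = 0" using loc by blast
    then show "\<exists>W. open W \<and> x \<in> W \<and> (AE y in ?\<mu>. y \<in> W \<longrightarrow> d y = 0)"
      by (intro exI[of _ "box a b"]) (simp add: open_box)
  qed
  obtain W where "\<forall>x\<in>\<Gamma>. open (W x) \<and> x \<in> W x \<and> (AE y in ?\<mu>. y \<in> W x \<longrightarrow> d y = 0)"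
    using bchoice[OF nbhd] by (elim exE)
  then have W: "open (W x)" "x \<in> W x" "AE y in ?\<mu>. y \<in> W x \<longrightarrow> d y = 0" if "x \<in> \<Gamma>" for x
    using that by blast+
  have "compact \<Gamma>" using hyp by (simp add: closed_C2_hypersurface_def)
  then obtain F where F: "F \<subseteq> \<Gamma>" "finite F" "\<Gamma> \<subseteq> (\<Union>x\<in>F. W x)"
    by (rule compactE_image[of \<Gamma> \<Gamma> W]) (use W(1,2) in auto)
  have "AE y in ?\<mu>. \<forall>x\<in>F. y \<in> W x \<longrightarrow> d y = 0"
    by (rule AE_finite_allI[OF F(2)]) (use F(1) W(3) in blast)
  then show ?thesis using AE_space
  proof eventually_elim
    case (elim y)
    then show ?case using F(3) by auto
  qed
qed

lemma weak_surf_grad_combine: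
  assumes v: "weak_surf_grad \<Gamma> \<nu> v g" "v \<in> L2_space (surface_measure \<Gamma>)"
    and w: "weak_surf_grad \<Gamma> \<nu> w h" "w \<in> L2_space (surface_measure \<Gamma>)"
  shows "weak_surf_grad \<Gamma> \<nu> (\<lambda>x. a * v x + w x) (\<lambda>x. a *\<^sub>R g x + h x)"
proof -
  let ?\<mu> = "surface_measure \<Gamma>"
  have g: "g \<in> L2_space ?\<mu>" "AE x in ?\<mu>. g x \<bullet> \<nu> x = 0"
    and h: "h \<in> L2_space ?\<mu>" "AE x in ?\<mu>. h x \<bullet> \<nu> x = 0"
    using v w by (auto simp: weak_surf_grad_def)
  show ?thesis unfolding weak_surf_grad_def
  proof (intro conjI allI impI)
    show "(\<lambda>x. a *\<^sub>R g x + h x) \<in> L2_space ?\<mu>" by (rule L2_space_combine[OF g(1) h(1)])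
    show "AE x in ?\<mu>. (a *\<^sub>R g x + h x) \<bullet> \<nu> x = 0"
      using g(2) h(2) by eventually_elim (simp add: inner_add_left)
    fix \<phi> assume \<phi>: "C1_tangential_field \<Gamma> \<nu> \<phi>"
    note L = tangential_field_L2[OF \<phi>]
    have "(LINT x|?\<mu>. (a *\<^sub>R g x + h x) \<bullet> \<phi> x) = (LINT x|?\<mu>. a * (g x \<bullet> \<phi> x) + h x \<bullet> \<phi> x)"
      by (simp add: inner_add_left)
    also have "\<dots> = a * (LINT x|?\<mu>. g x \<bullet> \<phi> x) + (LINT x|?\<mu>. h x \<bullet> \<phi> x)"
      using L2_space_inner_integrable[OF g(1) L(1)] L2_space_inner_integrable[OF h(1) L(1)]
      by (subst Bochner_Integration.integral_add) auto
    also have "\<dots> = - (a * (LINT x|?\<mu>. v x * surf_div \<nu> \<phi> x) + (LINT x|?\<mu>. w x * surf_div \<nu> \<phi> x))"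
      using v(1) w(1) \<phi> by (simp add: weak_surf_grad_def)
    also have "a * (LINT x|?\<mu>. v x * surf_div \<nu> \<phi> x) + (LINT x|?\<mu>. w x * surf_div \<nu> \<phi> x) =
        (LINT x|?\<mu>. a * (v x * surf_div \<nu> \<phi> x) + w x * surf_div \<nu> \<phi> x)"
      using L2_space_mult_integrable[OF v(2) L(2)] L2_space_mult_integrable[OF w(2) L(2)]
      by (subst Bochner_Integration.integral_add) auto
    also have "\<dots> = (LINT x|?\<mu>. (a * v x + w x) * surf_div \<nu> \<phi> x)"
      by (simp add: algebra_simps)
    finally show "(LINT x|?\<mu>. (a *\<^sub>R g x + h x) \<bullet> \<phi> x) = - (LINT x|?\<mu>. (a * v x + w x) * surf_div \<nu> \<phi> x)" .
  qed
qed

lemma weak_surf_grad_unique: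
  assumes v: "v \<in> L2_space (surface_measure \<Gamma>)" and g: "weak_surf_grad \<Gamma> \<nu> v g" and h: "weak_surf_grad \<Gamma> \<nu> v h"
  shows "AE x in surface_measure \<Gamma>. g x = h x"
proof -
  have c: "weak_surf_grad \<Gamma> \<nu> (\<lambda>x. (-1) * v x + v x) (\<lambda>x. (-1) *\<^sub>R g x + h x)"
    by (rule weak_surf_grad_combine[OF g v h v])
  have "AE x in surface_measure \<Gamma>. (-1) *\<^sub>R g x + h x = 0"
    by (rule tangential_L2_zero) (use c in \<open>auto simp: weak_surf_grad_def\<close>)
  then show ?thesis by eventually_elim auto
qed

end

section \<open>Bilinear forms on spaces of functions\<close>

text \<open>Linear subspaces of a space of functions.\<close>
definition lin_space :: "('a \<Rightarrow> real) set \<Rightarrow> bool" where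
  "lin_space V \<longleftrightarrow> (\<lambda>x. 0) \<in> V \<and> (\<forall>u\<in>V. \<forall>v\<in>V. \<forall>a. (\<lambda>x. a * u x + v x) \<in> V)"

text \<open>Symmetric bilinear forms that are positive semidefinite on \<open>V\<close>. Linearity in the second argument
  follows from symmetry when \<open>V\<close> is a subspace.\<close>
definition semi_inner_on ::
    "('a \<Rightarrow> real) set \<Rightarrow> (('a \<Rightarrow> real) \<Rightarrow> ('a \<Rightarrow> real) \<Rightarrow> real) \<Rightarrow> bool" where
  "semi_inner_on V B \<longleftrightarrow>
     (\<forall>u\<in>V. \<forall>v\<in>V. B u v = B v u) \<and> (\<forall>w\<in>V. linear_functional_on V (\<lambda>u. B u w)) \<and> (\<forall>v\<in>V. 0 \<le> B v v)"

lemma lin_space_combine: "lin_space V \<Longrightarrow> u \<in> V \<Longrightarrow> v \<in> V \<Longrightarrow> (\<lambda>x. a * u x + v x) \<in> V"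
  by (simp add: lin_space_def)

lemma lin_space_zero: "lin_space V \<Longrightarrow> (\<lambda>x. 0) \<in> V"
  by (simp add: lin_space_def)

lemma lin_space_scale: "lin_space V \<Longrightarrow> u \<in> V \<Longrightarrow> (\<lambda>x. a * u x) \<in> V"
  using lin_space_combine[of V u "\<lambda>x. 0" a] by (simp add: lin_space_zero)

lemma lin_space_diff: "lin_space V \<Longrightarrow> u \<in> V \<Longrightarrow> v \<in> V \<Longrightarrow> (\<lambda>x. u x - v x) \<in> V"
  using lin_space_combine[of V v u "-1"] by simp

lemma lin_space_sum:
  assumes "lin_space V" "finite I" "\<And>i. i \<in> I \<Longrightarrow> e i \<in> V"
  shows "(\<lambda>x. \<Sum>i\<in>I. c i * e i x) \<in> V"
  using assms(2,3)
proof (induction I rule: finite_induct)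
  case (insert j I)
  then show ?case using lin_space_combine[OF assms(1), of "e j" "\<lambda>x. \<Sum>i\<in>I. c i * e i x" "c j"] by simp
qed (simp add: lin_space_zero[OF assms(1)])

lemma linear_functional_combine:
  "linear_functional_on V l \<Longrightarrow> u \<in> V \<Longrightarrow> v \<in> V \<Longrightarrow> l (\<lambda>x. a * u x + v x) = a * l u + l v"
  by (simp add: linear_functional_on_def)

lemma linear_functional_zero:
  assumes "lin_space V" "linear_functional_on V l"
  shows "l (\<lambda>x. 0) = 0"
  using linear_functional_combine[OF assms(2), of "\<lambda>x. 0" "\<lambda>x. 0" 1] lin_space_zero[OF assms(1)] by simp

lemma linear_functional_scale:
  assumes "lin_space V" "linear_functional_on V l" "u \<in> V"
  shows "l (\<lambda>x. a * u x) = a * l u"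
  using linear_functional_combine[OF assms(2,3) lin_space_zero[OF assms(1)], of a]
    linear_functional_zero[OF assms(1,2)] by simp

lemma linear_functional_add:
  assumes "lin_space V" "linear_functional_on V l" "u \<in> V" "v \<in> V"
  shows "l (\<lambda>x. u x + v x) = l u + l v"
  using linear_functional_combine[OF assms(2-4), of 1] by simp

lemma linear_functional_diff:
  assumes "lin_space V" "linear_functional_on V l" "u \<in> V" "v \<in> V"
  shows "l (\<lambda>x. u x - v x) = l u - l v"
  using linear_functional_combine[OF assms(2,4,3), of "-1"] by simp

lemma linear_functional_sum:
  assumes V: "lin_space V" and l: "linear_functional_on V l" and "finite I" "\<And>i. i \<in> I \<Longrightarrow> e i \<in> V"
  shows "l (\<lambda>x. \<Sum>i\<in>I. c i * e i x) = (\<Sum>i\<in>I. c i * l (e i))"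
  using assms(3,4)
proof (induction I rule: finite_induct)
  case (insert j I)
  then show ?case
    using linear_functional_combine[OF l, of "e j" "\<lambda>x. \<Sum>i\<in>I. c i * e i x" "c j"] lin_space_sum[OF V, of I e c]
    by simp
qed (simp add: linear_functional_zero[OF V l])

lemma semi_inner_sym: "semi_inner_on V B \<Longrightarrow> u \<in> V \<Longrightarrow> v \<in> V \<Longrightarrow> B u v = B v u"
  by (simp add: semi_inner_on_def)

lemma semi_inner_nonneg: "semi_inner_on V B \<Longrightarrow> v \<in> V \<Longrightarrow> 0 \<le> B v v"
  by (simp add: semi_inner_on_def)

lemma semi_inner_left: "semi_inner_on V B \<Longrightarrow> w \<in> V \<Longrightarrow> linear_functional_on V (\<lambda>u. B u w)"
  by (simp add: semi_inner_on_def)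

lemma semi_inner_right:
  assumes "lin_space V" "semi_inner_on V B" "w \<in> V"
  shows "linear_functional_on V (B w)"
proof -
  have "B w (\<lambda>x. a * u x + v x) = a * B w u + B w v" if "u \<in> V" "v \<in> V" for u v a
    using linear_functional_combine[OF semi_inner_left[OF assms(2,3)] that, of a]
      semi_inner_sym[OF assms(2,3)] that lin_space_combine[OF assms(1) that] by simp
  then show ?thesis by (simp add: linear_functional_on_def)
qed

lemma semi_inner_quadratic:
  assumes V: "lin_space V" and B: "semi_inner_on V B" and u: "u \<in> V" and v: "v \<in> V"
  shows "B (\<lambda>x. a * u x + v x) (\<lambda>x. a * u x + v x) = a\<^sup>2 * B u u + 2 * a * B u v + B v v"
proof -
  let ?z = "\<lambda>x. a * u x + v x"
  have z: "?z \<in> V" by (rule lin_space_combine[OF V u v])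
  have "B ?z ?z = a * B u ?z + B v ?z" by (rule linear_functional_combine[OF semi_inner_left[OF B z] u v])
  then show ?thesis
    using linear_functional_combine[OF semi_inner_right[OF V B u] u v, of a]
      linear_functional_combine[OF semi_inner_right[OF V B v] u v, of a] semi_inner_sym[OF B u v]
    by (simp add: power2_eq_square algebra_simps)
qed

lemma semi_inner_Cauchy_Schwarz_square:
  assumes V: "lin_space V" and B: "semi_inner_on V B" and u: "u \<in> V" and v: "v \<in> V"
  shows "(B u v)\<^sup>2 \<le> B u u * B v v"
proof -
  have q: "0 \<le> a\<^sup>2 * B u u + 2 * a * B u v + B v v" for a
    using semi_inner_nonneg[OF B lin_space_combine[OF V u v, of a]] semi_inner_quadratic[OF V B u v, of a] by simp
  show ?thesis
  proof (cases "B u u = 0")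
    case True
    have "B u v = 0"
    proof (rule ccontr)
      assume nz: "B u v \<noteq> 0"
      have "2 * (- (B v v + 1) / (2 * B u v)) * B u v = - (B v v + 1)" using nz by simp
      then show False using q[of "- (B v v + 1) / (2 * B u v)"] True by simp
    qed
    then show ?thesis using True by simp
  next
    case False
    then have pos: "B u u > 0" using semi_inner_nonneg[OF B u] by simp
    have "0 \<le> (- B u v / B u u)\<^sup>2 * B u u + 2 * (- B u v / B u u) * B u v + B v v" by (rule q)
    also have "\<dots> = B v v - (B u v)\<^sup>2 / B u u" using False by (simp add: field_simps power2_eq_square)
    finally show ?thesis using pos by (simp add: field_simps)
  qed
qed

lemma semi_inner_Cauchy_Schwarz:
  assumes V: "lin_space V" and B: "semi_inner_on V B" and u: "u \<in> V" and v: "v \<in> V"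
  shows "\<bar>B u v\<bar> \<le> sqrt (B u u) * sqrt (B v v)"
  using real_sqrt_le_mono[OF semi_inner_Cauchy_Schwarz_square[OF assms]] by (simp add: real_sqrt_mult)

lemma semi_inner_add:
  assumes "semi_inner_on V B" "semi_inner_on V C"
  shows "semi_inner_on V (\<lambda>u v. B u v + C u v)"
  using assms unfolding semi_inner_on_def linear_functional_on_def by (simp add: algebra_simps)

lemma semi_inner_scale:
  assumes "semi_inner_on V B" "0 \<le> c"
  shows "semi_inner_on V (\<lambda>u v. c * B u v)"
  using assms unfolding semi_inner_on_def linear_functional_on_def by (simp add: algebra_simps)

lemma semi_inner_zero: "semi_inner_on V (\<lambda>u v. 0)"
  unfolding semi_inner_on_def linear_functional_on_def by simp

lemma semi_inner_sum:
  assumes "finite I" "\<And>i. i \<in> I \<Longrightarrow> semi_inner_on V (B i)"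
  shows "semi_inner_on V (\<lambda>u v. \<Sum>i\<in>I. B i u v)"
  using assms by (induction I rule: finite_induct) (auto intro!: semi_inner_zero semi_inner_add)

lemma semi_inner_subset: "semi_inner_on V B \<Longrightarrow> W \<subseteq> V \<Longrightarrow> semi_inner_on W B"
  unfolding semi_inner_on_def linear_functional_on_def by (simp add: subset_iff)

lemma inner_product_semi_inner:
  assumes V: "lin_space V" and B: "inner_product_on V B"
  shows "semi_inner_on V B"
proof -
  have "B (\<lambda>x. 0) w = 0" if "w \<in> V" for w
  proof -
    have "linear_functional_on V (\<lambda>u. B u w)" using B that by (simp add: inner_product_on_def linear_functional_on_def)
    then show ?thesis using linear_functional_zero[OF V, of "\<lambda>u. B u w"] by simp
  qed
  then have "0 \<le> B v v" if "v \<in> V" for v using B that by (cases "v = (\<lambda>x. 0)") (auto simp: inner_product_on_def less_imp_le)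
  then show ?thesis using B by (simp add: inner_product_on_def semi_inner_on_def linear_functional_on_def)
qed

lemma inner_product_subset: "inner_product_on V B \<Longrightarrow> W \<subseteq> V \<Longrightarrow> inner_product_on W B"
  unfolding inner_product_on_def by (simp add: subset_iff)

text \<open>That the \<open>e i\<close> span \<open>V\<close> is stated by means of the Fourier expansion.\<close>
definition orthonormal_basis ::
    "('a \<Rightarrow> real) set \<Rightarrow> (('a \<Rightarrow> real) \<Rightarrow> ('a \<Rightarrow> real) \<Rightarrow> real) \<Rightarrow> nat \<Rightarrow> (nat \<Rightarrow> 'a \<Rightarrow> real) \<Rightarrow> bool" where
  "orthonormal_basis V B n e \<longleftrightarrow>
     (\<forall>i<n. e i \<in> V) \<and> (\<forall>i<n. \<forall>j<n. B (e i) (e j) = (if i = j then 1 else 0)) \<and>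
     (\<forall>v\<in>V. v = (\<lambda>x. \<Sum>i<n. B v (e i) * e i x))"

lemma lin_space_span: "lin_space {v. \<exists>c :: nat \<Rightarrow> real. v = (\<lambda>x. \<Sum>i<N. c i * \<phi> i x)}"
  unfolding lin_space_def
proof (intro conjI ballI allI)
  show "(\<lambda>x. 0) \<in> {v. \<exists>c. v = (\<lambda>x. \<Sum>i<N. c i * \<phi> i x)}"
    by (auto intro!: exI[of _ "\<lambda>i. 0"])
  fix u v a assume "u \<in> {v. \<exists>c. v = (\<lambda>x. \<Sum>i<N. c i * \<phi> i x)}" "v \<in> {v. \<exists>c. v = (\<lambda>x. \<Sum>i<N. c i * \<phi> i x)}"
  then obtain c d where "u = (\<lambda>x. \<Sum>i<N. c i * \<phi> i x)" "v = (\<lambda>x. \<Sum>i<N. d i * \<phi> i x)" by auto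
  then show "(\<lambda>x. a * u x + v x) \<in> {v. \<exists>c. v = (\<lambda>x. \<Sum>i<N. c i * \<phi> i x)}"
    by (auto intro!: exI[of _ "\<lambda>i. a * c i + d i"] simp: sum_distrib_left sum.distrib[symmetric] algebra_simps)
qed

text \<open>Gram--Schmidt orthogonalisation.\<close>
lemma orthonormal_basis_exists:
  assumes "inner_product_on {v. \<exists>c :: nat \<Rightarrow> real. v = (\<lambda>x. \<Sum>i<N. c i * \<phi> i x)} B"
  shows "\<exists>n e. orthonormal_basis {v. \<exists>c :: nat \<Rightarrow> real. v = (\<lambda>x. \<Sum>i<N. c i * \<phi> i x)} B n e"
  using assms
proof (induction N)
  case 0
  then show ?case by (intro exI[of _ 0]) (auto simp: orthonormal_basis_def)
next
  case (Suc N)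
  define V where "V = {v. \<exists>c :: nat \<Rightarrow> real. v = (\<lambda>x. \<Sum>i<N. c i * \<phi> i x)}"
  define W where "W = {v. \<exists>c :: nat \<Rightarrow> real. v = (\<lambda>x. \<Sum>i<Suc N. c i * \<phi> i x)}"
  have V: "lin_space V" and W: "lin_space W" unfolding V_def W_def by (rule lin_space_span)+
  have prems: "inner_product_on W B" using Suc.prems by (simp only: W_def)
  have VW: "V \<subseteq> W"
  proof
    fix v assume "v \<in> V"
    then obtain c where c: "v = (\<lambda>x. \<Sum>i<N. c i * \<phi> i x)" by (auto simp: V_def)
    then show "v \<in> W" by (auto simp: W_def intro!: exI[of _ "c(N := 0)"])
  qed
  have "inner_product_on V B" by (rule inner_product_subset[OF prems VW])
  then obtain n e where "orthonormal_basis V B n e" using Suc.IH unfolding V_def by blast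
  then have e: "i < n \<Longrightarrow> e i \<in> V"
      "i < n \<Longrightarrow> j < n \<Longrightarrow> B (e i) (e j) = (if i = j then 1 else 0)"
      "v \<in> V \<Longrightarrow> v = (\<lambda>x. \<Sum>i<n. B v (e i) * e i x)"
    for i j v unfolding orthonormal_basis_def by blast+
  have eW: "e i \<in> W" if "i < n" for i using e(1)[OF that] VW by blast
  have B: "semi_inner_on W B" by (rule inner_product_semi_inner[OF W prems])
  define p where "p = \<phi> N"
  have pW: "p \<in> W"
  proof -
    have "p = (\<lambda>x. \<Sum>i<Suc N. (if i = N then 1 else 0) * \<phi> i x)" by (auto simp: p_def if_distrib)
    then show ?thesis unfolding W_def by (intro CollectI exI)
  qed
  have split: "\<exists>v'\<in>V. \<exists>c. v = (\<lambda>x. c * p x + v' x)" if v: "v \<in> W" for v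
  proof -
    obtain c where "v = (\<lambda>x. \<Sum>i<Suc N. c i * \<phi> i x)" using v by (auto simp: W_def)
    then show ?thesis
      by (intro bexI[of _ "\<lambda>x. \<Sum>i<N. c i * \<phi> i x"] exI[of _ "c N"]) (auto simp: p_def V_def)
  qed
  define s where "s = (\<lambda>x. \<Sum>i<n. B p (e i) * e i x)"
  define r where "r = (\<lambda>x. p x - s x)"
  have sW: "s \<in> W" unfolding s_def by (rule lin_space_sum[OF W]) (use eW in auto)
  have rW: "r \<in> W" unfolding r_def by (rule lin_space_diff[OF W pW sW])
  have Bs: "B s (e j) = B p (e j)" if j: "j < n" for j
  proof -
    have "B s (e j) = (\<Sum>i<n. B p (e i) * B (e i) (e j))"
      unfolding s_def by (rule linear_functional_sum[OF W semi_inner_left[OF B eW[OF j]]]) (use eW in auto)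
    also have "\<dots> = (\<Sum>i<n. if i = j then B p (e i) else 0)"
      by (rule sum.cong) (use e(2) j in auto)
    finally show ?thesis using j by simp
  qed
  have Br: "B r (e j) = 0" if j: "j < n" for j
    unfolding r_def using linear_functional_diff[OF W semi_inner_left[OF B eW[OF j]] pW sW] Bs[OF j] by simp
  have Bvr: "B v r = 0" if v: "v \<in> V" for v
  proof -
    have "B v r = (\<Sum>i<n. B v (e i) * B (e i) r)"
      by (subst e(3)[OF v], rule linear_functional_sum[OF W semi_inner_left[OF B rW]]) (use eW in auto)
    also have "\<dots> = 0" using Br semi_inner_sym[OF B eW rW] by simp
    finally show ?thesis .
  qed
  have "\<exists>n e. orthonormal_basis W B n e"
  proof (cases "r = (\<lambda>x. 0)")
    case True
    then have ps: "p = s" by (simp add: r_def fun_eq_iff)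
    have "v = (\<lambda>x. \<Sum>i<n. B v (e i) * e i x)" if v: "v \<in> W" for v
    proof -
      obtain v' c where v': "v' \<in> V" "v = (\<lambda>x. c * p x + v' x)" using split[OF v] by blast
      have "B v (e i) = c * B p (e i) + B v' (e i)" if "i < n" for i
        unfolding v'(2) using linear_functional_combine[OF semi_inner_left[OF B eW[OF that]] pW] v'(1) VW by blast
      then have "(\<lambda>x. \<Sum>i<n. B v (e i) * e i x) = (\<lambda>x. c * s x + (\<Sum>i<n. B v' (e i) * e i x))"
        by (auto simp: s_def fun_eq_iff sum_distrib_left sum.distrib[symmetric] algebra_simps)
      also have "\<dots> = v" using fun_cong[OF e(3)[OF v'(1)], symmetric] by (simp add: v'(2) ps)
      finally show ?thesis by simp
    qed
    then have "orthonormal_basis W B n e" using e(2) eW by (auto simp: orthonormal_basis_def)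
    then show ?thesis by blast
  next
    case False
    then have pos: "B r r > 0" using prems rW unfolding inner_product_on_def by blast
    define k where "k = sqrt (B r r)"
    have k: "k > 0" "k * k = B r r" using pos by (auto simp: k_def)
    define f where "f = (\<lambda>x. (1 / k) * r x)"
    have fW: "f \<in> W" unfolding f_def by (rule lin_space_scale[OF W rW])
    define e' where "e' = (\<lambda>i. if i < n then e i else f)"
    have Bvf: "B v f = (1 / k) * B v r" if "v \<in> W" for v
      unfolding f_def by (rule linear_functional_scale[OF W semi_inner_right[OF W B that] rW])
    have Bff: "B f f = 1"
    proof -
      have "B f r = (1 / k) * B r r"
        unfolding f_def by (rule linear_functional_scale[OF W semi_inner_left[OF B rW] rW])
      then have "B f f = (1 / k) * ((1 / k) * (k * k))" using Bvf[OF fW] k(2) by simp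
      then show ?thesis using k(1) by simp
    qed
    have Bef: "B (e i) f = 0" if "i < n" for i using Bvf[OF eW[OF that]] Bvr[OF e(1)[OF that]] by simp
    have Bfe: "B f (e i) = 0" if "i < n" for i using Bef[OF that] semi_inner_sym[OF B fW eW[OF that]] by simp
    have orth: "B (e' i) (e' j) = (if i = j then 1 else 0)" if "i < Suc n" "j < Suc n" for i j
      using that e(2)[of i j] Bff Bef[of i] Bfe[of j] by (auto simp: e'_def)
    have "v = (\<lambda>x. \<Sum>i<Suc n. B v (e' i) * e' i x)" if v: "v \<in> W" for v
    proof -
      obtain v' c where v': "v' \<in> V" "v = (\<lambda>x. c * p x + v' x)" using split[OF v] by blast
      have v'W: "v' \<in> W" using v'(1) VW by blast
      have 1: "B v (e i) = c * B p (e i) + B v' (e i)" if "i < n" for i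
        unfolding v'(2) by (rule linear_functional_combine[OF semi_inner_left[OF B eW[OF that]] pW v'W])
      have "B p r = B (\<lambda>x. r x + s x) r" by (simp add: r_def)
      also have "\<dots> = B r r + B s r" by (rule linear_functional_add[OF W semi_inner_left[OF B rW] rW sW])
      also have "B s r = 0"
        using Bvr[of s] lin_space_sum[OF V, of "{..<n}" e "\<lambda>i. B p (e i)"] e(1) by (auto simp: s_def)
      finally have "B p f = (1 / k) * (k * k)" using Bvf[OF pW] k(2) by simp
      then have "B p f = k" using k(1) by simp
      moreover have "B v f = c * B p f + B v' f"
        unfolding v'(2) by (rule linear_functional_combine[OF semi_inner_left[OF B fW] pW v'W])
      ultimately have 2: "B v f = c * k" using Bvf[OF v'W] Bvr[OF v'(1)] by simp
      have "(\<lambda>x. \<Sum>i<Suc n. B v (e' i) * e' i x) = (\<lambda>x. (\<Sum>i<n. B v (e i) * e i x) + B v f * f x)"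
        by (auto simp: e'_def)
      also have "\<dots> = (\<lambda>x. c * s x + (\<Sum>i<n. B v' (e i) * e i x) + c * r x)"
        using 1 k 2 by (auto simp: s_def f_def fun_eq_iff sum_distrib_left sum.distrib[symmetric] algebra_simps)
      also have "\<dots> = v"
        using fun_cong[OF e(3)[OF v'(1)], symmetric] by (simp add: v'(2) r_def algebra_simps)
      finally show ?thesis by simp
    qed
    then have "orthonormal_basis W B (Suc n) e'"
      using orth eW fW by (auto simp: orthonormal_basis_def e'_def)
    then show ?thesis by blast
  qed
  then show ?case unfolding W_def .
qed

text \<open>The Fourier coefficients of the representer of \<open>l\<close> are the values of \<open>l\<close> on the basis.\<close>
lemma riesz_representation:
  assumes V: "lin_space V" and B: "semi_inner_on V B" and e: "orthonormal_basis V B n e"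
    and l: "linear_functional_on V l"
  shows "(\<lambda>x. \<Sum>i<n. l (e i) * e i x) \<in> V" "v \<in> V \<Longrightarrow> B (\<lambda>x. \<Sum>i<n. l (e i) * e i x) v = l v"
proof -
  have eV: "e i \<in> V" if "i < n" for i using e that by (simp add: orthonormal_basis_def)
  show "(\<lambda>x. \<Sum>i<n. l (e i) * e i x) \<in> V" by (rule lin_space_sum[OF V]) (use eV in auto)
  assume v: "v \<in> V"
  have "l v = l (\<lambda>x. \<Sum>i<n. B v (e i) * e i x)" using e v by (metis orthonormal_basis_def)
  also have "\<dots> = (\<Sum>i<n. B v (e i) * l (e i))"
    by (rule linear_functional_sum[OF V l]) (use eV in auto)
  also have "\<dots> = (\<Sum>i<n. l (e i) * B (e i) v)"
    using semi_inner_sym[OF B v eV] by (intro sum.cong) auto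
  also have "\<dots> = B (\<lambda>x. \<Sum>i<n. l (e i) * e i x) v"
    by (rule linear_functional_sum[OF V semi_inner_left[OF B v], symmetric]) (use eV in auto)
  finally show "B (\<lambda>x. \<Sum>i<n. l (e i) * e i x) v = l v" by simp
qed

section \<open>The forms of the surface Sobolev space\<close>

context
  fixes \<Gamma> :: "'a::euclidean_space set" and \<nu> :: "'a \<Rightarrow> 'a"
  assumes hyp: "closed_C2_hypersurface \<Gamma>" and nor: "unit_normal_field \<Gamma> \<nu>"
begin

lemma weak_surf_grad_surf_grad: "v \<in> H1_surf \<Gamma> \<nu> \<Longrightarrow> weak_surf_grad \<Gamma> \<nu> v (surf_grad \<Gamma> \<nu> v)"
  unfolding H1_surf_def surf_grad_def using someI_ex[of "weak_surf_grad \<Gamma> \<nu> v"] by blast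

lemma H1_surf_L2: "v \<in> H1_surf \<Gamma> \<nu> \<Longrightarrow> v \<in> L2_space (surface_measure \<Gamma>)"
  by (simp add: H1_surf_def)

lemma surf_grad_L2: "v \<in> H1_surf \<Gamma> \<nu> \<Longrightarrow> surf_grad \<Gamma> \<nu> v \<in> L2_space (surface_measure \<Gamma>)"
  using weak_surf_grad_surf_grad by (simp add: weak_surf_grad_def)

lemma lin_space_H1_surf: "lin_space (H1_surf \<Gamma> \<nu>)"
proof -
  have "(\<lambda>x. 0) \<in> H1_surf \<Gamma> \<nu>"
    unfolding H1_surf_def weak_surf_grad_def by (auto simp: L2_space_def intro!: exI[of _ "\<lambda>x. 0"])
  moreover have "(\<lambda>x. a * u x + v x) \<in> H1_surf \<Gamma> \<nu>" if "u \<in> H1_surf \<Gamma> \<nu>" "v \<in> H1_surf \<Gamma> \<nu>" for a u v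
    using weak_surf_grad_combine[OF hyp nor weak_surf_grad_surf_grad[OF that(1)] H1_surf_L2[OF that(1)]
        weak_surf_grad_surf_grad[OF that(2)] H1_surf_L2[OF that(2)], of a]
      L2_space_combine[OF H1_surf_L2[OF that(1)] H1_surf_L2[OF that(2)], of a]
    unfolding H1_surf_def real_scaleR_def by blast
  ultimately show ?thesis by (simp add: lin_space_def)
qed

lemma surf_grad_combine:
  assumes u: "u \<in> H1_surf \<Gamma> \<nu>" and v: "v \<in> H1_surf \<Gamma> \<nu>"
  shows "AE x in surface_measure \<Gamma>.
    surf_grad \<Gamma> \<nu> (\<lambda>x. a * u x + v x) x = a *\<^sub>R surf_grad \<Gamma> \<nu> u x + surf_grad \<Gamma> \<nu> v x"
proof -
  have z: "(\<lambda>x. a * u x + v x) \<in> H1_surf \<Gamma> \<nu>" by (rule lin_space_combine[OF lin_space_H1_surf u v])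
  show ?thesis
    by (rule weak_surf_grad_unique[OF hyp nor H1_surf_L2[OF z] weak_surf_grad_surf_grad[OF z]
        weak_surf_grad_combine[OF hyp nor weak_surf_grad_surf_grad[OF u] H1_surf_L2[OF u]
          weak_surf_grad_surf_grad[OF v] H1_surf_L2[OF v]]])
qed

lemma semi_inner_ip_surf: "semi_inner_on (H1_surf \<Gamma> \<nu>) (ip_surf \<Gamma>)"
  unfolding semi_inner_on_def linear_functional_on_def
proof (intro conjI ballI allI)
  fix u v w a assume u: "u \<in> H1_surf \<Gamma> \<nu>" and v: "v \<in> H1_surf \<Gamma> \<nu>"
  show "ip_surf \<Gamma> u v = ip_surf \<Gamma> v u" by (simp add: ip_surf_def mult.commute)
  show "0 \<le> ip_surf \<Gamma> v v" by (simp add: ip_surf_def)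
  assume w: "w \<in> H1_surf \<Gamma> \<nu>"
  have "ip_surf \<Gamma> (\<lambda>x. a * u x + v x) w = (LINT x|surface_measure \<Gamma>. a * (u x * w x) + v x * w x)"
    unfolding ip_surf_def by (simp add: algebra_simps)
  also have "\<dots> = a * ip_surf \<Gamma> u w + ip_surf \<Gamma> v w"
    using L2_space_mult_integrable[OF H1_surf_L2[OF u] H1_surf_L2[OF w]]
      L2_space_mult_integrable[OF H1_surf_L2[OF v] H1_surf_L2[OF w]]
    unfolding ip_surf_def by (subst Bochner_Integration.integral_add) auto
  finally show "ip_surf \<Gamma> (\<lambda>x. a * u x + v x) w = a * ip_surf \<Gamma> u w + ip_surf \<Gamma> v w" .
qed

lemma semi_inner_grad_ip_surf: "semi_inner_on (H1_surf \<Gamma> \<nu>) (grad_ip_surf \<Gamma> \<nu>)"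
  unfolding semi_inner_on_def linear_functional_on_def
proof (intro conjI ballI allI)
  let ?D = "surf_grad \<Gamma> \<nu>" and ?\<mu> = "surface_measure \<Gamma>"
  fix u v w a assume u: "u \<in> H1_surf \<Gamma> \<nu>" and v: "v \<in> H1_surf \<Gamma> \<nu>"
  show "grad_ip_surf \<Gamma> \<nu> u v = grad_ip_surf \<Gamma> \<nu> v u" by (simp add: grad_ip_surf_def inner_commute)
  show "0 \<le> grad_ip_surf \<Gamma> \<nu> v v" by (simp add: grad_ip_surf_def)
  assume w: "w \<in> H1_surf \<Gamma> \<nu>"
  have z: "(\<lambda>x. a * u x + v x) \<in> H1_surf \<Gamma> \<nu>" by (rule lin_space_combine[OF lin_space_H1_surf u v])
  note I = L2_space_inner_integrable[OF surf_grad_L2 surf_grad_L2[OF w]]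
  have "(LINT x|?\<mu>. ?D (\<lambda>x. a * u x + v x) x \<bullet> ?D w x) = (LINT x|?\<mu>. a * (?D u x \<bullet> ?D w x) + ?D v x \<bullet> ?D w x)"
  proof (rule integral_cong_AE)
    show "AE x in ?\<mu>. ?D (\<lambda>x. a * u x + v x) x \<bullet> ?D w x = a * (?D u x \<bullet> ?D w x) + ?D v x \<bullet> ?D w x"
      using surf_grad_combine[OF u v, of a] by eventually_elim (simp add: inner_add_left)
  qed (use I[OF z] I[OF u] I[OF v] in auto)
  also have "\<dots> = a * (LINT x|?\<mu>. ?D u x \<bullet> ?D w x) + (LINT x|?\<mu>. ?D v x \<bullet> ?D w x)"
    using I[OF u] I[OF v] by (subst Bochner_Integration.integral_add) auto
  finally show "grad_ip_surf \<Gamma> \<nu> (\<lambda>x. a * u x + v x) w = a * grad_ip_surf \<Gamma> \<nu> u w + grad_ip_surf \<Gamma> \<nu> v w"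
    by (simp add: grad_ip_surf_def)
qed

end

section \<open>The stabilisation forms\<close>

text \<open>\<open>\<Gamma>\<close> need not be convex. The map is continuous because its graph is closed, being given by closed
  conditions, and its values lie in a compact set.\<close>
lemma closest_point_continuous:
  fixes \<Gamma> S :: "'a::euclidean_space set"
  assumes cG: "compact \<Gamma>" and cS: "compact S" and uniq: "\<forall>x\<in>S. \<exists>!y. y \<in> \<Gamma> \<and> (\<forall>z\<in>\<Gamma>. dist x y \<le> dist x z)"
  shows "continuous_on S (closest_point \<Gamma>)" "\<And>x. x \<in> S \<Longrightarrow> closest_point \<Gamma> x \<in> \<Gamma>"
proof -
  have cp: "closest_point \<Gamma> x \<in> \<Gamma> \<and> (\<forall>z\<in>\<Gamma>. dist x (closest_point \<Gamma> x) \<le> dist x z)" if "x \<in> S" for x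
  proof -
    have "\<exists>y. y \<in> \<Gamma> \<and> (\<forall>z\<in>\<Gamma>. dist x y \<le> dist x z)" using uniq that by (meson ex1_implies_ex)
    from someI_ex[OF this] show ?thesis unfolding closest_point_def .
  qed
  then show "\<And>x. x \<in> S \<Longrightarrow> closest_point \<Gamma> x \<in> \<Gamma>" by blast
  have "(\<lambda>x. (x, closest_point \<Gamma> x)) ` S = (S \<times> \<Gamma>) \<inter> (\<Inter>z\<in>\<Gamma>. {p. dist (fst p) (snd p) \<le> dist (fst p) z})"
    (is "?L = ?R")
  proof
    show "?L \<subseteq> ?R" using cp by auto
    show "?R \<subseteq> ?L"
    proof
      fix p assume p: "p \<in> ?R"
      then have "fst p \<in> S" and "snd p \<in> \<Gamma> \<and> (\<forall>z\<in>\<Gamma>. dist (fst p) (snd p) \<le> dist (fst p) z)" by auto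
      define near where "near y \<longleftrightarrow> y \<in> \<Gamma> \<and> (\<forall>z\<in>\<Gamma>. dist (fst p) y \<le> dist (fst p) z)" for y
      have "\<exists>!y. near y" unfolding near_def using uniq \<open>fst p \<in> S\<close> by (rule bspec)
      moreover have "near (snd p)" using \<open>snd p \<in> \<Gamma> \<and> _\<close> unfolding near_def .
      moreover have "near (closest_point \<Gamma> (fst p))"
        using cp[OF \<open>fst p \<in> S\<close>] unfolding near_def .
      ultimately have "snd p = closest_point \<Gamma> (fst p)" by blast
      then show "p \<in> ?L" using \<open>fst p \<in> S\<close> by (intro image_eqI[of _ _ "fst p"]) (auto simp: prod_eq_iff)
    qed
  qed
  moreover have "closed ?R"
    by (intro closed_Int closed_Times closed_INT ballI closed_Collect_le continuous_intros)
       (use cG cS compact_imp_closed in auto)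
  ultimately have "closed ((\<lambda>x. (x, closest_point \<Gamma> x)) ` S)" by simp
  then show "continuous_on S (closest_point \<Gamma>)"
    using cp cG by (intro continuous_from_closed_graph[of \<Gamma>]) auto
qed

lemma C1_scalar_add:
  assumes "C1_scalar f" "C1_scalar g"
  shows "C1_scalar (\<lambda>x. f x + g x)"
proof -
  obtain f' g' where f': "\<forall>x. (f has_derivative f' x) (at x)" "\<forall>h. continuous_on UNIV (\<lambda>x. f' x h)"
    and g': "\<forall>x. (g has_derivative g' x) (at x)" "\<forall>h. continuous_on UNIV (\<lambda>x. g' x h)"
    using assms unfolding C1_scalar_def by auto
  show ?thesis unfolding C1_scalar_def
    using f' g' by (intro exI[of _ "\<lambda>x h. f' x h + g' x h"]) (auto intro!: continuous_intros has_derivative_add)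
qed

lemma C1_scalar_polynomial: "real_polynomial_function q \<Longrightarrow> C1_scalar q"
proof (induction rule: real_polynomial_function.induct)
  case (linear f)
  then show ?case unfolding C1_scalar_def
    by (intro exI[of _ "\<lambda>x. f"]) (auto intro: bounded_linear_imp_has_derivative)
qed (auto intro: C1_scalar_const C1_scalar_add C1_scalar_mult)

lemma integrable_on_compact_lebesgue:
  fixes f :: "'a::euclidean_space \<Rightarrow> real"
  assumes "compact K" "continuous_on K f"
  shows "set_integrable lebesgue K f"
proof -
  have "integrable lborel (\<lambda>x. indicator K x *\<^sub>R f x)"
    using borel_integrable_compact[OF assms] by (simp add: indicator_def if_distrib cong: if_cong)
  then show ?thesis unfolding set_integrable_def
    by (subst integrable_completion) auto
qed

text \<open>A finite element function agrees with a polynomial on an element, so that its derivative is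
  classical inside the element and its normal derivative is there a continuous function on the whole
  element.\<close>
lemma normal_deriv_on_element:
  fixes \<Gamma> K :: "'a::euclidean_space set"
  assumes nu: "continuous_on \<Gamma> \<nu>"
    and cp: "continuous_on K (closest_point \<Gamma>)" "\<And>x. x \<in> K \<Longrightarrow> closest_point \<Gamma> x \<in> \<Gamma>"
    and q: "real_polynomial_function q" "\<And>x. x \<in> K \<Longrightarrow> v x = q x"
  obtains F where "continuous_on K F" "\<And>x. x \<in> interior K \<Longrightarrow> normal_deriv \<Gamma> \<nu> v x = F x"
    "\<And>x. x \<in> interior K \<Longrightarrow> v differentiable at x"
proof -
  obtain q' where q': "\<And>x. (q has_derivative q' x) (at x)" "\<And>h. continuous_on UNIV (\<lambda>x. q' x h)"
    using C1_scalar_polynomial[OF q(1)] unfolding C1_scalar_def by blast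
  let ?n = "\<lambda>x. \<nu> (closest_point \<Gamma> x)"
  define F where "F x = (\<Sum>b\<in>Basis. (?n x \<bullet> b) * q' x b)" for x
  have n: "continuous_on K ?n"
    by (rule continuous_on_compose2[OF nu cp(1)]) (use cp(2) in auto)
  have 1: "continuous_on K F" unfolding F_def
    using n q'(2) by (intro continuous_intros) (auto intro: continuous_on_subset)
  have der: "(v has_derivative q' x) (at x)" if "x \<in> interior K" for x
    by (rule has_derivative_transform_within_open[OF q'(1) open_interior that])
       (use q(2) interior_subset[of K] in force)
  have "normal_deriv \<Gamma> \<nu> v x = F x" if "x \<in> interior K" for x
  proof -
    have lin: "linear (q' x)" using q'(1)[of x] has_derivative_linear by blast
    have "normal_deriv \<Gamma> \<nu> v x = q' x (?n x)"
      unfolding normal_deriv_def using frechet_derivative_at[OF der[OF that]] by simp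
    also have "\<dots> = q' x (\<Sum>b\<in>Basis. (?n x \<bullet> b) *\<^sub>R b)" by (simp add: euclidean_representation)
    also have "\<dots> = F x" unfolding F_def using lin by (simp add: linear_sum linear_cmul)
    finally show ?thesis .
  qed
  moreover have "v differentiable at x" if "x \<in> interior K" for x
    using der[OF that] by (auto simp: differentiable_def)
  ultimately show ?thesis using 1 that by blast
qed

lemma semi_inner_stab_local:
  fixes \<Gamma> K :: "'a::euclidean_space set"
  assumes nu: "continuous_on \<Gamma> \<nu>" and K: "compact K" "negligible (frontier K)"
    and cp: "continuous_on K (closest_point \<Gamma>)" "\<And>x. x \<in> K \<Longrightarrow> closest_point \<Gamma> x \<in> \<Gamma>"
    and V: "lin_space V" "\<And>v. v \<in> V \<Longrightarrow> \<exists>q. real_polynomial_function q \<and> (\<forall>x\<in>K. v x = q x)"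
  shows "semi_inner_on V (stab_local \<Gamma> \<nu> j K)"
proof -
  let ?n = "normal_deriv \<Gamma> \<nu>"
  have elem: "\<exists>F. continuous_on K F \<and> (\<forall>x\<in>interior K. ?n v x = F x) \<and> (\<forall>x\<in>interior K. v differentiable at x)"
    if "v \<in> V" for v
  proof -
    obtain q where q: "real_polynomial_function q" "\<And>x. x \<in> K \<Longrightarrow> v x = q x" using V(2)[OF \<open>v \<in> V\<close>] by blast
    show ?thesis by (rule normal_deriv_on_element[OF nu cp q]) auto
  qed
  have fr: "interior K = K - frontier K"
    using interior_subset[of K] compact_imp_closed[OF K(1)] by (auto simp: frontier_def)
  have int: "set_integrable lebesgue K (\<lambda>x. ?n v x * ?n w x)" if v: "v \<in> V" and w: "w \<in> V" for v w
  proof -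
    obtain F G where F: "continuous_on K F" "\<forall>x\<in>interior K. ?n v x = F x"
      and G: "continuous_on K G" "\<forall>x\<in>interior K. ?n w x = G x"
      using elem[OF v] elem[OF w] by blast
    have "(\<lambda>x. F x * G x) absolutely_integrable_on K"
      by (rule integrable_on_compact_lebesgue[OF K(1)]) (intro continuous_intros F G)
    then show ?thesis
      by (rule absolutely_integrable_spike[OF _ K(2)]) (use F G fr in auto)
  qed
  have lin: "?n (\<lambda>x. a * u x + v x) x = a * ?n u x + ?n v x"
    if "u \<in> V" "v \<in> V" "x \<in> interior K" for u v a x
  proof -
    have du: "(u has_derivative frechet_derivative u (at x)) (at x)"
      and dv: "(v has_derivative frechet_derivative v (at x)) (at x)"
      using elem[OF that(1)] elem[OF that(2)] that(3) by (auto simp: frechet_derivative_works)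
    have "((\<lambda>x. a * u x + v x) has_derivative
        (\<lambda>h. a * frechet_derivative u (at x) h + frechet_derivative v (at x) h)) (at x)"
      by (auto intro!: derivative_eq_intros du dv)
    from frechet_derivative_at[OF this, symmetric] show ?thesis unfolding normal_deriv_def by simp
  qed
  have AE: "AE x in lebesgue. x \<notin> frontier K"
    using K(2) by (intro AE_not_in) (simp add: negligible_iff_null_sets)
  have base: "semi_inner_on V (\<lambda>v w. LINT x:K|lebesgue. ?n v x * ?n w x)"
    unfolding semi_inner_on_def linear_functional_on_def
  proof (intro conjI ballI allI)
    fix u v w a assume u: "u \<in> V" and v: "v \<in> V"
    show "(LINT x:K|lebesgue. ?n u x * ?n v x) = (LINT x:K|lebesgue. ?n v x * ?n u x)"
      by (simp add: mult.commute)
    show "0 \<le> (LINT x:K|lebesgue. ?n v x * ?n v x)"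
      unfolding set_lebesgue_integral_def by (intro Bochner_Integration.integral_nonneg) auto
    assume w: "w \<in> V"
    have z: "(\<lambda>x. a * u x + v x) \<in> V" by (rule lin_space_combine[OF V(1) u v])
    note I = int[OF u w] int[OF v w]
    have I2: "set_integrable lebesgue K (\<lambda>x. a * (?n u x * ?n w x) + ?n v x * ?n w x)"
      by (intro set_integral_add set_integrable_mult_right I)
    have "(LINT x:K|lebesgue. ?n (\<lambda>x. a * u x + v x) x * ?n w x)
        = (LINT x:K|lebesgue. a * (?n u x * ?n w x) + ?n v x * ?n w x)"
      unfolding set_lebesgue_integral_def
    proof (rule integral_cong_AE)
      show "(\<lambda>x. indicator K x *\<^sub>R (?n (\<lambda>x. a * u x + v x) x * ?n w x)) \<in> borel_measurable lebesgue"
        using int[OF z w] unfolding set_integrable_def by (rule borel_measurable_integrable)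
      show "(\<lambda>x. indicator K x *\<^sub>R (a * (?n u x * ?n w x) + ?n v x * ?n w x)) \<in> borel_measurable lebesgue"
        using I2 unfolding set_integrable_def by (rule borel_measurable_integrable)
      show "AE x in lebesgue. indicator K x *\<^sub>R (?n (\<lambda>x. a * u x + v x) x * ?n w x) =
          indicator K x *\<^sub>R (a * (?n u x * ?n w x) + ?n v x * ?n w x)"
        using AE
      proof eventually_elim
        case (elim x)
        then show ?case using lin[OF u v, of x a] fr by (cases "x \<in> K") (auto simp: algebra_simps)
      qed
    qed
    also have "\<dots> = a * (LINT x:K|lebesgue. ?n u x * ?n w x) + (LINT x:K|lebesgue. ?n v x * ?n w x)"
      using I by (subst set_integral_add) auto
    finally show "(LINT x:K|lebesgue. ?n (\<lambda>x. a * u x + v x) x * ?n w x) =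
        a * (LINT x:K|lebesgue. ?n u x * ?n w x) + (LINT x:K|lebesgue. ?n v x * ?n w x)" .
  qed
  have "0 \<le> diameter K powi (1 - 2 * j)" using diameter_ge_0[OF compact_imp_bounded[OF K(1)]] by simp
  from semi_inner_scale[OF base this] show ?thesis by (simp add: stab_local_def[abs_def])
qed

lemma diameter_pos:
  fixes K :: "'a::euclidean_space set"
  assumes "compact K" "interior K \<noteq> {}"
  shows "0 < diameter K"
proof -
  obtain x where x: "x \<in> interior K" using assms(2) by blast
  have "interior K \<noteq> {x}" using open_interior[of K] not_open_singleton by metis
  then obtain y where y: "y \<in> interior K" "y \<noteq> x" using x by blast
  then have "dist x y \<le> diameter K"
    using diameter_bounded_bound[OF compact_imp_bounded[OF assms(1)]] x interior_subset by blast
  then show ?thesis using y(2) by (smt (verit) dist_pos_lt)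
qed

text \<open>Raising the order \<open>j\<close> by one multiplies the form by \<open>h\<^sup>-\<^sup>2\<close>.\<close>
lemma stab_local_shift:
  assumes "0 < diameter K"
  shows "stab_local \<Gamma> \<nu> (j - 1) K v w = (diameter K)\<^sup>2 * stab_local \<Gamma> \<nu> j K v w"
proof -
  have "diameter K powi (1 - 2 * (j - 1)) = diameter K powi ((1 - 2 * j) + 2)" by (simp add: algebra_simps)
  also have "\<dots> = diameter K powi (1 - 2 * j) * (diameter K)\<^sup>2"
    using assms by (subst power_int_add) auto
  finally show ?thesis by (simp add: stab_local_def)
qed

section \<open>Weakly differentiable functions of one variable\<close>

lemma set_integrable_continuous_open_interval:
  fixes f :: "real \<Rightarrow> real"
  assumes "continuous_on {0..T} f"
  shows "set_integrable lborel {0<..<T} f"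
proof -
  have "set_integrable lborel {0..T} f"
    using borel_integrable_compact[OF compact_Icc assms]
    unfolding set_integrable_def by (simp add: indicator_def if_distrib cong: if_cong)
  then show ?thesis by (rule set_integrable_subset) auto
qed

text \<open>A continuously differentiable ramp that rises from \<open>0\<close> to \<open>1\<close> on the unit interval.\<close>

definition ramp :: "real \<Rightarrow> real" where
  "ramp y = 2 * (max 0 y)\<^sup>2 - 4 * (max 0 (y - 1/2))\<^sup>2 + 2 * (max 0 (y - 1))\<^sup>2"

text \<open>The derivative of the ramp: a hat function on the unit interval of height \<open>2\<close> and integral \<open>1\<close>.\<close>
definition tent :: "real \<Rightarrow> real" where
  "tent y = 4 * max 0 y - 8 * max 0 (y - 1/2) + 4 * max 0 (y - 1)"

lemma DERIV_ramp: "(ramp has_real_derivative tent y) (at y)"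
proof -
  have p: "((\<lambda>s::real. (max 0 (s - c))\<^sup>2) has_real_derivative 2 * max 0 (y - c)) (at y)" for c
  proof -
    have "((\<lambda>s. s - c) has_real_derivative 1) (at y)" by (auto intro!: derivative_eq_intros)
    from DERIV_chain2[OF has_real_derivative_pos_part_square this] show ?thesis by simp
  qed
  have "((\<lambda>y. 2 * (max 0 (y - 0))\<^sup>2 - 4 * (max 0 (y - 1/2))\<^sup>2 + 2 * (max 0 (y - 1))\<^sup>2) has_real_derivative
     2 * (2 * max 0 (y - 0)) - 4 * (2 * max 0 (y - 1/2)) + 2 * (2 * max 0 (y - 1))) (at y)"
    by (intro DERIV_add DERIV_diff DERIV_cmult p)
  then show ?thesis by (simp add: ramp_def[abs_def] tent_def)
qed

lemma continuous_tent: "continuous_on S tent"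
  unfolding tent_def by (intro continuous_intros)

lemma ramp_zero: "y \<le> 0 \<Longrightarrow> ramp y = 0"
  by (simp add: ramp_def)

lemma ramp_one: "1 \<le> y \<Longrightarrow> ramp y = 1"
  by (simp add: ramp_def max_def power2_eq_square algebra_simps)

lemma tent_outside: "y \<notin> {0..1} \<Longrightarrow> tent y = 0"
  by (auto simp: tent_def max_def not_le)

lemma tent_bounds: "0 \<le> tent y" "tent y \<le> 2"
  by (auto simp: tent_def max_def)

lemma ramp_bounds: "0 \<le> ramp y" "ramp y \<le> 1"
proof -
  have mono: "ramp x \<le> ramp z" if "x \<le> z" for x z
    by (rule DERIV_nonneg_imp_nondecreasing[OF that]) (use DERIV_ramp tent_bounds in blast)
  show "0 \<le> ramp y" using mono[of "min y 0" y] ramp_zero[of "min y 0"] by simp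
  show "ramp y \<le> 1" using mono[of y "max y 1"] ramp_one[of "max y 1"] by simp
qed

lemma integral_tent: "(LINT y|lborel. tent y) = 1"
proof -
  have "isCont tent x" for x using continuous_tent[of UNIV] continuous_on_eq_continuous_at by blast
  then have "(LINT y|lborel. tent y * indicator {0..1} y) = ramp 1 - ramp 0"
    by (intro integral_FTC_Icc_real DERIV_ramp) auto
  moreover have "tent y * indicator {0..1} y = tent y" for y
    using tent_outside[of y] by (auto simp: indicator_def)
  ultimately show ?thesis by (simp add: ramp_zero ramp_one)
qed

text \<open>The kernels \<open>n tent (n x)\<close>, \<open>n = k + 1\<close>, are a mollifier; their supports \<open>[\<sigma> k, \<sigma> k + 1 / n]\<close> are
  required to lie inside the time interval, so that end points are admitted as limits.\<close>
lemma mollifier_limit: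
  fixes f :: "real \<Rightarrow> real"
  assumes f: "continuous_on {0..T} f" and s: "s \<in> {0..T}"
    and lim: "\<sigma> \<longlonglongrightarrow> s"
    and inside: "\<forall>\<^sub>F k in sequentially. 0 < \<sigma> k \<and> \<sigma> k + 1 / real (Suc k) < T"
  shows "(\<lambda>k. LINT x:{0<..<T}|lborel. real (Suc k) * tent (real (Suc k) * (x - \<sigma> k)) * f x) \<longlonglongrightarrow> f s"
proof -
  define g where "g x = indicator {0<..<T} x *\<^sub>R f x" for x
  have gm: "g \<in> borel_measurable borel" unfolding g_def
    by (rule borel_measurable_continuous_on_indicator) (auto intro: continuous_on_subset[OF f])
  have tm: "tent \<in> borel_measurable borel" by (intro borel_measurable_continuous_onI continuous_tent)
  have "compact (f ` {0..T})" by (rule compact_continuous_image[OF f compact_Icc])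
  then obtain K where K: "\<forall>y\<in>f ` {0..T}. norm y \<le> K" using compact_imp_bounded bounded_iff by blast
  have gK: "\<bar>g x\<bar> \<le> \<bar>K\<bar>" for x
  proof (cases "x \<in> {0<..<T}")
    case True
    then have "norm (f x) \<le> K" using K by (intro bspec[OF K] imageI) auto
    then show ?thesis using True by (simp add: g_def)
  qed (simp add: g_def)
  have sub: "(LINT x:{0<..<T}|lborel. real (Suc k) * tent (real (Suc k) * (x - \<sigma> k)) * f x)
      = (LINT y|lborel. tent y * g (\<sigma> k + (1 / real (Suc k)) * y))" for k
  proof -
    have "(LINT x:{0<..<T}|lborel. real (Suc k) * tent (real (Suc k) * (x - \<sigma> k)) * f x)
        = (LINT x|lborel. real (Suc k) * tent (real (Suc k) * (x - \<sigma> k)) * g x)"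
      unfolding set_lebesgue_integral_def g_def
      by (intro Bochner_Integration.integral_cong) (auto simp: algebra_simps)
    also have "\<dots> = \<bar>1 / real (Suc k)\<bar> *\<^sub>R (LINT y|lborel. real (Suc k) *
        tent (real (Suc k) * (\<sigma> k + (1 / real (Suc k)) * y - \<sigma> k)) * g (\<sigma> k + (1 / real (Suc k)) * y))"
      by (rule lborel_integral_real_affine) simp
    also have "\<dots> = \<bar>1 / real (Suc k)\<bar> *\<^sub>R (LINT y|lborel. real (Suc k) * (tent y * g (\<sigma> k + (1 / real (Suc k)) * y)))"
      by (simp add: mult.assoc del: of_nat_Suc)
    also have "\<dots> = (LINT y|lborel. tent y * g (\<sigma> k + (1 / real (Suc k)) * y))"
      by (simp del: of_nat_Suc)
    finally show ?thesis .
  qed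
  have "(\<lambda>k. LINT y|lborel. tent y * g (\<sigma> k + (1 / real (Suc k)) * y)) \<longlonglongrightarrow> (LINT y|lborel. tent y * f s)"
  proof (rule integral_dominated_convergence[where w = "\<lambda>y. 2 * \<bar>K\<bar> * indicator {0..1} y"])
    show "(\<lambda>y. tent y * f s) \<in> borel_measurable lborel" using tm by simp
    show "(\<lambda>y. tent y * g (\<sigma> k + (1 / real (Suc k)) * y)) \<in> borel_measurable lborel" for k
      using tm gm by measurable
    show "integrable lborel (\<lambda>y::real. 2 * \<bar>K\<bar> * indicator {0..1} y)" by simp
    show "AE y in lborel. norm (tent y * g (\<sigma> k + (1 / real (Suc k)) * y)) \<le> 2 * \<bar>K\<bar> * indicator {0..1} y" for k
    proof (rule AE_I2)
      fix y :: real
      show "norm (tent y * g (\<sigma> k + (1 / real (Suc k)) * y)) \<le> 2 * \<bar>K\<bar> * indicator {0..1} y"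
        using tent_outside[of y] tent_bounds[of y] gK[of "\<sigma> k + (1 / real (Suc k)) * y"]
        by (cases "y \<in> {0..1}") (auto simp: abs_mult intro!: mult_mono simp del: of_nat_Suc)
    qed
    show "AE y in lborel. (\<lambda>k. tent y * g (\<sigma> k + (1 / real (Suc k)) * y)) \<longlonglongrightarrow> tent y * f s"
    proof (rule AE_I2)
      fix y :: real
      show "(\<lambda>k. tent y * g (\<sigma> k + (1 / real (Suc k)) * y)) \<longlonglongrightarrow> tent y * f s"
      proof (cases "y \<in> {0..1}")
        case True
        let ?x = "\<lambda>k. \<sigma> k + (1 / real (Suc k)) * y"
        have "(\<lambda>k. 1 / real (Suc k)) \<longlonglongrightarrow> 0" using LIMSEQ_inverse_real_of_nat by (simp add: inverse_eq_divide)
        then have "?x \<longlonglongrightarrow> s + 0 * y" by (intro tendsto_intros lim)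
        then have x: "?x \<longlonglongrightarrow> s" by simp
        have ins: "\<forall>\<^sub>F k in sequentially. ?x k \<in> {0<..<T}"
          using inside
        proof eventually_elim
          case (elim k)
          have "0 \<le> (1 / real (Suc k)) * y" "(1 / real (Suc k)) * y \<le> 1 / real (Suc k)"
            using True by (auto simp: divide_right_mono simp del: of_nat_Suc)
          then show ?case using elim unfolding greaterThanLessThan_iff by linarith
        qed
        have "(\<lambda>k. f (?x k)) \<longlonglongrightarrow> f s"
          by (rule continuous_on_tendsto_compose[OF f x s])
             (use ins in eventually_elim, auto)
        moreover have "\<forall>\<^sub>F k in sequentially. f (?x k) = g (?x k)"
          using ins by eventually_elim (simp add: g_def)
        ultimately have "(\<lambda>k. g (?x k)) \<longlonglongrightarrow> f s" by (rule Lim_transform_eventually)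
        then show ?thesis by (intro tendsto_intros)
      qed (simp add: tent_outside)
    qed
  qed
  then show ?thesis unfolding sub by (simp add: integral_tent)
qed

text \<open>The fundamental theorem of calculus for weak derivatives. The test functions are differences of
  two steep ramps placed just inside the interval of integration, so that no interior point has to be
  singled out and the end points of the time interval are allowed.\<close>
lemma weak_derivative_integral:
  fixes f g :: "real \<Rightarrow> real"
  assumes f: "continuous_on {0..T} f" and g: "set_integrable lborel {0<..<T} g"
    and weak: "\<And>\<phi>. time_test_function T \<phi> \<Longrightarrow>
       (LINT t:{0<..<T}|lborel. deriv \<phi> t * f t) = - (LINT t:{0<..<T}|lborel. \<phi> t * g t)"
    and st: "0 \<le> s" "s < t" "t \<le> T"
  shows "f t - f s = (LINT x:{s<..<t}|lborel. g x)"
proof -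
  \<comment> \<open>The ramps rise on \<open>[\<alpha> k, \<alpha> k + 1 / n]\<close> and \<open>[\<beta> k, \<beta> k + 1 / n]\<close> with \<open>n = k + 1\<close>, both inside
      \<open>(s, t)\<close> for large \<open>k\<close>.\<close>
  define \<alpha> where "\<alpha> k = s + 1 / real (Suc k)" for k
  define \<beta> where "\<beta> k = t - 2 / real (Suc k)" for k
  define \<phi> where "\<phi> k x = ramp (real (Suc k) * (x - \<alpha> k)) - ramp (real (Suc k) * (x - \<beta> k))" for k x
  have inv: "(\<lambda>k. 1 / real (Suc k)) \<longlonglongrightarrow> 0" using LIMSEQ_inverse_real_of_nat by (simp add: inverse_eq_divide)
  have \<alpha>: "\<alpha> \<longlonglongrightarrow> s" unfolding \<alpha>_def using tendsto_add[OF tendsto_const[of s] inv] by simp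
  have \<beta>: "\<beta> \<longlonglongrightarrow> t" unfolding \<beta>_def using tendsto_diff[OF tendsto_const[of t] tendsto_mult[OF tendsto_const[of 2] inv]] by simp
  have large: "\<forall>\<^sub>F k in sequentially. 4 / (t - s) < real (Suc k)"
    using eventually_gt_at_top[of "nat \<lceil>4 / (t - s)\<rceil>"] by eventually_elim linarith
  have d\<phi>: "(\<phi> k has_real_derivative
      real (Suc k) * tent (real (Suc k) * (x - \<alpha> k)) - real (Suc k) * tent (real (Suc k) * (x - \<beta> k))) (at x)" for k x
  proof -
    have "((\<lambda>x. ramp (real (Suc k) * (x - a))) has_real_derivative tent (real (Suc k) * (x - a)) * real (Suc k)) (at x)" for a
      by (rule DERIV_chain2[OF DERIV_ramp]) (auto intro!: derivative_eq_intros)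
    from DERIV_diff[OF this[of "\<alpha> k"] this[of "\<beta> k"]] show ?thesis
      by (simp only: \<phi>_def[abs_def] mult.commute)
  qed
  have deriv: "deriv (\<phi> k) = (\<lambda>x. real (Suc k) * tent (real (Suc k) * (x - \<alpha> k)) - real (Suc k) * tent (real (Suc k) * (x - \<beta> k)))" for k
    using DERIV_imp_deriv[OF d\<phi>] by blast
  have test: "time_test_function T (\<phi> k)" if k: "4 / (t - s) < real (Suc k)" for k
  proof -
    let ?\<kappa> = "real (Suc k)"
    have \<kappa>: "?\<kappa> > 0" by simp
    have 4: "4 < ?\<kappa> * (t - s)" using k st by (simp add: pos_divide_less_eq)
    show ?thesis unfolding time_test_function_def
    proof (intro conjI allI)
      show "\<phi> k field_differentiable at x" for x using d\<phi> unfolding field_differentiable_def by blast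
      show "continuous_on UNIV (deriv (\<phi> k))" unfolding deriv
        by (intro continuous_intros continuous_on_compose2[OF continuous_tent[of UNIV]]) auto
      have pos: "0 < \<alpha> k" unfolding \<alpha>_def using st \<kappa> by (intro add_nonneg_pos) auto
      have less: "t - 1 / ?\<kappa> < T" using st \<kappa> by (smt (verit) zero_less_divide_1_iff)
      have "\<phi> k x = 0" if x: "x \<notin> {\<alpha> k..t - 1 / ?\<kappa>}" for x
      proof -
      have A: "?\<kappa> * (x - \<alpha> k) = ?\<kappa> * (x - s) - 1" and Bx: "?\<kappa> * (x - \<beta> k) = ?\<kappa> * (x - t) + 2"
        using \<kappa> by (simp_all add: \<alpha>_def \<beta>_def field_simps del: of_nat_Suc)
      have sum: "?\<kappa> * (x - s) = ?\<kappa> * (x - t) + ?\<kappa> * (t - s)" by (simp add: algebra_simps)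
      show ?thesis
      proof (cases "x < \<alpha> k")
        case True
        then have "?\<kappa> * (x - \<alpha> k) < 0" using \<kappa> by (intro mult_pos_neg) auto
        then show ?thesis unfolding \<phi>_def using A Bx sum 4 by (simp add: ramp_zero del: of_nat_Suc)
      next
        case False
        then have "t - 1 / ?\<kappa> < x" using x by auto
        then have "?\<kappa> * (t - 1 / ?\<kappa>) < ?\<kappa> * x" using \<kappa> by (intro mult_strict_left_mono)
        then have "-1 < ?\<kappa> * (x - t)" using \<kappa> by (simp add: algebra_simps del: of_nat_Suc)
        then show ?thesis unfolding \<phi>_def using A Bx sum 4 by (simp add: ramp_one del: of_nat_Suc)
      qed
      qed
      with pos less show "\<exists>a b. 0 < a \<and> b < T \<and> (\<forall>x. x \<notin> {a..b} \<longrightarrow> \<phi> k x = 0)" by blast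
    qed
  qed
  have fint: "set_integrable lborel {0<..<T} (\<lambda>x. real (Suc k) * tent (real (Suc k) * (x - a)) * f x)" for k a
    by (intro set_integrable_continuous_open_interval continuous_intros f
        continuous_on_compose2[OF continuous_tent[of UNIV]]) auto
  have lim: "(\<lambda>k. LINT x:{0<..<T}|lborel. deriv (\<phi> k) x * f x) \<longlonglongrightarrow> f s - f t"
  proof -
    have "\<forall>\<^sub>F k in sequentially. (0 < \<alpha> k \<and> \<alpha> k + 1 / real (Suc k) < T) \<and>
        0 < \<beta> k \<and> \<beta> k + 1 / real (Suc k) < T"
      using large
    proof eventually_elim
      case (elim k)
      have "4 < real (Suc k) * (t - s)" using elim st by (simp add: pos_divide_less_eq)
      then have "4 / real (Suc k) < t - s" by (simp add: pos_divide_less_eq mult.commute del: of_nat_Suc)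
      moreover have "0 < 1 / real (Suc k)" by simp
      ultimately show ?case using st unfolding \<alpha>_def \<beta>_def by linarith
    qed
    then have 1: "\<forall>\<^sub>F k in sequentially. 0 < \<alpha> k \<and> \<alpha> k + 1 / real (Suc k) < T"
      and 2: "\<forall>\<^sub>F k in sequentially. 0 < \<beta> k \<and> \<beta> k + 1 / real (Suc k) < T"
      by (simp_all only: eventually_conj_iff)
    have "(LINT x:{0<..<T}|lborel. deriv (\<phi> k) x * f x) =
        (LINT x:{0<..<T}|lborel. real (Suc k) * tent (real (Suc k) * (x - \<alpha> k)) * f x) -
        (LINT x:{0<..<T}|lborel. real (Suc k) * tent (real (Suc k) * (x - \<beta> k)) * f x)" for k
      unfolding deriv left_diff_distrib by (rule set_integral_diff(2)[OF fint fint])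
    then show ?thesis
      using tendsto_diff[OF mollifier_limit[OF f _ \<alpha> 1] mollifier_limit[OF f _ \<beta> 2]] st by simp
  qed
  have "(\<lambda>k. LINT x:{0<..<T}|lborel. \<phi> k x * g x) \<longlonglongrightarrow> (LINT x:{s<..<t}|lborel. g x)"
    unfolding set_lebesgue_integral_def
  proof (rule integral_dominated_convergence[where w = "\<lambda>x. \<bar>indicator {0<..<T} x *\<^sub>R g x\<bar>"])
    have sub: "set_integrable lborel {s<..<t} g" by (rule set_integrable_subset[OF g]) (use st in auto)
    show "(\<lambda>x. indicator {s<..<t} x *\<^sub>R g x) \<in> borel_measurable lborel"
      using sub unfolding set_integrable_def by (rule borel_measurable_integrable)
    show "integrable lborel (\<lambda>x. \<bar>indicator {0<..<T} x *\<^sub>R g x\<bar>)"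
      using g unfolding set_integrable_def by (rule integrable_abs)
    have \<phi>m: "\<phi> k \<in> borel_measurable borel" for k
      by (rule borel_measurable_continuous_onI, rule DERIV_continuous_on, rule has_field_derivative_at_within, rule d\<phi>)
    have "(\<lambda>x. \<phi> k x * (indicator {0<..<T} x *\<^sub>R g x)) \<in> borel_measurable lborel" for k
      using \<phi>m[of k] borel_measurable_integrable[OF g[unfolded set_integrable_def]] by measurable
    then show "(\<lambda>x. indicator {0<..<T} x *\<^sub>R (\<phi> k x * g x)) \<in> borel_measurable lborel" for k
      by (simp add: mult_ac)
    have "\<bar>\<phi> k x\<bar> \<le> 1" for k x
      unfolding \<phi>_def using ramp_bounds[of "real (Suc k) * (x - \<alpha> k)"] ramp_bounds[of "real (Suc k) * (x - \<beta> k)"]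
      by linarith
    then show "AE x in lborel. norm (indicator {0<..<T} x *\<^sub>R (\<phi> k x * g x)) \<le> \<bar>indicator {0<..<T} x *\<^sub>R g x\<bar>" for k
      by (intro AE_I2) (auto simp: abs_mult indicator_def mult_left_le_one_le)
    show "AE x in lborel. (\<lambda>k. indicator {0<..<T} x *\<^sub>R (\<phi> k x * g x)) \<longlonglongrightarrow> indicator {s<..<t} x *\<^sub>R g x"
    proof (rule AE_I2)
      fix x
      have ev: "\<forall>\<^sub>F k in sequentially. indicator {0<..<T} x *\<^sub>R (\<phi> k x * g x) = indicator {s<..<t} x *\<^sub>R g x"
      proof (cases "x \<in> {s<..<t}")
        case True
        then have x: "s < x" "x < t" by auto
        have "\<forall>\<^sub>F k in sequentially. 2 / (x - s) < real (Suc k)"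
          using eventually_gt_at_top[of "nat \<lceil>2 / (x - s)\<rceil>"] by eventually_elim linarith
        moreover have "\<forall>\<^sub>F k in sequentially. 2 / (t - x) < real (Suc k)"
          using eventually_gt_at_top[of "nat \<lceil>2 / (t - x)\<rceil>"] by eventually_elim linarith
        ultimately show ?thesis
        proof eventually_elim
          case (elim k)
          have "2 < real (Suc k) * (x - s)" "2 < real (Suc k) * (t - x)"
            using elim x by (simp_all add: pos_divide_less_eq)
          moreover have "real (Suc k) * (x - \<alpha> k) = real (Suc k) * (x - s) - 1"
            "real (Suc k) * (x - \<beta> k) = - (real (Suc k) * (t - x)) + 2"
            by (simp_all add: \<alpha>_def \<beta>_def field_simps del: of_nat_Suc)
          ultimately have "\<phi> k x = 1" unfolding \<phi>_def by (simp add: ramp_one ramp_zero del: of_nat_Suc)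
          then show ?case using x st by simp
        qed
      next
        case False
        show ?thesis using large
        proof eventually_elim
          case (elim k)
          have 4: "4 < real (Suc k) * (t - s)" using elim st by (simp add: pos_divide_less_eq)
          have A: "real (Suc k) * (x - \<alpha> k) = real (Suc k) * (x - s) - 1"
            and Bx: "real (Suc k) * (x - \<beta> k) = real (Suc k) * (x - t) + 2"
            by (simp_all add: \<alpha>_def \<beta>_def field_simps del: of_nat_Suc)
          have sum: "real (Suc k) * (x - s) = real (Suc k) * (x - t) + real (Suc k) * (t - s)" by (simp add: algebra_simps)
          have "\<phi> k x = 0"
          proof (cases "x \<le> s")
            case True
            then have "real (Suc k) * (x - s) \<le> 0" by (intro mult_nonneg_nonpos) auto
            then show ?thesis unfolding \<phi>_def using A Bx sum 4 by (simp add: ramp_zero del: of_nat_Suc)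
          next
            case nx: False
            then have "0 \<le> real (Suc k) * (x - t)" using False by (intro mult_nonneg_nonneg) auto
            then show ?thesis unfolding \<phi>_def using A Bx sum 4 by (simp add: ramp_one del: of_nat_Suc)
          qed
          then show ?case using False by simp
        qed
      qed
      then show "(\<lambda>k. indicator {0<..<T} x *\<^sub>R (\<phi> k x * g x)) \<longlonglongrightarrow> indicator {s<..<t} x *\<^sub>R g x"
        by (rule tendsto_eventually)
    qed
  qed
  then have "(\<lambda>k. - (LINT x:{0<..<T}|lborel. \<phi> k x * g x)) \<longlonglongrightarrow> - (LINT x:{s<..<t}|lborel. g x)"
    by (rule tendsto_minus)
  moreover have "\<forall>\<^sub>F k in sequentially. - (LINT x:{0<..<T}|lborel. \<phi> k x * g x) =
      (LINT x:{0<..<T}|lborel. deriv (\<phi> k) x * f x)"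
    using large
  proof eventually_elim
    case (elim k)
    show ?case unfolding weak[OF test[OF elim]] by (rule refl)
  qed
  ultimately have "(\<lambda>k. LINT x:{0<..<T}|lborel. deriv (\<phi> k) x * f x) \<longlonglongrightarrow> - (LINT x:{s<..<t}|lborel. g x)"
    by (rule Lim_transform_eventually)
  then have "f s - f t = - (LINT x:{s<..<t}|lborel. g x)"
    by (rule LIMSEQ_unique[OF lim])
  then show ?thesis by simp
qed

lemma set_integral_split_open:
  fixes f :: "real \<Rightarrow> real"
  assumes f: "set_integrable lborel {a<..<c} f" and ab: "a \<le> b" "b \<le> c"
  shows "(LINT x:{a<..<c}|lborel. f x) = (LINT x:{a<..<b}|lborel. f x) + (LINT x:{b<..<c}|lborel. f x)"
proof -
  have 1: "set_integrable lborel {a<..<b} f" "set_integrable lborel {b<..<c} f"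
    using ab by (auto intro: set_integrable_subset[OF f])
  have "(LINT x:{a<..<c}|lborel. f x) = (LINT x|lborel. indicator {a<..<b} x *\<^sub>R f x + indicator {b<..<c} x *\<^sub>R f x)"
    unfolding set_lebesgue_integral_def
  proof (rule integral_cong_AE)
    show "AE x in lborel. indicator {a<..<c} x *\<^sub>R f x = indicator {a<..<b} x *\<^sub>R f x + indicator {b<..<c} x *\<^sub>R f x"
      using AE_lborel_singleton[of b] by eventually_elim (use ab in \<open>auto simp: indicator_def\<close>)
  qed (use f 1 in \<open>auto simp: set_integrable_def\<close>)
  also have "\<dots> = (LINT x:{a<..<b}|lborel. f x) + (LINT x:{b<..<c}|lborel. f x)"
    using 1 unfolding set_lebesgue_integral_def set_integrable_def by (rule Bochner_Integration.integral_add)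
  finally show ?thesis .
qed

text \<open>The chain rule for the square of an absolutely continuous function: on each cell of a fine
  partition, the function differs little from the mean of its end values.\<close>
lemma energy_identity:
  fixes f g :: "real \<Rightarrow> real"
  assumes f: "continuous_on {0..T} f" and g: "set_integrable lborel {0<..<T} g"
    and ftc: "\<And>s t. 0 \<le> s \<Longrightarrow> s < t \<Longrightarrow> t \<le> T \<Longrightarrow> f t - f s = (LINT x:{s<..<t}|lborel. g x)"
    and \<tau>: "0 \<le> \<tau>" "\<tau> \<le> T"
  shows "set_integrable lborel {0<..<T} (\<lambda>x. g x * f x)"
    and "(f \<tau>)\<^sup>2 - (f 0)\<^sup>2 = 2 * (LINT x:{0<..<\<tau>}|lborel. g x * f x)"
proof -
  have "compact (f ` {0..T})" by (rule compact_continuous_image[OF f compact_Icc])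
  then obtain K where K: "\<forall>y\<in>f ` {0..T}. norm y \<le> K" using compact_imp_bounded bounded_iff by blast
  have gm: "(\<lambda>x. indicator {0<..<T} x *\<^sub>R g x) \<in> borel_measurable lborel"
    using g unfolding set_integrable_def by (rule borel_measurable_integrable)
  have fm: "(\<lambda>x. indicator {0<..<T} x *\<^sub>R f x) \<in> borel_measurable lborel"
    using borel_measurable_continuous_on_indicator[of "{0<..<T}" f]
      continuous_on_subset[OF f, of "{0<..<T}"] by (auto simp: subset_iff)
  show gf: "set_integrable lborel {0<..<T} (\<lambda>x. g x * f x)"
    unfolding set_integrable_def
  proof (rule Bochner_Integration.integrable_bound[of _ "\<lambda>x. \<bar>K\<bar> * (indicator {0<..<T} x *\<^sub>R g x)"])
    show "integrable lborel (\<lambda>x. \<bar>K\<bar> * (indicator {0<..<T} x *\<^sub>R g x))"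
      using g unfolding set_integrable_def by simp
    have "(\<lambda>x. (indicator {0<..<T} x *\<^sub>R g x) * (indicator {0<..<T} x *\<^sub>R f x)) \<in> borel_measurable lborel"
      using gm fm by measurable
    then show "(\<lambda>x. indicator {0<..<T} x *\<^sub>R (g x * f x)) \<in> borel_measurable lborel"
      by (rule measurable_cong[THEN iffD1, rotated]) (auto simp: indicator_def)
    have "\<bar>f x\<bar> \<le> \<bar>K\<bar>" if "x \<in> {0<..<T}" for x
    proof -
      have "norm (f x) \<le> K" using that by (intro bspec[OF K] imageI) auto
      then show ?thesis by simp
    qed
    then show "AE x in lborel. norm (indicator {0<..<T} x *\<^sub>R (g x * f x)) \<le> norm (\<bar>K\<bar> * (indicator {0<..<T} x *\<^sub>R g x))"
      by (intro AE_I2) (auto simp: indicator_def abs_mult mult.commute[of "\<bar>g _\<bar>"] intro!: mult_right_mono)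
  qed
  have gi: "set_integrable lborel {a<..<b} g" if "0 \<le> a" "b \<le> T" for a b
    by (rule set_integrable_subset[OF g]) (use that in auto)
  have gfi: "set_integrable lborel {a<..<b} (\<lambda>x. g x * f x)" if "0 \<le> a" "b \<le> T" for a b
    by (rule set_integrable_subset[OF gf]) (use that in auto)
  have gai: "set_integrable lborel {a<..<b} (\<lambda>x. \<bar>g x\<bar>)" if "0 \<le> a" "b \<le> T" for a b
    using set_integrable_abs[OF gi[OF that]] by simp
  define J where "J = (LINT x:{0<..<\<tau>}|lborel. \<bar>g x\<bar>)"
  have J: "0 \<le> J" unfolding J_def set_lebesgue_integral_def by (intro Bochner_Integration.integral_nonneg) auto
  define E where "E s = (f s)\<^sup>2 - (f 0)\<^sup>2 - 2 * (LINT x:{0<..<s}|lborel. g x * f x)" for s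
  have bound: "\<bar>E \<tau>\<bar> \<le> 2 * \<epsilon> * J" if \<epsilon>: "\<epsilon> > 0" for \<epsilon>
  proof -
    have "uniformly_continuous_on {0..T} f" by (rule compact_uniformly_continuous[OF f compact_Icc])
    then obtain \<delta> where \<delta>: "\<delta> > 0" "\<And>x y. x \<in> {0..T} \<Longrightarrow> y \<in> {0..T} \<Longrightarrow> dist y x < \<delta> \<Longrightarrow> dist (f y) (f x) < \<epsilon>"
      using \<epsilon> unfolding uniformly_continuous_on_def by metis
    obtain N :: nat where N: "\<tau> / \<delta> < real N" using reals_Archimedean2 by blast
    have N0: "0 < N" using N \<tau> \<delta> by (cases N) (auto simp: divide_less_0_iff)
    define p where "p i = real i * (\<tau> / real N)" for i
    have step: "p (Suc i) = p i + \<tau> / real N" for i by (simp add: p_def distrib_right add_divide_distrib)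
    have small: "\<tau> / real N < \<delta>" using N N0 \<delta> by (simp add: field_simps)
    have pN: "p N = \<tau>" using N0 by (simp add: p_def)
    have prange: "0 \<le> p i" "p i \<le> \<tau>" if "i \<le> N" for i
    proof -
      show "0 \<le> p i" using \<tau> by (simp add: p_def)
      have "p i \<le> p N" unfolding p_def using that \<tau> by (intro mult_right_mono) auto
      then show "p i \<le> \<tau>" using pN by simp
    qed
    have "i \<le> N \<Longrightarrow> \<bar>E (p i)\<bar> \<le> 2 * \<epsilon> * (LINT x:{0<..<p i}|lborel. \<bar>g x\<bar>)" for i
    proof (induction i)
      case 0
      then show ?case by (simp add: p_def E_def set_lebesgue_integral_def)
    next
      case (Suc i)
      let ?a = "p i" and ?b = "p (Suc i)"
      have ab: "0 \<le> ?a" "?a \<le> ?b" "?b \<le> T" "?b - ?a < \<delta>"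
        using prange[of i] prange[of "Suc i"] Suc.prems step[of i] \<tau> small by auto
      note abi = gi[OF ab(1,3)] gfi[OF ab(1,3)] gai[OF ab(1,3)]
      let ?m = "f ?b + f ?a"
      have incr: "(f ?b)\<^sup>2 - (f ?a)\<^sup>2 = (LINT x:{?a<..<?b}|lborel. ?m * g x)"
      proof -
        have inc: "f ?b - f ?a = (LINT x:{?a<..<?b}|lborel. g x)"
        proof (cases "?a < ?b")
          case False
          then have "?a = ?b" using ab by simp
          then show ?thesis by (simp add: set_lebesgue_integral_def)
        qed (use ftc ab in auto)
        have "(f ?b)\<^sup>2 - (f ?a)\<^sup>2 = ?m * (f ?b - f ?a)" by (simp add: power2_eq_square algebra_simps)
        then show ?thesis unfolding inc by (simp only: set_integral_mult_right)
      qed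
      have mi: "set_integrable lborel {?a<..<?b} (\<lambda>x. ?m * g x)" using abi(1) by (rule set_integrable_mult_right)
      have fi: "set_integrable lborel {?a<..<?b} (\<lambda>x. 2 * (g x * f x))" using abi(2) by (rule set_integrable_mult_right)
      have "E ?b - E ?a = (LINT x:{?a<..<?b}|lborel. ?m * g x) - (LINT x:{?a<..<?b}|lborel. 2 * (g x * f x))"
        unfolding E_def using incr set_integral_split_open[OF gfi[of 0 ?b] ab(1,2)] ab by simp
      also have "\<dots> = (LINT x:{?a<..<?b}|lborel. ?m * g x - 2 * (g x * f x))"
        by (rule set_integral_diff(2)[OF mi fi, symmetric])
      finally have eq: "E ?b - E ?a = (LINT x:{?a<..<?b}|lborel. ?m * g x - 2 * (g x * f x))" .
      have "\<bar>E ?b - E ?a\<bar> \<le> (LINT x:{?a<..<?b}|lborel. 2 * \<epsilon> * \<bar>g x\<bar>)"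
        unfolding eq set_lebesgue_integral_def
      proof (rule integral_abs_bound_integral)
        show "integrable lborel (\<lambda>x. indicator {?a<..<?b} x *\<^sub>R (?m * g x - 2 * (g x * f x)))"
          using set_integral_diff(1)[OF mi fi] unfolding set_integrable_def .
        show "integrable lborel (\<lambda>x. indicator {?a<..<?b} x *\<^sub>R (2 * \<epsilon> * \<bar>g x\<bar>))"
          using set_integrable_mult_right[OF abi(3), of "2 * \<epsilon>"] unfolding set_integrable_def by simp
        fix x
        show "\<bar>indicator {?a<..<?b} x *\<^sub>R (?m * g x - 2 * (g x * f x))\<bar> \<le> indicator {?a<..<?b} x *\<^sub>R (2 * \<epsilon> * \<bar>g x\<bar>)"
        proof (cases "x \<in> {?a<..<?b}")
          case True
          then have "x \<in> {0..T}" "?a \<in> {0..T}" "?b \<in> {0..T}" "dist ?b x < \<delta>" "dist ?a x < \<delta>"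
            using ab by (auto simp: dist_real_def)
          then have "dist (f ?b) (f x) < \<epsilon>" "dist (f ?a) (f x) < \<epsilon>" using \<delta>(2) by blast+
          then have "\<bar>?m - 2 * f x\<bar> \<le> 2 * \<epsilon>" unfolding dist_real_def by linarith
          then have "\<bar>?m - 2 * f x\<bar> * \<bar>g x\<bar> \<le> 2 * \<epsilon> * \<bar>g x\<bar>" by (intro mult_right_mono) auto
          moreover have "?m * g x - 2 * (g x * f x) = (?m - 2 * f x) * g x" by (simp add: algebra_simps)
          ultimately show ?thesis using True by (simp add: abs_mult)
        qed simp
      qed
      also have "\<dots> = 2 * \<epsilon> * (LINT x:{?a<..<?b}|lborel. \<bar>g x\<bar>)" by simp
      finally have 1: "\<bar>E ?b - E ?a\<bar> \<le> 2 * \<epsilon> * (LINT x:{?a<..<?b}|lborel. \<bar>g x\<bar>)" .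
      have "\<bar>E ?b\<bar> \<le> \<bar>E ?a\<bar> + \<bar>E ?b - E ?a\<bar>" by linarith
      also have "\<dots> \<le> 2 * \<epsilon> * ((LINT x:{0<..<?a}|lborel. \<bar>g x\<bar>) + (LINT x:{?a<..<?b}|lborel. \<bar>g x\<bar>))"
        using 1 Suc by (simp add: distrib_left)
      also have "\<dots> = 2 * \<epsilon> * (LINT x:{0<..<?b}|lborel. \<bar>g x\<bar>)"
        using set_integral_split_open[OF gai[of 0 ?b] ab(1,2)] ab by simp
      finally show ?case .
    qed
    from this[of N] show ?thesis by (simp add: pN J_def)
  qed
  have "\<bar>E \<tau>\<bar> \<le> 0"
  proof (rule field_le_epsilon)
    fix e :: real assume e: "0 < e"
    have "2 * (e / (2 * (J + 1))) * J \<le> e" using e J by (simp add: field_simps)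
    then show "\<bar>E \<tau>\<bar> \<le> 0 + e" using bound[of "e / (2 * (J + 1))"] e J by simp
  qed
  then show "(f \<tau>)\<^sup>2 - (f 0)\<^sup>2 = 2 * (LINT x:{0<..<\<tau>}|lborel. g x * f x)" by (simp add: E_def)
qed

section \<open>Functions of time with values in a finite-dimensional space\<close>

lemma time_deriv_weak: "u \<in> trial_space V T \<Longrightarrow> weak_time_deriv V T u (time_deriv V T u)"
  unfolding trial_space_def time_deriv_def using someI_ex[of "weak_time_deriv V T u"] by blast

lemma L2_time_in: "v \<in> L2_time V T \<Longrightarrow> 0 < t \<Longrightarrow> t < T \<Longrightarrow> v t \<in> V"
  by (simp add: L2_time_def)

lemma L2_timeI:
  assumes "\<And>t. t \<in> {0<..<T} \<Longrightarrow> v t \<in> V"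
    and "\<And>l. linear_functional_on V l \<Longrightarrow> set_borel_measurable lborel {0<..<T} (\<lambda>t. l (v t))"
    and "\<And>l. linear_functional_on V l \<Longrightarrow> set_integrable lborel {0<..<T} (\<lambda>t. (l (v t))\<^sup>2)"
  shows "v \<in> L2_time V T"
  unfolding L2_time_def
proof (intro CollectI conjI ballI allI impI)
  show "v t \<in> V" if "t \<in> {0<..<T}" for t by (rule assms(1)[OF that])
  show "set_borel_measurable lborel {0<..<T} (\<lambda>t. l (v t))" if "linear_functional_on V l" for l
    by (rule assms(2)[OF that])
  show "set_integrable lborel {0<..<T} (\<lambda>t. (l (v t))\<^sup>2)" if "linear_functional_on V l" for l
    by (rule assms(3)[OF that])
qed

lemma L2_time_mult_integrable:
  assumes "u \<in> L2_time V T" "v \<in> L2_time V T" "linear_functional_on V l" "linear_functional_on V m"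
  shows "set_integrable lborel {0<..<T} (\<lambda>t. l (u t) * m (v t))"
proof -
  let ?I = "indicator {0<..<T} :: real \<Rightarrow> real"
  have meas: "(\<lambda>t. ?I t *\<^sub>R l (u t)) \<in> borel_measurable lborel" "(\<lambda>t. ?I t *\<^sub>R m (v t)) \<in> borel_measurable lborel"
    and int: "set_integrable lborel {0<..<T} (\<lambda>t. (l (u t))\<^sup>2)" "set_integrable lborel {0<..<T} (\<lambda>t. (m (v t))\<^sup>2)"
    using assms by (auto simp: L2_time_def set_borel_measurable_def)
  show ?thesis unfolding set_integrable_def
  proof (rule Bochner_Integration.integrable_bound)
    show "integrable lborel (\<lambda>t. ?I t *\<^sub>R (l (u t))\<^sup>2 + ?I t *\<^sub>R (m (v t))\<^sup>2)"
      using int unfolding set_integrable_def by (rule Bochner_Integration.integrable_add)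
    have "(\<lambda>t. (?I t *\<^sub>R l (u t)) * (?I t *\<^sub>R m (v t))) \<in> borel_measurable lborel"
      using meas by measurable
    then show "(\<lambda>t. ?I t *\<^sub>R (l (u t) * m (v t))) \<in> borel_measurable lborel"
      by (rule measurable_cong[THEN iffD1, rotated]) (auto simp: indicator_def)
    have "\<bar>a * b\<bar> \<le> a\<^sup>2 + b\<^sup>2" for a b :: real
    proof -
      have "2 * (\<bar>a\<bar> * \<bar>b\<bar>) \<le> a\<^sup>2 + b\<^sup>2" using sum_squares_bound[of "\<bar>a\<bar>" "\<bar>b\<bar>"] by simp
      moreover have "0 \<le> \<bar>a\<bar> * \<bar>b\<bar>" by simp
      ultimately show ?thesis unfolding abs_mult by linarith
    qed
    then show "AE t in lborel. norm (?I t *\<^sub>R (l (u t) * m (v t))) \<le> norm (?I t *\<^sub>R (l (u t))\<^sup>2 + ?I t *\<^sub>R (m (v t))\<^sup>2)"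
      by (intro AE_I2) (auto simp: indicator_def)
  qed
qed

lemma L2_time_combine:
  assumes V: "lin_space V" and u: "u \<in> L2_time V T" and v: "v \<in> L2_time V T"
  shows "(\<lambda>t x. a * u t x + v t x) \<in> L2_time V T"
proof -
  have uv: "(\<lambda>x. a * u t x + v t x) \<in> V" if "t \<in> {0<..<T}" for t
    using that by (intro lin_space_combine[OF V]) (auto intro: L2_time_in[OF u] L2_time_in[OF v])
  have "set_borel_measurable lborel {0<..<T} (\<lambda>t. l (\<lambda>x. a * u t x + v t x)) \<and>
        set_integrable lborel {0<..<T} (\<lambda>t. (l (\<lambda>x. a * u t x + v t x))\<^sup>2)"
    if l: "linear_functional_on V l" for l
  proof
    have eq: "l (\<lambda>x. a * u t x + v t x) = a * l (u t) + l (v t)" if "t \<in> {0<..<T}" for t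
      using that by (intro linear_functional_combine[OF l]) (auto intro: L2_time_in[OF u] L2_time_in[OF v])
    have "(\<lambda>t. indicator {0<..<T} t *\<^sub>R l (u t)) \<in> borel_measurable lborel"
      "(\<lambda>t. indicator {0<..<T} t *\<^sub>R l (v t)) \<in> borel_measurable lborel"
      using u v l by (auto simp: L2_time_def set_borel_measurable_def)
    then have "(\<lambda>t. a * (indicator {0<..<T} t *\<^sub>R l (u t)) + indicator {0<..<T} t *\<^sub>R l (v t)) \<in> borel_measurable lborel"
      by measurable
    then show "set_borel_measurable lborel {0<..<T} (\<lambda>t. l (\<lambda>x. a * u t x + v t x))"
      unfolding set_borel_measurable_def
      by (rule measurable_cong[THEN iffD1, rotated]) (auto simp: indicator_def eq)
    note I = L2_time_mult_integrable[OF u u l l] L2_time_mult_integrable[OF u v l l] L2_time_mult_integrable[OF v v l l]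
    have "set_integrable lborel {0<..<T} (\<lambda>t. a\<^sup>2 * (l (u t) * l (u t)) + (2 * a) * (l (u t) * l (v t)) + l (v t) * l (v t))"
      by (intro set_integral_add set_integrable_mult_right I)
    then show "set_integrable lborel {0<..<T} (\<lambda>t. (l (\<lambda>x. a * u t x + v t x))\<^sup>2)"
    proof (rule set_integrable_cong[THEN iffD1, rotated -1])
      fix t assume t: "t \<in> {0<..<T}"
      show "a\<^sup>2 * (l (u t) * l (u t)) + (2 * a) * (l (u t) * l (v t)) + l (v t) * l (v t) = (l (\<lambda>x. a * u t x + v t x))\<^sup>2"
        unfolding eq[OF t] by (simp add: power2_eq_square algebra_simps)
    qed auto
  qed
  then show ?thesis using uv by (intro L2_timeI) auto
qed

lemma L2_time_map:
  assumes u: "u \<in> L2_time V T" and R: "\<And>v. v \<in> V \<Longrightarrow> R v \<in> V"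
    and lin: "\<And>l. linear_functional_on V l \<Longrightarrow> linear_functional_on V (\<lambda>v. l (R v))"
  shows "(\<lambda>t. R (u t)) \<in> L2_time V T"
proof (rule L2_timeI)
  show "R (u t) \<in> V" if "t \<in> {0<..<T}" for t using that by (intro R L2_time_in[OF u]) auto
  fix l assume "linear_functional_on V l"
  from lin[OF this] have l: "linear_functional_on V (\<lambda>v. l (R v))" .
  show "set_borel_measurable lborel {0<..<T} (\<lambda>t. l (R (u t)))"
    using u l unfolding L2_time_def by (elim CollectE conjE allE[of _ "\<lambda>v. l (R v)"]) simp
  show "set_integrable lborel {0<..<T} (\<lambda>t. (l (R (u t)))\<^sup>2)"
    using u l unfolding L2_time_def by (elim CollectE conjE allE[of _ "\<lambda>v. l (R v)"]) simp
qed

lemma trial_space_in: "u \<in> trial_space V T \<Longrightarrow> 0 \<le> t \<Longrightarrow> t \<le> T \<Longrightarrow> u t \<in> V"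
  by (simp add: trial_space_def)

lemma trial_space_continuous:
  "u \<in> trial_space V T \<Longrightarrow> linear_functional_on V l \<Longrightarrow> continuous_on {0..T} (\<lambda>t. l (u t))"
  by (simp add: trial_space_def)

lemma L2_time_measurable:
  "v \<in> L2_time V T \<Longrightarrow> linear_functional_on V l \<Longrightarrow>
     (\<lambda>t. indicator {0<..<T} t *\<^sub>R l (v t)) \<in> borel_measurable lborel"
  by (simp add: L2_time_def set_borel_measurable_def)

lemma trial_space_L2_time:
  assumes u: "u \<in> trial_space V T"
  shows "u \<in> L2_time V T"
proof -
  have "set_borel_measurable lborel {0<..<T} (\<lambda>t. l (u t)) \<and> set_integrable lborel {0<..<T} (\<lambda>t. (l (u t))\<^sup>2)"
    if l: "linear_functional_on V l" for l
  proof
    have c: "continuous_on {0..T} (\<lambda>t. l (u t))" by (rule trial_space_continuous[OF u l])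
    have "continuous_on {0<..<T} (\<lambda>t. l (u t))" by (rule continuous_on_subset[OF c]) auto
    then show "set_borel_measurable lborel {0<..<T} (\<lambda>t. l (u t))"
      unfolding set_borel_measurable_def using borel_measurable_continuous_on_indicator[of "{0<..<T}" "\<lambda>t. l (u t)"] by simp
    show "set_integrable lborel {0<..<T} (\<lambda>t. (l (u t))\<^sup>2)"
      by (intro set_integrable_continuous_open_interval continuous_intros c)
  qed
  then show ?thesis using u by (intro L2_timeI) (auto intro: trial_space_in)
qed

lemma weak_time_deriv_L2: "weak_time_deriv V T u g \<Longrightarrow> g \<in> L2_time V T"
  by (simp add: weak_time_deriv_def)

lemma L2_time_integrable:
  assumes g: "g \<in> L2_time V T" and l: "linear_functional_on V l"
  shows "set_integrable lborel {0<..<T} (\<lambda>t. l (g t))"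
proof -
  have meas: "(\<lambda>t. indicator {0<..<T} t *\<^sub>R l (g t)) \<in> borel_measurable lborel"
    and int: "set_integrable lborel {0<..<T} (\<lambda>t. (l (g t))\<^sup>2)"
    using assms by (auto simp: L2_time_def set_borel_measurable_def)
  have one: "set_integrable lborel {0<..<T} (\<lambda>t. 1 :: real)"
    unfolding set_integrable_def by (cases "0 \<le> T") auto
  show ?thesis unfolding set_integrable_def
  proof (rule Bochner_Integration.integrable_bound[OF _ meas])
    show "integrable lborel (\<lambda>t. indicator {0<..<T} t *\<^sub>R (1 + (l (g t))\<^sup>2))"
      using set_integral_add(1)[OF one int] unfolding set_integrable_def .
    have "\<bar>a\<bar> \<le> 1 + a\<^sup>2" for a :: real
      using sum_squares_bound[of 1 "\<bar>a\<bar>"] abs_ge_zero[of a] by simp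
    then show "AE t in lborel. norm (indicator {0<..<T} t *\<^sub>R l (g t)) \<le> norm (indicator {0<..<T} t *\<^sub>R (1 + (l (g t))\<^sup>2))"
      by (intro AE_I2) (auto simp: indicator_def abs_of_nonneg add_nonneg_nonneg)
  qed
qed

lemma weak_time_deriv_integral:
  assumes u: "u \<in> trial_space V T" and g: "weak_time_deriv V T u g" and l: "linear_functional_on V l"
    and st: "0 \<le> s" "s < t" "t \<le> T"
  shows "l (u t) - l (u s) = (LINT x:{s<..<t}|lborel. l (g x))"
proof (rule weak_derivative_integral[OF _ _ _ st])
  show "continuous_on {0..T} (\<lambda>t. l (u t))" by (rule trial_space_continuous[OF u l])
  show "set_integrable lborel {0<..<T} (\<lambda>t. l (g t))" by (rule L2_time_integrable[OF weak_time_deriv_L2[OF g] l])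
  show "(LINT t:{0<..<T}|lborel. deriv \<phi> t * l (u t)) = - (LINT t:{0<..<T}|lborel. \<phi> t * l (g t))"
    if "time_test_function T \<phi>" for \<phi>
    using g l that by (simp add: weak_time_deriv_def)
qed

context
  fixes V :: "('a \<Rightarrow> real) set" and B n e
  assumes V: "lin_space V" and B: "semi_inner_on V B" and e: "orthonormal_basis V B n e"
begin

lemma basis_in: "i < n \<Longrightarrow> e i \<in> V"
  using e by (simp add: orthonormal_basis_def)

lemma basis_expansion: "v \<in> V \<Longrightarrow> v = (\<lambda>x. \<Sum>i<n. B v (e i) * e i x)"
  using e unfolding orthonormal_basis_def by blast

lemma coordinate_functional: "i < n \<Longrightarrow> linear_functional_on V (\<lambda>v. B v (e i))"
  by (rule semi_inner_left[OF B basis_in])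

lemma functional_expansion:
  assumes l: "linear_functional_on V l" and v: "v \<in> V"
  shows "l v = (\<Sum>i<n. B v (e i) * l (e i))"
proof -
  have "l v = l (\<lambda>x. \<Sum>i<n. B v (e i) * e i x)" using basis_expansion[OF v] by (rule arg_cong)
  also have "\<dots> = (\<Sum>i<n. B v (e i) * l (e i))"
    by (rule linear_functional_sum[OF V l]) (auto simp: basis_in)
  finally show ?thesis .
qed

lemma form_time_integrable:
  assumes C: "semi_inner_on V C" and u: "u \<in> L2_time V T" and v: "v \<in> L2_time V T"
  shows "set_integrable lborel {0<..<T} (\<lambda>t. C (u t) (v t))"
proof -
  have "set_integrable lborel {0<..<T} (\<lambda>t. \<Sum>i<n. B (u t) (e i) * C (e i) (v t))"
  proof -
    have "set_integrable lborel {0<..<T} (\<lambda>t. B (u t) (e i) * C (e i) (v t))" if "i < n" for i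
      by (rule L2_time_mult_integrable[OF u v coordinate_functional[OF that] semi_inner_right[OF V C basis_in[OF that]]])
    then show ?thesis unfolding set_integrable_def scaleR_sum_right
      by (intro Bochner_Integration.integrable_sum) auto
  qed
  then show ?thesis
  proof (rule set_integrable_cong[THEN iffD1, rotated -1])
    fix t assume "t \<in> {0<..<T}"
    then have "u t \<in> V" "v t \<in> V" by (auto intro: L2_time_in[OF u] L2_time_in[OF v])
    then show "(\<Sum>i<n. B (u t) (e i) * C (e i) (v t)) = C (u t) (v t)"
      using functional_expansion[OF semi_inner_left[OF C]] by simp
  qed auto
qed

text \<open>A seminorm is continuous in the coordinates, hence measurable along a measurable path.\<close>
lemma seminorm_time_measurable:
  assumes C: "semi_inner_on V C" and v: "v \<in> L2_time V T"
    and N: "\<And>u w. u \<in> V \<Longrightarrow> w \<in> V \<Longrightarrow> \<bar>N u - N w\<bar> \<le> sqrt (C (\<lambda>x. u x - w x) (\<lambda>x. u x - w x))"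
  shows "set_borel_measurable lborel {0<..<T} (\<lambda>t. N (v t) :: real)"
proof -
  \<comment> \<open>The coefficients form a function of an index in the naturals, of which only the first \<open>n\<close>
      values matter: the product topology makes the continuity of \<open>N (comb c)\<close> meaningful.\<close>
  define comb where "comb c = (\<lambda>x. \<Sum>i<n. c i * e i x)" for c :: "nat \<Rightarrow> real"
  define s where "s i = sqrt (C (e i) (e i))" for i
  have comb: "comb c \<in> V" for c unfolding comb_def by (rule lin_space_sum[OF V]) (auto simp: basis_in)
  have quad: "sqrt (C (comb c) (comb c)) \<le> (\<Sum>i<n. \<bar>c i\<bar> * s i)" for c
  proof -
    have Cc: "C (comb c) w = (\<Sum>i<n. c i * C (e i) w)" if "w \<in> V" for w
      unfolding comb_def by (rule linear_functional_sum[OF V semi_inner_left[OF C that]]) (auto simp: basis_in)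
    have cC: "C w (comb c) = (\<Sum>i<n. c i * C w (e i))" if "w \<in> V" for w
      unfolding comb_def by (rule linear_functional_sum[OF V semi_inner_right[OF V C that]]) (auto simp: basis_in)
    have "C (comb c) (comb c) = (\<Sum>i<n. \<Sum>j<n. c i * (c j * C (e i) (e j)))"
      unfolding Cc[OF comb] by (simp add: cC basis_in sum_distrib_left)
    also have "\<dots> \<le> (\<Sum>i<n. \<Sum>j<n. (\<bar>c i\<bar> * s i) * (\<bar>c j\<bar> * s j))"
    proof (intro sum_mono)
      fix i j assume "i \<in> {..<n}" "j \<in> {..<n}"
      then have "\<bar>C (e i) (e j)\<bar> \<le> s i * s j"
        unfolding s_def by (intro semi_inner_Cauchy_Schwarz[OF V C]) (auto simp: basis_in)
      then have "\<bar>c i\<bar> * \<bar>c j\<bar> * \<bar>C (e i) (e j)\<bar> \<le> \<bar>c i\<bar> * \<bar>c j\<bar> * (s i * s j)" by (intro mult_left_mono) auto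
      moreover have "c i * (c j * C (e i) (e j)) \<le> \<bar>c i\<bar> * \<bar>c j\<bar> * \<bar>C (e i) (e j)\<bar>"
        using abs_ge_self[of "c i * (c j * C (e i) (e j))"] by (simp add: abs_mult mult.assoc)
      ultimately show "c i * (c j * C (e i) (e j)) \<le> (\<bar>c i\<bar> * s i) * (\<bar>c j\<bar> * s j)" by (simp add: mult_ac)
    qed
    also have "\<dots> = (\<Sum>i<n. \<bar>c i\<bar> * s i)\<^sup>2" by (simp add: power2_eq_square sum_product)
    finally have "sqrt (C (comb c) (comb c)) \<le> sqrt ((\<Sum>i<n. \<bar>c i\<bar> * s i)\<^sup>2)" by (rule real_sqrt_le_mono)
    moreover have "0 \<le> (\<Sum>i<n. \<bar>c i\<bar> * s i)"
      using semi_inner_nonneg[OF C] basis_in by (intro sum_nonneg) (auto simp: s_def)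
    ultimately show ?thesis by simp
  qed
  have lip: "\<bar>N (comb c) - N (comb d)\<bar> \<le> (\<Sum>i<n. \<bar>c i - d i\<bar> * s i)" for c d
  proof -
    have "(\<lambda>x. comb c x - comb d x) = comb (\<lambda>i. c i - d i)"
      by (simp add: comb_def fun_eq_iff left_diff_distrib sum_subtractf)
    then show ?thesis using N[OF comb comb, of c d] quad[of "\<lambda>i. c i - d i"] by simp
  qed
  have "continuous_on UNIV (\<lambda>c. N (comb c))"
  proof (rule continuous_at_imp_continuous_on, rule ballI)
    fix c :: "nat \<Rightarrow> real"
    have "continuous_on UNIV (\<lambda>d. \<Sum>i<n. \<bar>d i - c i\<bar> * s i)"
      by (intro continuous_intros continuous_on_product_coordinates)
    then have "((\<lambda>d. \<Sum>i<n. \<bar>d i - c i\<bar> * s i) \<longlongrightarrow> (\<Sum>i<n. \<bar>c i - c i\<bar> * s i)) (at c)"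
      unfolding continuous_on_def by blast
    then have "((\<lambda>d. \<Sum>i<n. \<bar>d i - c i\<bar> * s i) \<longlongrightarrow> 0) (at c)" by simp
    then have "((\<lambda>d. N (comb d) - N (comb c)) \<longlongrightarrow> 0) (at c)"
      by (rule Lim_null_comparison[rotated]) (use lip in auto)
    then have "((\<lambda>d. N (comb d)) \<longlongrightarrow> N (comb c)) (at c)" by (simp add: LIM_zero_iff)
    then show "isCont (\<lambda>c. N (comb c)) c" by (simp add: isCont_def)
  qed
  then have Nm: "(\<lambda>c. N (comb c)) \<in> borel_measurable borel" by (rule borel_measurable_continuous_onI)
  define c where "c t i = (if i < n then indicator {0<..<T} t *\<^sub>R B (v t) (e i) else 0)" for t i
  have "(\<lambda>t. c t i) \<in> borel_measurable lborel" for i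
  proof (cases "i < n")
    case True
    then show ?thesis using L2_time_measurable[OF v coordinate_functional[OF True]]
      by (simp add: c_def)
  qed (simp add: c_def)
  then have "c \<in> borel_measurable lborel" by (rule measurable_coordinatewise_then_product)
  then have "(\<lambda>t. N (comb (c t))) \<in> borel_measurable lborel" using Nm by (rule measurable_compose)
  then have meas: "(\<lambda>t. indicator {0<..<T} t *\<^sub>R N (comb (c t))) \<in> borel_measurable lborel" by measurable
  have cv: "comb (c t) = v t" if "t \<in> {0<..<T}" for t
  proof -
    have "v t \<in> V" using that by (auto intro: L2_time_in[OF v])
    from basis_expansion[OF this] show ?thesis using that by (simp add: comb_def c_def)
  qed
  from meas show ?thesis unfolding set_borel_measurable_def
    by (rule measurable_cong[THEN iffD1, rotated]) (auto simp: indicator_def cv)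
qed

text \<open>The scalar identity for each coordinate, summed by Parseval's formula.\<close>
lemma energy_equation:
  assumes u: "u \<in> trial_space V T" and g: "weak_time_deriv V T u g" and \<tau>: "0 \<le> \<tau>" "\<tau> \<le> T"
  shows "B (u \<tau>) (u \<tau>) - B (u 0) (u 0) = 2 * (LINT t:{0<..<\<tau>}|lborel. B (g t) (u t))"
proof -
  have gL: "g \<in> L2_time V T" by (rule weak_time_deriv_L2[OF g])
  have parseval: "B v w = (\<Sum>i<n. B v (e i) * B w (e i))" if "v \<in> V" "w \<in> V" for v w
    using functional_expansion[OF semi_inner_left[OF B that(2)] that(1)] semi_inner_sym[OF B that(2) basis_in] by simp
  have E: "set_integrable lborel {0<..<T} (\<lambda>t. B (g t) (e i) * B (u t) (e i))"
    "(B (u \<tau>) (e i))\<^sup>2 - (B (u 0) (e i))\<^sup>2 = 2 * (LINT t:{0<..<\<tau>}|lborel. B (g t) (e i) * B (u t) (e i))"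
    if i: "i < n" for i
  proof -
    note l = coordinate_functional[OF i]
    have c: "continuous_on {0..T} (\<lambda>t. B (u t) (e i))" by (rule trial_space_continuous[OF u l])
    note * = energy_identity[OF c L2_time_integrable[OF gL l] weak_time_deriv_integral[OF u g l] \<tau>]
    show "set_integrable lborel {0<..<T} (\<lambda>t. B (g t) (e i) * B (u t) (e i))" using * by blast
    show "(B (u \<tau>) (e i))\<^sup>2 - (B (u 0) (e i))\<^sup>2 = 2 * (LINT t:{0<..<\<tau>}|lborel. B (g t) (e i) * B (u t) (e i))"
      using * by blast
  qed
  have int: "set_integrable lborel {0<..<\<tau>} (\<lambda>t. B (g t) (e i) * B (u t) (e i))" if "i < n" for i
    by (rule set_integrable_subset[OF E(1)[OF that]]) (use \<tau> in auto)
  have "(LINT t:{0<..<\<tau>}|lborel. B (g t) (u t)) = (LINT t:{0<..<\<tau>}|lborel. \<Sum>i<n. B (g t) (e i) * B (u t) (e i))"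
    unfolding set_lebesgue_integral_def
  proof (rule Bochner_Integration.integral_cong[OF refl])
    fix t
    show "indicator {0<..<\<tau>} t *\<^sub>R B (g t) (u t) = indicator {0<..<\<tau>} t *\<^sub>R (\<Sum>i<n. B (g t) (e i) * B (u t) (e i))"
      using parseval[of "g t" "u t"] L2_time_in[OF gL, of t] trial_space_in[OF u, of t] \<tau>
      by (cases "t \<in> {0<..<\<tau>}") auto
  qed
  also have "\<dots> = (\<Sum>i<n. LINT t:{0<..<\<tau>}|lborel. B (g t) (e i) * B (u t) (e i))"
    using int unfolding set_lebesgue_integral_def set_integrable_def scaleR_sum_right
    by (intro Bochner_Integration.integral_sum) auto
  finally have "2 * (LINT t:{0<..<\<tau>}|lborel. B (g t) (u t)) = (\<Sum>i<n. (B (u \<tau>) (e i))\<^sup>2 - (B (u 0) (e i))\<^sup>2)"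
    by (simp add: sum_distrib_left E(2))
  then show ?thesis
    using parseval[of "u \<tau>" "u \<tau>"] parseval[of "u 0" "u 0"] trial_space_in[OF u] \<tau>
    by (simp add: sum_subtractf power2_eq_square)
qed

text \<open>Both derivatives have the same integral over every interval.\<close>
lemma weak_time_deriv_unique:
  assumes u: "u \<in> trial_space V T" and g: "weak_time_deriv V T u g" and h: "weak_time_deriv V T u h"
  shows "AE t in lborel. t \<in> {0<..<T} \<longrightarrow> g t = h t"
proof -
  have coord: "AE t in lborel. indicator {0<..<T} t *\<^sub>R (B (g t) (e i) - B (h t) (e i)) = 0" if i: "i < n" for i
  proof (rule AE_zero_if_box_integrals_zero[where S = UNIV])
    note l = coordinate_functional[OF i]
    have gi: "set_integrable lborel {0<..<T} (\<lambda>t. B (g t) (e i))" and hi: "set_integrable lborel {0<..<T} (\<lambda>t. B (h t) (e i))"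
      by (rule L2_time_integrable[OF weak_time_deriv_L2[OF g] l] L2_time_integrable[OF weak_time_deriv_L2[OF h] l])+
    show "integrable lborel (\<lambda>t. indicator {0<..<T} t *\<^sub>R (B (g t) (e i) - B (h t) (e i)))"
      using set_integral_diff(1)[OF gi hi] unfolding set_integrable_def .
    show "sets lborel = sets (restrict_space borel (UNIV :: real set))" by simp
    fix a b :: real
    define s where "s = max a 0"
    define t where "t = min b T"
    have "(LINT x|lborel. indicator (box a b) x * (indicator {0<..<T} x *\<^sub>R (B (g x) (e i) - B (h x) (e i)))) =
        (LINT x:{s<..<t}|lborel. B (g x) (e i) - B (h x) (e i))"
      unfolding set_lebesgue_integral_def
      by (rule Bochner_Integration.integral_cong) (auto simp: box_real s_def t_def indicator_def)
    also have "\<dots> = 0"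
    proof (cases "s < t")
      case True
      have st: "0 \<le> s" "t \<le> T" by (auto simp: s_def t_def)
      have "set_integrable lborel {s<..<t} (\<lambda>t. B (g t) (e i))" "set_integrable lborel {s<..<t} (\<lambda>t. B (h t) (e i))"
        using st by (auto intro: set_integrable_subset[OF gi] set_integrable_subset[OF hi])
      then have "(LINT x:{s<..<t}|lborel. B (g x) (e i) - B (h x) (e i)) =
          (LINT x:{s<..<t}|lborel. B (g x) (e i)) - (LINT x:{s<..<t}|lborel. B (h x) (e i))"
        by (rule set_integral_diff(2))
      then show ?thesis
        using weak_time_deriv_integral[OF u g l st(1) True st(2)] weak_time_deriv_integral[OF u h l st(1) True st(2)] by simp
    qed (simp add: set_lebesgue_integral_def)
    finally show "(LINT x|lborel. indicator (box a b) x * (indicator {0<..<T} x *\<^sub>R (B (g x) (e i) - B (h x) (e i)))) = 0" .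
  qed
  have "AE t in lborel. \<forall>i\<in>{..<n}. indicator {0<..<T} t *\<^sub>R (B (g t) (e i) - B (h t) (e i)) = 0"
    by (rule AE_finite_allI) (use coord in auto)
  then show ?thesis
  proof eventually_elim
    case (elim t)
    show ?case
    proof
      assume t: "t \<in> {0<..<T}"
      then have "B (g t) (e i) = B (h t) (e i)" if "i < n" for i using bspec[OF elim, of i] that by simp
      moreover have "g t \<in> V" "h t \<in> V"
        using t by (auto intro: L2_time_in[OF weak_time_deriv_L2[OF g]] L2_time_in[OF weak_time_deriv_L2[OF h]])
      ultimately show "g t = h t" using basis_expansion[of "g t"] basis_expansion[of "h t"] by simp
    qed
  qed
qed

end

lemma monomial_weak_time_deriv:
  assumes V: "lin_space V" and w: "w \<in> V" and T: "0 < T" and m: "0 < m"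
  shows "(\<lambda>t x. t ^ m * w x) \<in> trial_space V T"
    and "weak_time_deriv V T (\<lambda>t x. t ^ m * w x) (\<lambda>t x. (real m * t ^ (m - 1)) * w x)"
proof -
  let ?g = "\<lambda>t x. (real m * t ^ (m - 1)) * w x"
  note cI = set_integrable_continuous_open_interval
  have gL: "?g \<in> L2_time V T"
  proof -
    have "set_borel_measurable lborel {0<..<T} (\<lambda>t. l (?g t)) \<and> set_integrable lborel {0<..<T} (\<lambda>t. (l (?g t))\<^sup>2)"
      if l: "linear_functional_on V l" for l
    proof
      have eq: "l (?g t) = (real m * t ^ (m - 1)) * l w" for t by (rule linear_functional_scale[OF V l w])
      show "set_borel_measurable lborel {0<..<T} (\<lambda>t. l (?g t))"
        unfolding eq set_borel_measurable_def by measurable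
      show "set_integrable lborel {0<..<T} (\<lambda>t. (l (?g t))\<^sup>2)"
        unfolding eq by (rule cI) (intro continuous_intros)
    qed
    then show ?thesis using lin_space_scale[OF V w] by (intro L2_timeI) auto
  qed
  show wd: "weak_time_deriv V T (\<lambda>t x. t ^ m * w x) ?g"
    unfolding weak_time_deriv_def
  proof (intro conjI gL allI impI)
    fix l \<phi> assume l: "linear_functional_on V l" and \<phi>: "time_test_function T \<phi>"
    have lu: "l (\<lambda>x. t ^ m * w x) = t ^ m * l w" for t by (rule linear_functional_scale[OF V l w])
    have lg: "l (?g t) = (real m * t ^ (m - 1)) * l w" for t by (rule linear_functional_scale[OF V l w])
    obtain a b where ab: "0 < a" "b < T" "\<And>t. t \<notin> {a..b} \<Longrightarrow> \<phi> t = 0"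
      using \<phi> unfolding time_test_function_def by blast
    have d\<phi>: "(\<phi> has_real_derivative deriv \<phi> t) (at t)" for t
      using \<phi> unfolding time_test_function_def by (simp add: DERIV_deriv_iff_field_differentiable)
    have c\<phi>: "continuous_on UNIV \<phi>" by (rule DERIV_continuous_on[OF has_field_derivative_at_within[OF d\<phi>]])
    have cd: "continuous_on UNIV (deriv \<phi>)" using \<phi> unfolding time_test_function_def by blast
    have i1: "set_integrable lborel {0<..<T} (\<lambda>t. deriv \<phi> t * (t ^ m * l w))"
      by (rule cI) (intro continuous_intros continuous_on_subset[OF cd] subset_UNIV)
    have i2: "set_integrable lborel {0<..<T} (\<lambda>t. \<phi> t * ((real m * t ^ (m - 1)) * l w))"
      by (rule cI) (intro continuous_intros continuous_on_subset[OF c\<phi>] subset_UNIV)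
    define D where "D t = deriv \<phi> t * (t ^ m * l w) + \<phi> t * ((real m * t ^ (m - 1)) * l w)" for t
    have der: "((\<lambda>t. \<phi> t * (t ^ m * l w)) has_real_derivative D t) (at t)" for t
      unfolding D_def by (auto intro!: derivative_eq_intros d\<phi>)
    have cD: "continuous_on UNIV D" unfolding D_def
      by (intro continuous_intros cd c\<phi>)
    then have "(LINT t|lborel. D t * indicator {0..T} t) = \<phi> T * (T ^ m * l w) - \<phi> 0 * (0 ^ m * l w)"
      by (intro integral_FTC_Icc_real der) (use T in \<open>auto simp: continuous_on_eq_continuous_at\<close>)
    also have "\<dots> = 0" using ab(3)[of T] ab(2) m by simp
    finally have "(LINT t|lborel. D t * indicator {0..T} t) = 0" .
    moreover have "(LINT t:{0<..<T}|lborel. D t) = (LINT t|lborel. D t * indicator {0..T} t)"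
      unfolding set_lebesgue_integral_def
    proof (rule integral_cong_AE)
      have Dm: "D \<in> borel_measurable borel" by (rule borel_measurable_continuous_onI[OF cD])
      show "(\<lambda>t. indicator {0<..<T} t *\<^sub>R D t) \<in> borel_measurable lborel" using Dm by measurable
      show "(\<lambda>t. D t * indicator {0..T} t) \<in> borel_measurable lborel" using Dm by measurable
      show "AE t in lborel. indicator {0<..<T} t *\<^sub>R D t = D t * indicator {0..T} t"
        using AE_lborel_singleton[of 0] AE_lborel_singleton[of T]
        by eventually_elim (auto simp: indicator_def)
    qed
    ultimately have "(LINT t:{0<..<T}|lborel. D t) = 0" by simp
    then show "(LINT t:{0<..<T}|lborel. deriv \<phi> t * l (\<lambda>x. t ^ m * w x)) = - (LINT t:{0<..<T}|lborel. \<phi> t * l (?g t))"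
      unfolding lu lg D_def using set_integral_add(2)[OF i1 i2] by simp
  qed
  have "continuous_on {0..T} (\<lambda>t. l (\<lambda>x. t ^ m * w x))" if "linear_functional_on V l" for l
    unfolding linear_functional_scale[OF V that w] by (intro continuous_intros)
  then show "(\<lambda>t x. t ^ m * w x) \<in> trial_space V T"
    unfolding trial_space_def using wd lin_space_scale[OF V w] by blast
qed

section \<open>Lower estimate of an abstract parabolic form\<close>

lemma semi_inner_young:
  assumes V: "lin_space V" and C: "semi_inner_on V C" and r: "r \<in> V" and u: "u \<in> V" and \<eta>: "0 < \<eta>"
  shows "2 * C r u \<le> \<eta> * C r r + C u u / \<eta>"
proof -
  have "0 \<le> (-\<eta>)\<^sup>2 * C r r + 2 * (-\<eta>) * C r u + C u u"
    using semi_inner_nonneg[OF C lin_space_combine[OF V r u, of "-\<eta>"]] semi_inner_quadratic[OF V C r u, of "-\<eta>"] by simp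
  then have "\<eta> * (2 * C r u) \<le> \<eta> * (\<eta> * C r r + C u u / \<eta>)"
    using \<eta> by (simp add: power2_eq_square algebra_simps)
  then show ?thesis using \<eta> by (simp only: mult_le_cancel_left_pos)
qed

text \<open>Here \<open>R\<close> represents \<open>B\<close> in the inner product \<open>K\<close>, so that \<open>K (R v) (R v)\<close> is the square of the
  norm of \<open>v\<close> in the discrete dual space. The test function is \<open>u + R (\<partial>\<^sub>t u)\<close>; since the trial norm
  only contains the seminorm given by \<open>a\<close>, the full norm of \<open>u\<close> in the norm of the test function is
  recovered from the energy equation with Young's inequality of weight \<open>1 + 2 T\<close>.\<close>
lemma discrete_inf_sup_estimate:
  fixes V :: "('a \<Rightarrow> real) set"
  assumes V: "lin_space V" and B: "inner_product_on V B" and e: "orthonormal_basis V B n e"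
    and a: "semi_inner_on V a" and K: "semi_inner_on V K"
    and aK: "\<And>v. v \<in> V \<Longrightarrow> a v v \<le> K v v" and KBa: "\<And>v. v \<in> V \<Longrightarrow> K v v \<le> B v v + a v v"
    and R: "\<And>v. v \<in> V \<Longrightarrow> R v \<in> V" "\<And>v w. v \<in> V \<Longrightarrow> w \<in> V \<Longrightarrow> K (R v) w = B v w"
      "\<And>l. linear_functional_on V l \<Longrightarrow> linear_functional_on V (\<lambda>v. l (R v))"
    and T: "0 < T" and u: "u \<in> trial_space V T" and g: "weak_time_deriv V T u g"
    and nz: "\<exists>t\<in>{0..T}. u t \<noteq> (\<lambda>x. 0)"
  defines "X \<equiv> B (u 0) (u 0) + (LINT t:{0<..<T}|lborel. K (R (g t)) (R (g t)) + a (u t) (u t))"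
    and "v1 \<equiv> (\<lambda>t x. u t x + R (g t) x)"
  shows "0 < X" and "v1 \<in> L2_time V T"
    and "X / 2 \<le> B (u 0) (u 0) + (LINT t:{0<..<T}|lborel. B (g t) (v1 t) + a (u t) (v1 t))"
    and "B (u 0) (u 0) + (LINT t:{0<..<T}|lborel. K (v1 t) (v1 t)) \<le> 2 * (1 + 2 * T)\<^sup>2 * X"
proof -
  let ?I = "{0<..<T}"
  note Bs = inner_product_semi_inner[OF V B]
  define r where "r t = R (g t)" for t
  \<comment> \<open>The weight of Young's inequality.\<close>
  define q where "q = 1 + 2 * T"
  have q: "q > 0" using T by (simp add: q_def)
  have gL: "g \<in> L2_time V T" by (rule weak_time_deriv_L2[OF g])
  have uL: "u \<in> L2_time V T" by (rule trial_space_L2_time[OF u])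
  have rL: "r \<in> L2_time V T" unfolding r_def by (rule L2_time_map[where R = R, OF gL]) (rule R(1) R(3), assumption)+
  have in_V: "u t \<in> V" "g t \<in> V" "r t \<in> V" if "t \<in> ?I" for t
    using that L2_time_in[OF uL, of t] L2_time_in[OF gL, of t] L2_time_in[OF rL, of t] by auto
  have v1: "v1 t = (\<lambda>x. 1 * u t x + r t x)" for t by (simp add: v1_def r_def)
  show v1L: "v1 \<in> L2_time V T" unfolding v1 using L2_time_combine[OF V uL rL, of 1] by (simp add: v1_def r_def)
  note int = form_time_integrable[OF V Bs e]
  have u0: "u 0 \<in> V" using trial_space_in[OF u, of 0] T by simp
  define A where "A = B (u 0) (u 0)"
  define G where "G = (LINT t:?I|lborel. K (r t) (r t))"
  define D where "D = (LINT t:?I|lborel. a (u t) (u t))"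
  define Y where "Y = (LINT t:?I|lborel. K (u t) (u t))"
  define M where "M = (LINT t:?I|lborel. B (u t) (u t))"
  have nonneg: "0 \<le> set_lebesgue_integral lborel ?I f" if "\<And>t. t \<in> ?I \<Longrightarrow> 0 \<le> f t" for f :: "real \<Rightarrow> real"
    unfolding set_lebesgue_integral_def
    by (rule Bochner_Integration.integral_nonneg) (use that in \<open>auto simp: indicator_def\<close>)
  have A0: "0 \<le> A" unfolding A_def by (rule semi_inner_nonneg[OF Bs u0])
  have G0: "0 \<le> G" unfolding G_def by (rule nonneg) (rule semi_inner_nonneg[OF K in_V(3)])
  have D0: "0 \<le> D" unfolding D_def by (rule nonneg) (rule semi_inner_nonneg[OF a in_V(1)])
  have X: "X = A + G + D"
    unfolding X_def A_def G_def D_def r_def[symmetric]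
    using set_integral_add(2)[OF int[OF K rL rL] int[OF a uL uL]] by simp
  define S where "S = A + q * G + Y / q"
  have pointwise: "B (u t) (u t) \<le> S" if t: "0 \<le> t" "t \<le> T" for t
  proof -
    have "(LINT s:{0<..<t}|lborel. 2 * B (g s) (u s)) \<le> (LINT s:?I|lborel. q * K (r s) (r s) + K (u s) (u s) / q)"
      unfolding set_lebesgue_integral_def
    proof (rule integral_mono)
      have "set_integrable lborel {0<..<t} (\<lambda>s. 2 * B (g s) (u s))"
        by (rule set_integrable_subset[OF set_integrable_mult_right[OF int[OF Bs gL uL]]]) (use t in auto)
      then show "integrable lborel (\<lambda>s. indicator {0<..<t} s *\<^sub>R (2 * B (g s) (u s)))"
        unfolding set_integrable_def .
      have "set_integrable lborel ?I (\<lambda>s. q * K (r s) (r s) + (1 / q) * K (u s) (u s))"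
        by (intro set_integral_add set_integrable_mult_right int[OF K rL rL] int[OF K uL uL])
      then show "integrable lborel (\<lambda>s. indicator ?I s *\<^sub>R (q * K (r s) (r s) + K (u s) (u s) / q))"
        unfolding set_integrable_def by simp
      fix s :: real
      show "indicator {0<..<t} s *\<^sub>R (2 * B (g s) (u s)) \<le> indicator ?I s *\<^sub>R (q * K (r s) (r s) + K (u s) (u s) / q)"
      proof (cases "s \<in> ?I")
        case True
        have 1: "2 * B (g s) (u s) \<le> q * K (r s) (r s) + K (u s) (u s) / q"
          using semi_inner_young[OF V K in_V(3)[OF True] in_V(1)[OF True] q] R(2)[OF in_V(2)[OF True] in_V(1)[OF True]]
          by (simp add: r_def)
        have 2: "0 \<le> q * K (r s) (r s) + K (u s) (u s) / q"
          using semi_inner_nonneg[OF K in_V(3)[OF True]] semi_inner_nonneg[OF K in_V(1)[OF True]] q by simp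
        show ?thesis using 1 2 True by (simp add: indicator_def)
      next
        case False
        then have "s \<notin> {0<..<t}" using t by auto
        then show ?thesis using False by simp
      qed
    qed
    also have "\<dots> = q * G + Y / q"
      using set_integral_add(2)[OF set_integrable_mult_right[OF int[OF K rL rL], of q] set_integrable_mult_right[OF int[OF K uL uL], of "1 / q"]]
      by (simp add: G_def Y_def)
    finally have "2 * (LINT s:{0<..<t}|lborel. B (g s) (u s)) \<le> q * G + Y / q" by simp
    then show ?thesis using energy_equation[OF V Bs e u g t] by (simp add: S_def A_def)
  qed
  have M: "M \<le> T * S"
  proof -
    have c: "set_integrable lborel ?I (\<lambda>t. S)" unfolding set_integrable_def using T by simp
    have "M \<le> (LINT t:?I|lborel. S)" unfolding M_def
      by (rule set_integral_mono[OF int[OF Bs uL uL] c]) (use pointwise in auto)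
    also have "\<dots> = T * S" unfolding set_lebesgue_integral_def using T by simp
    finally show ?thesis .
  qed
  have YMD: "Y \<le> M + D"
  proof -
    have "Y \<le> (LINT t:?I|lborel. B (u t) (u t) + a (u t) (u t))" unfolding Y_def
      by (rule set_integral_mono[OF int[OF K uL uL] set_integral_add(1)[OF int[OF Bs uL uL] int[OF a uL uL]]])
         (use KBa in_V in auto)
    then show ?thesis using set_integral_add(2)[OF int[OF Bs uL uL] int[OF a uL uL]] by (simp add: M_def D_def)
  qed
  have Y: "(1 + T) * Y \<le> q * (T * A + D + T * q * G)"
  proof -
    have "Y \<le> T * S + D" using M YMD by simp
    then have "q * Y \<le> q * (T * S + D)" using q by (intro mult_left_mono) auto
    also have "\<dots> = q * (T * A + D + T * q * G) + T * Y" using q by (simp add: S_def field_simps)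
    finally show ?thesis by (simp add: q_def algebra_simps)
  qed
  \<comment> \<open>The bound \<open>S\<close> of \<open>B (u t) (u t)\<close> vanishes with \<open>X\<close>, but \<open>u\<close> does not vanish.\<close>
  show X0: "0 < X"
  proof (rule ccontr)
    assume "\<not> 0 < X"
    then have zero: "A = 0" "G = 0" "D = 0" using X A0 G0 D0 by linarith+
    then have "(1 + T) * Y \<le> 0" using Y by simp
    then have "Y \<le> 0" using T by (simp add: mult_le_0_iff)
    then have "S \<le> 0" unfolding S_def zero using q by (simp add: divide_nonpos_pos)
    obtain t where t: "t \<in> {0..T}" "u t \<noteq> (\<lambda>x. 0)" using nz by blast
    then have "0 < B (u t) (u t)" using B trial_space_in[OF u, of t] by (auto simp: inner_product_on_def)
    then show False using pointwise[of t] t \<open>S \<le> 0\<close> by simp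
  qed
  show "X / 2 \<le> B (u 0) (u 0) + (LINT t:?I|lborel. B (g t) (v1 t) + a (u t) (v1 t))"
  proof -
    have uT: "u T \<in> V" using trial_space_in[OF u, of T] T by simp
    have I: "set_integrable lborel ?I (\<lambda>t. B (g t) (u t))" "set_integrable lborel ?I (\<lambda>t. K (r t) (r t))"
      "set_integrable lborel ?I (\<lambda>t. a (u t) (u t))"
      by (rule int[OF Bs gL uL] int[OF K rL rL] int[OF a uL uL])+
    have "(LINT t:?I|lborel. B (g t) (u t) + ((1/2) * K (r t) (r t) + (1/2) * a (u t) (u t))) \<le>
        (LINT t:?I|lborel. B (g t) (v1 t) + a (u t) (v1 t))"
    proof (rule set_integral_mono)
      show "set_integrable lborel ?I (\<lambda>t. B (g t) (u t) + ((1/2) * K (r t) (r t) + (1/2) * a (u t) (u t)))"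
        by (intro set_integral_add set_integrable_mult_right I)
      show "set_integrable lborel ?I (\<lambda>t. B (g t) (v1 t) + a (u t) (v1 t))"
        by (intro set_integral_add int[OF Bs gL v1L] int[OF a uL v1L])
      fix t assume t: "t \<in> ?I"
      note uV = in_V(1)[OF t] and gV = in_V(2)[OF t] and rV = in_V(3)[OF t]
      have "B (g t) (v1 t) = B (g t) (u t) + B (g t) (r t)"
        unfolding v1 using linear_functional_combine[OF semi_inner_right[OF V Bs gV] uV rV, of 1] by simp
      moreover have "B (g t) (r t) = K (r t) (r t)" using R(2)[OF gV rV] by (simp add: r_def)
      moreover have "a (u t) (v1 t) = a (u t) (u t) + a (u t) (r t)"
        unfolding v1 using linear_functional_combine[OF semi_inner_right[OF V a uV] uV rV, of 1] by simp
      moreover have "- 2 * a (u t) (r t) \<le> a (u t) (u t) + a (r t) (r t)"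
        using semi_inner_nonneg[OF a lin_space_combine[OF V uV rV, of 1]] semi_inner_quadratic[OF V a uV rV, of 1] by simp
      ultimately show "B (g t) (u t) + ((1/2) * K (r t) (r t) + (1/2) * a (u t) (u t)) \<le> B (g t) (v1 t) + a (u t) (v1 t)"
        using aK[OF rV] by simp
    qed
    moreover have "(LINT t:?I|lborel. B (g t) (u t) + ((1/2) * K (r t) (r t) + (1/2) * a (u t) (u t))) =
        (LINT t:?I|lborel. B (g t) (u t)) + (1/2) * G + (1/2) * D"
      using I by (simp add: set_integral_add G_def D_def)
    moreover have "- A \<le> 2 * (LINT t:?I|lborel. B (g t) (u t))"
      using energy_equation[OF V Bs e u g, of T] semi_inner_nonneg[OF Bs uT] T by (simp add: A_def)
    moreover have "(A + G + D) / 2 \<le> A + z" if "p \<le> z" "p = i + (1/2) * G + (1/2) * D" "- A \<le> 2 * i" for p z i :: real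
      using that by simp
    ultimately show ?thesis unfolding X A_def[symmetric] by blast
  qed
  show "B (u 0) (u 0) + (LINT t:?I|lborel. K (v1 t) (v1 t)) \<le> 2 * (1 + 2 * T)\<^sup>2 * X"
  proof -
    have "(LINT t:?I|lborel. K (v1 t) (v1 t)) \<le> (LINT t:?I|lborel. 2 * K (u t) (u t) + 2 * K (r t) (r t))"
    proof (rule set_integral_mono[OF int[OF K v1L v1L]])
      show "set_integrable lborel ?I (\<lambda>t. 2 * K (u t) (u t) + 2 * K (r t) (r t))"
        by (intro set_integral_add set_integrable_mult_right int[OF K uL uL] int[OF K rL rL])
      fix t assume t: "t \<in> ?I"
      note uV = in_V(1)[OF t] and rV = in_V(3)[OF t]
      have "2 * K (u t) (r t) \<le> K (u t) (u t) + K (r t) (r t)" using semi_inner_young[OF V K uV rV, of 1] by simp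
      then show "K (v1 t) (v1 t) \<le> 2 * K (u t) (u t) + 2 * K (r t) (r t)"
        unfolding v1 using semi_inner_quadratic[OF V K uV rV, of 1] by simp
    qed
    also have "\<dots> = 2 * Y + 2 * G"
      using set_integral_add(2)[OF set_integrable_mult_right[OF int[OF K uL uL], of 2] set_integrable_mult_right[OF int[OF K rL rL], of 2]]
      by (simp add: Y_def G_def)
    finally have N: "(LINT t:?I|lborel. K (v1 t) (v1 t)) \<le> 2 * Y + 2 * G" .
    \<comment> \<open>After multiplication by \<open>1 + T\<close> both sides are linear in \<open>A\<close>, \<open>D\<close> and \<open>G\<close>, with coefficients that
        are polynomials in \<open>T\<close>; those of the difference are nonnegative.\<close>
    have "(1 + T) * (A + 2 * Y + 2 * G) = (1 + T) * (A + 2 * G) + 2 * ((1 + T) * Y)" by (simp add: algebra_simps)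
    also have "\<dots> \<le> (1 + T) * (A + 2 * G) + 2 * (q * (T * A + D + T * q * G))" using Y by simp
    also have "\<dots> \<le> (1 + T) * (2 * q\<^sup>2 * X)"
    proof -
      have "(1 + T) * (2 * q\<^sup>2 * X) - ((1 + T) * (A + 2 * G) + 2 * (q * (T * A + D + T * q * G))) =
          (1 + 7 * T + 12 * T\<^sup>2 + 8 * T^3) * A + (6 * T + 16 * T\<^sup>2 + 8 * T^3) * D + (6 * T + 8 * T\<^sup>2) * G"
        unfolding X q_def by (simp add: power2_eq_square power3_eq_cube algebra_simps)
      moreover have "0 \<le> \<dots>" using A0 D0 G0 T by (intro add_nonneg_nonneg mult_nonneg_nonneg) auto
      ultimately show ?thesis by linarith
    qed
    finally have "A + 2 * Y + 2 * G \<le> 2 * q\<^sup>2 * X" using T by (simp add: mult_le_cancel_left_pos)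
    then show ?thesis using N by (simp add: A_def q_def)
  qed
qed

lemma two_term_Cauchy_Schwarz:
  fixes x y z w :: real
  shows "x * y + z * w \<le> sqrt (x\<^sup>2 + z\<^sup>2) * sqrt (y\<^sup>2 + w\<^sup>2)"
proof -
  have "(x * y + z * w)\<^sup>2 \<le> (x\<^sup>2 + z\<^sup>2) * (y\<^sup>2 + w\<^sup>2)"
    using zero_le_power2[of "x * w - z * y"] by (simp add: power2_eq_square algebra_simps)
  then have "\<bar>x * y + z * w\<bar> \<le> sqrt ((x\<^sup>2 + z\<^sup>2) * (y\<^sup>2 + w\<^sup>2))" by (rule real_le_rsqrt[of "\<bar>x * y + z * w\<bar>", simplified])
  then show ?thesis by (simp add: real_sqrt_mult)
qed

section \<open>Norms of the stabilised method\<close>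

text \<open>The hypersurface with a mesh that resolves it and a nontrivial finite element space on which the
  stabilised form of order zero is definite.\<close>
locale stabilised_fem =
  fixes \<Gamma> :: "'a::euclidean_space set" and \<nu> :: "'a \<Rightarrow> 'a"
    and M Th :: "'a set set" and V :: "('a \<Rightarrow> real) set" and C :: real
  assumes hypersurface: "closed_C2_hypersurface \<Gamma>"
    and normal: "unit_normal_field \<Gamma> \<nu>"
    and mesh: "mesh_surrounding \<Gamma> M"
    and active: "Th = active_mesh \<Gamma> M"
    and resolves: "resolves_geometry \<Gamma> \<nu> Th C"
    and fe: "fe_space \<Gamma> \<nu> Th V"
    and nontrivial: "V \<noteq> {\<lambda>x. 0}"
    and inner: "inner_product_on V (ip_star \<Gamma> \<nu> Th)"
begin

text \<open>Abbreviations that suppress the fixed data. The suffix \<open>s\<close> marks the stabilised norms, \<open>0\<close> the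
  seminorm; \<open>PS\<close> is the norm of the projection into the stabilised space, \<open>CI\<close> the inverse parameter,
  \<open>trn\<close> and \<open>ten\<close> are the trial and the test norm, \<open>bf\<close> is the parabolic form and \<open>isc\<close> the inf-sup
  constant.\<close>

abbreviation "H1 \<equiv> H1_surf \<Gamma> \<nu>"
abbreviation "ip \<equiv> ip_surf \<Gamma>"
abbreviation "gip \<equiv> grad_ip_surf \<Gamma> \<nu>"
abbreviation "B \<equiv> ip_star \<Gamma> \<nu> Th"
abbreviation "a \<equiv> a_star \<Gamma> \<nu> Th"
abbreviation "stabl \<equiv> stab_local \<Gamma> \<nu>"
abbreviation "h1 \<equiv> H1_surf_norm \<Gamma> \<nu>"
abbreviation "S \<equiv> stab \<Gamma> \<nu> Th"
abbreviation "H1s \<equiv> H1_star_norm \<Gamma> \<nu> Th"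
abbreviation "H1s0 \<equiv> H1_star_seminorm \<Gamma> \<nu> Th"
abbreviation "Hm1s \<equiv> Hm1_star_norm \<Gamma> \<nu> Th"
abbreviation "P z \<equiv> proj_star \<Gamma> \<nu> Th V (ip z)"
abbreviation "PS \<equiv> proj_norm_H1_star \<Gamma> \<nu> Th V"
abbreviation "CI \<equiv> inverse_parameter \<Gamma> \<nu> Th V"
abbreviation "trn \<equiv> trial_norm \<Gamma> \<nu> Th V"
abbreviation "ten \<equiv> test_norm \<Gamma> \<nu> Th"
abbreviation "bf \<equiv> b_form \<Gamma> \<nu> Th V"
abbreviation "isc \<equiv> inf_sup_constant \<Gamma> \<nu> Th V"

text \<open>The inner product that induces the stabilised norm of order one.\<close>
definition K :: "('a \<Rightarrow> real) \<Rightarrow> ('a \<Rightarrow> real) \<Rightarrow> real" where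
  "K v w = ip v w + a v w"

lemma compact_surface: "compact \<Gamma>"
  using hypersurface by (simp add: closed_C2_hypersurface_def)

lemma finite_mesh: "finite Th"
  using mesh active by (simp add: mesh_surrounding_def active_mesh_def)

lemma element:
  assumes "E \<in> Th"
  shows "compact E" "interior E \<noteq> {}" "negligible (frontier E)"
proof -
  have "E \<in> M" using assms active by (simp add: active_mesh_def)
  then show "compact E" "interior E \<noteq> {}" "negligible (frontier E)"
    using mesh unfolding mesh_surrounding_def by blast+
qed

lemma element_diameter: "E \<in> Th \<Longrightarrow> 0 < diameter E"
  by (rule diameter_pos[OF element(1) element(2)])

lemma V_lin: "lin_space V"
proof -
  obtain N \<phi> where "V = {v. \<exists>c :: nat \<Rightarrow> real. v = (\<lambda>x. \<Sum>i<N. c i * \<phi> i x)}"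
    using fe unfolding fe_space_def by (elim conjE exE)
  then show ?thesis by (simp only: lin_space_span)
qed

lemma basis_exists: "inner_product_on V Q \<Longrightarrow> \<exists>n e. orthonormal_basis V Q n e"
proof -
  assume Q: "inner_product_on V Q"
  obtain N \<phi> where N: "V = {v. \<exists>c :: nat \<Rightarrow> real. v = (\<lambda>x. \<Sum>i<N. c i * \<phi> i x)}"
    using fe unfolding fe_space_def by (elim conjE exE)
  show ?thesis using orthonormal_basis_exists[OF Q[unfolded N]] unfolding N .
qed

lemma V_members: "\<forall>v\<in>V. continuous_on (\<Union>Th) v \<and> (\<forall>x. x \<notin> \<Union>Th \<longrightarrow> v x = 0) \<and>
    (\<forall>E\<in>Th. \<exists>q. real_polynomial_function q \<and> (\<forall>x\<in>E. v x = q x)) \<and> v \<in> H1"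
  using fe unfolding fe_space_def by (rule conjunct2)

lemma V_H1: "V \<subseteq> H1"
  using V_members by (simp add: subset_iff)

lemma V_in_H1: "v \<in> V \<Longrightarrow> v \<in> H1"
  using V_H1 by blast

lemma semi_ip_H1: "semi_inner_on H1 ip"
  by (rule semi_inner_ip_surf[OF hypersurface normal])

lemma semi_gip_H1: "semi_inner_on H1 gip"
  by (rule semi_inner_grad_ip_surf[OF hypersurface normal])

lemma H1_lin: "lin_space H1"
  by (rule lin_space_H1_surf[OF hypersurface normal])

lemma semi_ip: "semi_inner_on V ip"
  by (rule semi_inner_subset[OF semi_ip_H1 V_H1])

lemma semi_gip: "semi_inner_on V gip"
  by (rule semi_inner_subset[OF semi_gip_H1 V_H1])

lemma semi_stab_local:
  assumes E: "E \<in> Th"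
  shows "semi_inner_on V (stabl j E)"
proof (rule semi_inner_stab_local)
  have uniq: "\<forall>x\<in>E. \<exists>!y. y \<in> \<Gamma> \<and> (\<forall>z\<in>\<Gamma>. dist x y \<le> dist x z)"
    using bspec[OF resolves[unfolded resolves_geometry_def, THEN conjunct2, THEN conjunct2] UnionI[OF E]] by blast
  show "continuous_on \<Gamma> \<nu>" by (rule unit_normal_continuous[OF normal])
  show "compact E" "negligible (frontier E)" using element[OF E] by auto
  note cp = closest_point_continuous[OF compact_surface element(1)[OF E] uniq]
  show "continuous_on E (closest_point \<Gamma>)" by (rule cp(1))
  show "closest_point \<Gamma> x \<in> \<Gamma>" if "x \<in> E" for x by (rule cp(2)[OF that])
  show "lin_space V" by (rule V_lin)
  show "\<exists>q. real_polynomial_function q \<and> (\<forall>x\<in>E. v x = q x)" if "v \<in> V" for v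
    using bspec[OF V_members that] E by simp
qed

lemma semi_stab: "semi_inner_on V (S j)"
  unfolding stab_def[abs_def] by (rule semi_inner_sum[OF finite_mesh semi_stab_local])

lemma semi_B: "semi_inner_on V B"
  by (rule inner_product_semi_inner[OF V_lin inner])

lemma semi_a: "semi_inner_on V a"
  unfolding a_star_def[abs_def] by (rule semi_inner_add[OF semi_gip semi_stab])

lemma semi_K: "semi_inner_on V K"
  unfolding K_def[abs_def] by (rule semi_inner_add[OF semi_ip semi_a])

lemma stab_zero_one: "E \<in> Th \<Longrightarrow> stabl 0 E v w = (diameter E)\<^sup>2 * stabl 1 E v w"
  using stab_local_shift[OF element_diameter, of E \<Gamma> \<nu> 1 v w] by simp

lemma stab_minus_zero: "E \<in> Th \<Longrightarrow> stabl (-1) E v w = (diameter E)\<^sup>2 * stabl 0 E v w"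
  using stab_local_shift[OF element_diameter, of E \<Gamma> \<nu> 0 v w] by simp

lemma stab_local_nonneg: "E \<in> Th \<Longrightarrow> v \<in> V \<Longrightarrow> 0 \<le> stabl j E v v"
  by (rule semi_inner_nonneg[OF semi_stab_local])

lemma h1_square:
  assumes "v \<in> H1"
  shows "(h1 v)\<^sup>2 = ip v v + gip v v"
  using semi_inner_nonneg[OF semi_ip_H1 assms] semi_inner_nonneg[OF semi_gip_H1 assms]
  by (simp add: H1_surf_norm_def)

lemma h1_nonneg: "v \<in> H1 \<Longrightarrow> 0 \<le> h1 v"
  using semi_inner_nonneg[OF semi_ip_H1, of v] semi_inner_nonneg[OF semi_gip_H1, of v]
  by (simp add: H1_surf_norm_def)

lemma H1_star_norm_K: "v \<in> V \<Longrightarrow> H1s v = sqrt (K v v)"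
  by (simp add: H1_star_norm_def K_def a_star_def h1_square[OF V_in_H1] add.assoc)

lemma a_le_K: "v \<in> V \<Longrightarrow> a v v \<le> K v v"
  using semi_inner_nonneg[OF semi_ip] by (simp add: K_def)

lemma K_le_B_a: "v \<in> V \<Longrightarrow> K v v \<le> B v v + a v v"
  using semi_inner_nonneg[OF semi_stab, of v 0] by (simp add: K_def ip_star_def)

lemma h1_le_K: "v \<in> V \<Longrightarrow> h1 v \<le> sqrt (K v v)"
  using semi_inner_nonneg[OF semi_stab, of v 1] by (simp add: H1_surf_norm_def K_def a_star_def)

lemma B_pos: "v \<in> V \<Longrightarrow> v \<noteq> (\<lambda>x. 0) \<Longrightarrow> 0 < B v v"
  using inner unfolding inner_product_on_def by blast

lemma inner_K: "inner_product_on V K"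
proof -
  have "0 < K v v" if v: "v \<in> V" "v \<noteq> (\<lambda>x. 0)" for v
  proof (rule ccontr)
    assume "\<not> 0 < K v v"
    moreover have "0 \<le> ip v v" "0 \<le> gip v v" "0 \<le> S 1 v v"
      using v semi_inner_nonneg[OF semi_ip] semi_inner_nonneg[OF semi_gip] semi_inner_nonneg[OF semi_stab] by auto
    ultimately have zero: "ip v v = 0" "S 1 v v = 0" by (auto simp: K_def a_star_def)
    have "stabl 1 E v v = 0" if "E \<in> Th" for E
      using zero(2) that stab_local_nonneg[OF _ v(1)] finite_mesh unfolding stab_def
      by (subst (asm) sum_nonneg_eq_0_iff) auto
    then have "S 0 v v = 0" by (simp add: stab_def stab_zero_one)
    then have "B v v = 0" using zero(1) by (simp add: ip_star_def)
    then show False using B_pos[OF v] by simp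
  qed
  moreover have "K (\<lambda>x. c * u x + v x) w = c * K u w + K v w" if "u \<in> V" "v \<in> V" "w \<in> V" for u v w c
    by (rule linear_functional_combine[OF semi_inner_left[OF semi_K that(3)] that(1,2)])
  ultimately show ?thesis using semi_inner_sym[OF semi_K] by (simp add: inner_product_on_def)
qed

lemma K_pos: "v \<in> V \<Longrightarrow> v \<noteq> (\<lambda>x. 0) \<Longrightarrow> 0 < K v v"
  using inner_K unfolding inner_product_on_def by blast

lemma K_Cauchy_Schwarz: "v \<in> V \<Longrightarrow> w \<in> V \<Longrightarrow> \<bar>K v w\<bar> \<le> sqrt (K v v) * sqrt (K w w)"
  by (rule semi_inner_Cauchy_Schwarz[OF V_lin semi_K])

text \<open>\<open>R v\<close> is the Riesz representer of the functional \<open>B v\<close> in the inner product \<open>K\<close>. Linearity of \<open>R\<close>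
  is expressed through the linear functionals, as are measurability and integrability in time.\<close>

definition R :: "('a \<Rightarrow> real) \<Rightarrow> 'a \<Rightarrow> real" where
  "R = (SOME R. (\<forall>v\<in>V. R v \<in> V) \<and> (\<forall>v\<in>V. \<forall>w\<in>V. K (R v) w = B v w) \<and>
        (\<forall>l. linear_functional_on V l \<longrightarrow> linear_functional_on V (\<lambda>v. l (R v))))"

lemma R_props: "(\<forall>v\<in>V. R v \<in> V) \<and> (\<forall>v\<in>V. \<forall>w\<in>V. K (R v) w = B v w) \<and>
        (\<forall>l. linear_functional_on V l \<longrightarrow> linear_functional_on V (\<lambda>v. l (R v)))"
proof -
  obtain n k where k: "orthonormal_basis V K n k" using basis_exists[OF inner_K] by blast
  have kV: "k i \<in> V" if "i < n" for i using k that by (simp add: orthonormal_basis_def)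
  let ?R = "\<lambda>v x. \<Sum>i<n. B v (k i) * k i x"
  have 1: "?R v \<in> V" if "v \<in> V" for v
    by (rule riesz_representation(1)[OF V_lin semi_K k semi_inner_right[OF V_lin semi_B that]])
  have 2: "K (?R v) w = B v w" if "v \<in> V" "w \<in> V" for v w
    by (rule riesz_representation(2)[OF V_lin semi_K k semi_inner_right[OF V_lin semi_B that(1)] that(2)])
  have 3: "linear_functional_on V (\<lambda>v. l (?R v))" if l: "linear_functional_on V l" for l
  proof -
    have exp: "l (?R v) = (\<Sum>i<n. B v (k i) * l (k i))" for v
      by (rule linear_functional_sum[OF V_lin l]) (auto simp: kV)
    have comb: "B (\<lambda>x. c * u x + v x) (k i) = c * B u (k i) + B v (k i)" if "u \<in> V" "v \<in> V" "i < n" for u v c i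
      by (rule linear_functional_combine[OF semi_inner_left[OF semi_B kV[OF that(3)]] that(1,2)])
    have "(\<Sum>i<n. B (\<lambda>x. c * u x + v x) (k i) * l (k i)) =
        c * (\<Sum>i<n. B u (k i) * l (k i)) + (\<Sum>i<n. B v (k i) * l (k i))" if uv: "u \<in> V" "v \<in> V" for u v c
    proof -
      have "(\<Sum>i<n. B (\<lambda>x. c * u x + v x) (k i) * l (k i)) = (\<Sum>i<n. (c * B u (k i) + B v (k i)) * l (k i))"
        by (rule sum.cong) (simp_all add: comb[OF uv])
      then show ?thesis by (simp add: distrib_right sum.distrib sum_distrib_left mult.assoc)
    qed
    then show ?thesis unfolding linear_functional_on_def exp by blast
  qed
  show ?thesis unfolding R_def by (rule someI[of _ ?R]) (use 1 2 3 in blast)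
qed

lemma R_in: "v \<in> V \<Longrightarrow> R v \<in> V"
  using R_props by blast

lemma R_eq: "v \<in> V \<Longrightarrow> w \<in> V \<Longrightarrow> K (R v) w = B v w"
  using R_props by blast

lemma R_linear: "linear_functional_on V l \<Longrightarrow> linear_functional_on V (\<lambda>v. l (R v))"
  using R_props by blast

text \<open>The discrete dual norm in closed form; it is also meaningful for \<open>v = 0\<close>.\<close>
definition dual :: "('a \<Rightarrow> real) \<Rightarrow> real" where
  "dual v = sqrt (K (R v) (R v))"

lemma dual_square: "v \<in> V \<Longrightarrow> (dual v)\<^sup>2 = K (R v) (R v)"
  using semi_inner_nonneg[OF semi_K R_in] by (simp add: dual_def)

lemma dual_nonneg: "v \<in> V \<Longrightarrow> 0 \<le> dual v"
  using semi_inner_nonneg[OF semi_K R_in] by (simp add: dual_def)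

lemma dual_bound: "v \<in> V \<Longrightarrow> w \<in> V \<Longrightarrow> \<bar>B v w\<bar> \<le> dual v * sqrt (K w w)"
  using K_Cauchy_Schwarz[OF R_in, of v w] R_eq[of v w] by (simp add: dual_def)

lemma R_nonzero:
  assumes v: "v \<in> V" "v \<noteq> (\<lambda>x. 0)"
  shows "R v \<noteq> (\<lambda>x. 0)"
proof
  assume "R v = (\<lambda>x. 0)"
  then have "B v v = 0"
    using R_eq[OF v(1) v(1)] linear_functional_zero[OF V_lin semi_inner_left[OF semi_K v(1)]] by simp
  then show False using B_pos[OF v] by simp
qed

lemma dual_pos: "v \<in> V \<Longrightarrow> v \<noteq> (\<lambda>x. 0) \<Longrightarrow> 0 < dual v"
  using K_pos[OF R_in R_nonzero] by (simp add: dual_def)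

lemma discrete_dual_norm_eq:
  assumes v: "v \<in> V" "v \<noteq> (\<lambda>x. 0)"
  shows "discrete_dual_norm \<Gamma> \<nu> Th V v = dual v"
  unfolding discrete_dual_norm_def
proof (rule cSup_eq_maximum)
  have Rv: "R v \<in> V - {\<lambda>x. 0}" using R_in R_nonzero v by blast
  have "0 < K (R v) (R v)" using K_pos Rv by blast
  then have "B v (R v) / H1s (R v) = dual v"
    using H1_star_norm_K[OF R_in[OF v(1)]] R_eq[OF v(1) R_in[OF v(1)]]
    by (simp add: dual_def real_div_sqrt)
  then show "dual v \<in> (\<lambda>w. B v w / H1s w) ` (V - {\<lambda>x. 0})"
    using Rv by (intro image_eqI[of _ _ "R v"]) auto
  fix y assume "y \<in> (\<lambda>w. B v w / H1s w) ` (V - {\<lambda>x. 0})"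
  then obtain w where w: "w \<in> V" "w \<noteq> (\<lambda>x. 0)" "y = B v w / H1s w" by blast
  have "B v w \<le> dual v * sqrt (K w w)" using dual_bound[OF v(1) w(1)] by linarith
  then show "y \<le> dual v"
    using w K_pos[OF w(1,2)] H1_star_norm_K[OF w(1)] by (simp add: divide_le_eq)
qed

lemma proj:
  assumes z: "z \<in> H1"
  shows "P z \<in> V" "v \<in> V \<Longrightarrow> B (P z) v = ip z v"
proof -
  obtain n e where e: "orthonormal_basis V B n e" using basis_exists[OF inner] by blast
  have "linear_functional_on H1 (ip z)" by (rule semi_inner_right[OF H1_lin semi_ip_H1 z])
  then have l: "linear_functional_on V (ip z)" using V_H1 by (auto simp: linear_functional_on_def)
  let ?w = "\<lambda>x. \<Sum>i<n. ip z (e i) * e i x"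
  note w = riesz_representation[OF V_lin semi_B e l]
  have "P z = ?w"
    unfolding proj_star_def
  proof (rule the_equality)
    show "?w \<in> V \<and> (\<forall>v\<in>V. B ?w v = ip z v)" using w by blast
    fix w' assume w': "w' \<in> V \<and> (\<forall>v\<in>V. B w' v = ip z v)"
    let ?d = "\<lambda>x. w' x - ?w x"
    have d: "?d \<in> V" by (rule lin_space_diff[OF V_lin]) (use w' w in auto)
    have "B ?d ?d = B w' ?d - B ?w ?d"
      by (rule linear_functional_diff[OF V_lin semi_inner_left[OF semi_B d]]) (use w' w in auto)
    also have "\<dots> = 0" using w' w(2)[OF d] d by simp
    finally have "?d = (\<lambda>x. 0)" using B_pos[OF d] by force
    then show "w' = ?w" by (simp add: fun_eq_iff)
  qed
  then show "P z \<in> V" "v \<in> V \<Longrightarrow> B (P z) v = ip z v" using w by simp_all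
qed

text \<open>The norm in the dual of \<open>H\<^sup>1(\<Gamma>)\<close> of the functional given by a square integrable function.\<close>

definition hm :: "('a \<Rightarrow> real) \<Rightarrow> real" where
  "hm v = Hm1_surf_norm \<Gamma> \<nu> (ip v)"

lemma ip_le_h1:
  assumes "v \<in> H1" "w \<in> H1"
  shows "\<bar>ip v w\<bar> \<le> sqrt (ip v v) * h1 w"
proof -
  have "\<bar>ip v w\<bar> \<le> sqrt (ip v v) * sqrt (ip w w)"
    by (rule semi_inner_Cauchy_Schwarz[OF H1_lin semi_ip_H1 assms])
  also have "\<dots> \<le> sqrt (ip v v) * h1 w"
    using semi_inner_nonneg[OF semi_ip_H1 assms(1)] semi_inner_nonneg[OF semi_gip_H1 assms(2)]
    by (intro mult_left_mono) (auto simp: H1_surf_norm_def)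
  finally show ?thesis .
qed

lemma hm_bdd: "v \<in> H1 \<Longrightarrow> bdd_above ((\<lambda>w. \<bar>ip v w\<bar>) ` {w \<in> H1. h1 w \<le> 1})"
proof (rule bdd_aboveI2)
  fix w assume v: "v \<in> H1" and w: "w \<in> {w \<in> H1. h1 w \<le> 1}"
  then have "\<bar>ip v w\<bar> \<le> sqrt (ip v v) * h1 w" by (intro ip_le_h1) auto
  also have "\<dots> \<le> sqrt (ip v v) * 1"
    using w semi_inner_nonneg[OF semi_ip_H1 v] by (intro mult_left_mono) auto
  finally show "\<bar>ip v w\<bar> \<le> sqrt (ip v v)" by simp
qed

lemma h1_scale:
  assumes "w \<in> H1"
  shows "h1 (\<lambda>x. c * w x) = \<bar>c\<bar> * h1 w"
proof -
  have cw: "(\<lambda>x. c * w x) \<in> H1" by (rule lin_space_scale[OF H1_lin assms])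
  have sc: "Q (\<lambda>x. c * w x) (\<lambda>x. c * w x) = c\<^sup>2 * Q w w" if Q: "semi_inner_on H1 Q" for Q
    using linear_functional_scale[OF H1_lin semi_inner_left[OF Q cw] assms, of c]
      linear_functional_scale[OF H1_lin semi_inner_right[OF H1_lin Q assms] assms, of c]
    by (simp add: power2_eq_square)
  show ?thesis unfolding H1_surf_norm_def sc[OF semi_ip_H1] sc[OF semi_gip_H1]
    by (simp add: distrib_left[symmetric] real_sqrt_mult)
qed

lemma h1_zero: "h1 (\<lambda>x. 0) = 0"
  using h1_scale[OF lin_space_zero[OF H1_lin], of 0] by simp

lemma hm_upper:
  assumes v: "v \<in> H1" and w: "w \<in> H1"
  shows "\<bar>ip v w\<bar> \<le> hm v * h1 w"
proof (cases "h1 w = 0")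
  case True
  then show ?thesis using ip_le_h1[OF v w] by simp
next
  case False
  then have pos: "0 < h1 w" using h1_nonneg[OF w] by simp
  let ?w = "\<lambda>x. (1 / h1 w) * w x"
  have w': "?w \<in> H1" by (rule lin_space_scale[OF H1_lin w])
  have "h1 ?w = 1" using h1_scale[OF w, of "1 / h1 w"] pos by simp
  then have "\<bar>ip v ?w\<bar> \<le> hm v"
    unfolding hm_def Hm1_surf_norm_def by (intro cSUP_upper hm_bdd[OF v]) (use w' in auto)
  moreover have "ip v ?w = (1 / h1 w) * ip v w"
    by (rule linear_functional_scale[OF H1_lin semi_inner_right[OF H1_lin semi_ip_H1 v] w])
  ultimately show ?thesis using pos by (simp add: abs_mult divide_le_eq)
qed

lemma hm_least:
  assumes "\<And>w. w \<in> H1 \<Longrightarrow> h1 w \<le> 1 \<Longrightarrow> \<bar>ip v w\<bar> \<le> c"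
  shows "hm v \<le> c"
  unfolding hm_def Hm1_surf_norm_def
proof (rule cSUP_least)
  show "{w \<in> H1. h1 w \<le> 1} \<noteq> {}" using lin_space_zero[OF H1_lin] h1_zero by auto
qed (use assms in auto)

lemma hm_nonneg:
  assumes "v \<in> H1"
  shows "0 \<le> hm v"
proof -
  have "\<bar>ip v (\<lambda>x. 0)\<bar> \<le> hm v"
    unfolding hm_def Hm1_surf_norm_def
    by (intro cSUP_upper hm_bdd[OF assms]) (use lin_space_zero[OF H1_lin] h1_zero in auto)
  then show ?thesis by linarith
qed

lemma hm_diff:
  assumes u: "u \<in> H1" and w: "w \<in> H1"
  shows "\<bar>hm u - hm w\<bar> \<le> sqrt (ip (\<lambda>x. u x - w x) (\<lambda>x. u x - w x))"
proof -
  have one: "hm u \<le> hm w + sqrt (ip (\<lambda>x. u x - w x) (\<lambda>x. u x - w x))" if u: "u \<in> H1" and w: "w \<in> H1" for u w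
  proof (rule hm_least)
    let ?d = "\<lambda>x. u x - w x"
    fix z assume z: "z \<in> H1" "h1 z \<le> 1"
    have d: "?d \<in> H1" by (rule lin_space_diff[OF H1_lin u w])
    have "ip ?d z = ip u z - ip w z"
      by (rule linear_functional_diff[OF H1_lin semi_inner_left[OF semi_ip_H1 z(1)] u w])
    then have "\<bar>ip u z\<bar> \<le> \<bar>ip w z\<bar> + \<bar>ip ?d z\<bar>" by linarith
    also have "\<dots> \<le> hm w * h1 z + sqrt (ip ?d ?d) * h1 z"
      by (intro add_mono hm_upper ip_le_h1 w z d)
    also have "\<dots> \<le> hm w * 1 + sqrt (ip ?d ?d) * 1"
      using z(2) hm_nonneg[OF w] semi_inner_nonneg[OF semi_ip_H1 d]
      by (intro add_mono mult_left_mono) auto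
    finally show "\<bar>ip u z\<bar> \<le> hm w + sqrt (ip ?d ?d)" by simp
  qed
  let ?d = "\<lambda>x. u x - w x" and ?e = "\<lambda>x. w x - u x"
  have ee: "ip ?e ?e = ip ?d ?d" unfolding ip_surf_def by (simp add: algebra_simps)
  show ?thesis using one[OF u w] one[OF w u, unfolded ee] by (simp add: abs_le_iff)
qed

lemma Hm1_star_square:
  assumes v: "v \<in> V"
  shows "(Hm1s v)\<^sup>2 = (hm v)\<^sup>2 + S (-1) v v"
  using semi_inner_nonneg[OF semi_stab v, of "-1"] by (simp add: Hm1_star_norm_def hm_def)

lemma Hm1_star_nonneg: "v \<in> V \<Longrightarrow> 0 \<le> Hm1s v"
  using semi_inner_nonneg[OF semi_stab, of v "-1"] by (simp add: Hm1_star_norm_def)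

text \<open>On each element the order zero is the geometric mean of the orders minus one and one.\<close>
lemma stab_zero_bound:
  assumes v: "v \<in> V" and w: "w \<in> V"
  shows "S 0 v w \<le> sqrt (S (-1) v v) * sqrt (S 1 w w)"
proof -
  let ?f = "\<lambda>E. sqrt (stabl (-1) E v v)" and ?g = "\<lambda>E. sqrt (stabl 1 E w w)"
  have "S 0 v w \<le> (\<Sum>E\<in>Th. \<bar>?f E\<bar> * \<bar>?g E\<bar>)"
    unfolding stab_def
  proof (rule sum_mono)
    fix E assume E: "E \<in> Th"
    have d: "0 < diameter E" by (rule element_diameter[OF E])
    have "stabl 0 E v w \<le> sqrt (stabl 0 E v v) * sqrt (stabl 0 E w w)"
      using semi_inner_Cauchy_Schwarz[OF V_lin semi_stab_local[OF E] v w, of 0] by linarith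
    also have "\<dots> = ?f E * ?g E"
      using d by (simp add: stab_minus_zero[OF E] stab_zero_one[OF E, of w w] real_sqrt_mult)
    finally show "stabl 0 E v w \<le> \<bar>?f E\<bar> * \<bar>?g E\<bar>"
      using stab_local_nonneg[OF E v, of "-1"] stab_local_nonneg[OF E w, of 1] by simp
  qed
  also have "\<dots> \<le> L2_set ?f Th * L2_set ?g Th" by (rule L2_set_mult_ineq)
  also have "\<dots> = sqrt (S (-1) v v) * sqrt (S 1 w w)"
    unfolding L2_set_def stab_def using stab_local_nonneg v w by simp
  finally show ?thesis .
qed

text \<open>\<open>B v w\<close> is the pairing on \<open>\<Gamma>\<close> plus the stabilisation of order zero; each part is bounded by the
  corresponding parts of the two norms.\<close>
lemma dual_le_Hm1_star:
  assumes v: "v \<in> V"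
  shows "dual v \<le> Hm1s v"
proof -
  let ?y = "R v" and ?H = "Hm1s v"
  have y: "?y \<in> V" by (rule R_in[OF v])
  have "(dual v)\<^sup>2 = B v ?y" using dual_square[OF v] R_eq[OF v y] by simp
  also have "\<dots> \<le> hm v * h1 ?y + sqrt (S (-1) v v) * sqrt (S 1 ?y ?y)"
    using hm_upper[OF V_in_H1[OF v] V_in_H1[OF y]] stab_zero_bound[OF v y] by (simp add: ip_star_def)
  also have "\<dots> \<le> sqrt ((hm v)\<^sup>2 + (sqrt (S (-1) v v))\<^sup>2) * sqrt ((h1 ?y)\<^sup>2 + (sqrt (S 1 ?y ?y))\<^sup>2)"
    by (rule two_term_Cauchy_Schwarz)
  also have "\<dots> = ?H * dual v"
    using semi_inner_nonneg[OF semi_stab v, of "-1"] semi_inner_nonneg[OF semi_stab y, of 1]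
    by (simp add: Hm1_star_norm_def hm_def dual_def K_def a_star_def h1_square[OF V_in_H1[OF y]] add.assoc)
  finally have "dual v * dual v \<le> ?H * dual v" by (simp add: power2_eq_square)
  then show ?thesis
    using dual_nonneg[OF v] Hm1_star_nonneg[OF v] by (cases "dual v = 0") (auto simp: mult_le_cancel_right)
qed

text \<open>The norm of the projection controls the part on \<open>\<Gamma>\<close> and the inverse parameter the stabilisation.\<close>
lemma Hm1_star_le_dual:
  assumes p: "PS = ennreal p" "0 \<le> p"
    and c: "CI = ennreal c" "0 \<le> c"
    and v: "v \<in> V"
  shows "Hm1s v \<le> (p + c) * dual v"
proof -
  have D: "0 \<le> dual v" by (rule dual_nonneg[OF v])
  have hm: "hm v \<le> p * dual v"
  proof (rule hm_least)
    fix w assume w: "w \<in> H1" "h1 w \<le> 1"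
    note Pw = proj[OF w(1)]
    show "\<bar>ip v w\<bar> \<le> p * dual v"
    proof (cases "h1 w = 0")
      case True
      then show ?thesis using ip_le_h1[OF V_in_H1[OF v] w(1)] p(2) D by simp
    next
      case False
      then have pos: "0 < h1 w" using h1_nonneg[OF w(1)] by simp
      have "ennreal (H1s (P w) / h1 w) \<le> ennreal p"
        unfolding p(1)[symmetric] proj_norm_H1_star_def by (rule SUP_upper) (use w False in auto)
      then have "H1s (P w) / h1 w \<le> p" using p(2) by (simp add: ennreal_le_iff)
      then have N: "sqrt (K (P w) (P w)) \<le> p * h1 w"
        using pos by (simp add: divide_le_eq H1_star_norm_K[OF Pw(1)])
      have "ip v w = B v (P w)"
        using Pw(2)[OF v] semi_inner_sym[OF semi_ip_H1 w(1) V_in_H1[OF v]] semi_inner_sym[OF semi_B v Pw(1)] by simp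
      then have "\<bar>ip v w\<bar> \<le> dual v * sqrt (K (P w) (P w))" using dual_bound[OF v Pw(1)] by simp
      also have "\<dots> \<le> dual v * (p * h1 w)" using N D by (rule mult_left_mono)
      also have "\<dots> \<le> dual v * (p * 1)" using w(2) p(2) D by (intro mult_left_mono) auto
      finally show ?thesis by (simp add: mult.commute)
    qed
  qed
  have st: "sqrt (S (-1) v v) \<le> c * dual v"
  proof (cases "v = (\<lambda>x. 0)")
    case True
    have "S (-1) v v = 0"
      unfolding True by (rule linear_functional_zero[OF V_lin semi_inner_left[OF semi_stab lin_space_zero[OF V_lin]]])
    then show ?thesis using c(2) D by simp
  next
    case False
    let ?L = "\<lambda>E. (diameter E)\<^sup>2 * (L2_star_norm_local \<Gamma> \<nu> E v)\<^sup>2"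
    have "ennreal (sqrt (\<Sum>E\<in>Th. ?L E) / discrete_dual_norm \<Gamma> \<nu> Th V v) \<le> ennreal c"
      unfolding c(1)[symmetric] inverse_parameter_def by (rule SUP_upper) (use v False in auto)
    then have "sqrt (\<Sum>E\<in>Th. ?L E) / dual v \<le> c"
      using c(2) by (simp add: ennreal_le_iff discrete_dual_norm_eq[OF v False])
    then have 1: "sqrt (\<Sum>E\<in>Th. ?L E) \<le> c * dual v"
      using dual_pos[OF v False] by (simp add: divide_le_eq)
    have "S (-1) v v \<le> (\<Sum>E\<in>Th. ?L E)"
      unfolding stab_def
    proof (rule sum_mono)
      fix E assume E: "E \<in> Th"
      have "0 \<le> (LINT x:\<Gamma> \<inter> E|surface_measure \<Gamma>. (v x)\<^sup>2)"
        unfolding set_lebesgue_integral_def by (intro Bochner_Integration.integral_nonneg) auto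
      then have "stabl 0 E v v \<le> (L2_star_norm_local \<Gamma> \<nu> E v)\<^sup>2"
        using stab_local_nonneg[OF E v, of 0] by (simp add: L2_star_norm_local_def)
      then show "stabl (-1) E v v \<le> ?L E" unfolding stab_minus_zero[OF E] by (intro mult_left_mono) auto
    qed
    then show ?thesis using 1 real_sqrt_le_mono by (meson order_trans)
  qed
  have "sqrt (S (-1) v v) ^ 2 = S (-1) v v"
    using semi_inner_nonneg[OF semi_stab v, of "-1"] by simp
  then have "Hm1s v = sqrt ((hm v)\<^sup>2 + (sqrt (S (-1) v v))\<^sup>2)"
    by (simp add: Hm1_star_norm_def hm_def)
  also have "\<dots> \<le> hm v + sqrt (S (-1) v v)"
    by (rule sqrt_sum_squares_le_sum[OF hm_nonneg[OF V_in_H1[OF v]]])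
       (simp add: semi_inner_nonneg[OF semi_stab v])
  also have "\<dots> \<le> (p + c) * dual v" using hm st by (simp add: distrib_right)
  finally show ?thesis .
qed

lemma Hm1_star_time_integrable:
  assumes g: "g \<in> L2_time V T"
  shows "set_integrable lborel {0<..<T} (\<lambda>t. (Hm1s (g t))\<^sup>2)"
proof -
  obtain n e where e: "orthonormal_basis V B n e" using basis_exists[OF inner] by blast
  let ?S = "S (-1)"
  note int = form_time_integrable[OF V_lin semi_B e]
  have meas: "set_borel_measurable lborel {0<..<T} (\<lambda>t. hm (g t))"
    by (rule seminorm_time_measurable[where N = hm, OF V_lin semi_B e semi_ip g]) (intro hm_diff V_in_H1)
  have gV: "g t \<in> V" if "t \<in> {0<..<T}" for t using that L2_time_in[OF g] by auto
  have le: "hm v \<le> sqrt (ip v v)" if v: "v \<in> V" for v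
  proof (rule hm_least)
    fix w assume w: "w \<in> H1" "h1 w \<le> 1"
    have "\<bar>ip v w\<bar> \<le> sqrt (ip v v) * h1 w" by (rule ip_le_h1[OF V_in_H1[OF v] w(1)])
    also have "\<dots> \<le> sqrt (ip v v) * 1" using w semi_inner_nonneg[OF semi_ip v] by (intro mult_left_mono) auto
    finally show "\<bar>ip v w\<bar> \<le> sqrt (ip v v)" by simp
  qed
  have "set_integrable lborel {0<..<T} (\<lambda>t. (hm (g t))\<^sup>2)"
    unfolding set_integrable_def
  proof (rule Bochner_Integration.integrable_bound)
    show "integrable lborel (\<lambda>t. indicator {0<..<T} t *\<^sub>R ip (g t) (g t))"
      using int[OF semi_ip g g] unfolding set_integrable_def .
    have "(\<lambda>t. (indicator {0<..<T} t *\<^sub>R hm (g t))\<^sup>2) \<in> borel_measurable lborel"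
      using meas unfolding set_borel_measurable_def by measurable
    then show "(\<lambda>t. indicator {0<..<T} t *\<^sub>R (hm (g t))\<^sup>2) \<in> borel_measurable lborel"
      by (rule measurable_cong[THEN iffD1, rotated]) (auto simp: indicator_def)
    have "(hm (g t))\<^sup>2 \<le> ip (g t) (g t)" if "t \<in> {0<..<T}" for t
      using power_mono[OF le[OF gV[OF that]] hm_nonneg[OF V_in_H1[OF gV[OF that]]], of 2]
        semi_inner_nonneg[OF semi_ip gV[OF that]] by simp
    then show "AE t in lborel. norm (indicator {0<..<T} t *\<^sub>R (hm (g t))\<^sup>2) \<le> norm (indicator {0<..<T} t *\<^sub>R ip (g t) (g t))"
      using semi_inner_nonneg[OF semi_ip gV] by (intro AE_I2) (auto simp: indicator_def)
  qed
  from set_integral_add(1)[OF this int[OF semi_stab[of "-1"] g g]] show ?thesis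
    by (rule set_integrable_cong[THEN iffD1, rotated -1]) (auto simp: Hm1_star_square gV)
qed

end

section \<open>The two bounds of the inf-sup constant\<close>

lemma semi_inner_L2_space:
  fixes M :: "'b measure"
  shows "semi_inner_on (L2_space M) (\<lambda>f g. LINT x|M. f x * g x)"
  unfolding semi_inner_on_def linear_functional_on_def
proof (intro conjI ballI allI)
  fix u v w :: "'b \<Rightarrow> real" and a assume u: "u \<in> L2_space M" and v: "v \<in> L2_space M"
  show "(LINT x|M. u x * v x) = (LINT x|M. v x * u x)" by (simp add: mult.commute)
  show "0 \<le> (LINT x|M. v x * v x)" by simp
  assume w: "w \<in> L2_space M"
  have "(LINT x|M. (a * u x + v x) * w x) = (LINT x|M. a * (u x * w x) + v x * w x)"
    by (simp add: algebra_simps)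
  also have "\<dots> = a * (LINT x|M. u x * w x) + (LINT x|M. v x * w x)"
    using L2_space_mult_integrable[OF u w] L2_space_mult_integrable[OF v w]
    by (subst Bochner_Integration.integral_add) auto
  finally show "(LINT x|M. (a * u x + v x) * w x) = a * (LINT x|M. u x * w x) + (LINT x|M. v x * w x)" .
qed

lemma lin_space_L2_space:
  fixes M :: "'b measure"
  shows "lin_space (L2_space M)"
proof -
  have "(\<lambda>x. a * u x + v x) \<in> L2_space M" if "u \<in> L2_space M" "v \<in> L2_space M" for u v :: "'b \<Rightarrow> real" and a
    using L2_space_combine[OF that, of a] by simp
  then show ?thesis by (simp add: lin_space_def L2_space_def)
qed

text \<open>The conventions for division by \<open>0\<close> and by infinity are covered by the statement.\<close>
lemma ennreal_le_divide_SUP: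
  fixes f :: "'b \<Rightarrow> real"
  assumes i: "0 \<le> i" and s: "0 < s" and le: "\<And>z. z \<in> Z \<Longrightarrow> 0 < f z \<Longrightarrow> i \<le> s / f z"
  shows "ennreal i \<le> ennreal s / (SUP z\<in>Z. ennreal (f z))" (is "_ \<le> _ / ?S")
proof -
  have "ennreal i * ?S = (SUP z\<in>Z. ennreal i * ennreal (f z))"
    by (simp add: SUP_mult_left_ennreal)
  also have "\<dots> \<le> ennreal s"
  proof (rule SUP_least)
    fix z assume z: "z \<in> Z"
    show "ennreal i * ennreal (f z) \<le> ennreal s"
    proof (cases "0 < f z")
      case True
      then have "i * f z \<le> s" using le[OF z] by (simp add: pos_le_divide_eq)
      then show ?thesis using i True by (simp add: ennreal_mult[symmetric] ennreal_leI)
    next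
      case False
      then show ?thesis by (simp add: ennreal_neg not_less)
    qed
  qed
  finally have mult: "ennreal i * ?S \<le> ennreal s" .
  show ?thesis
  proof (cases ?S)
    case (real r)
    show ?thesis
    proof (cases "r = 0")
      case True
      then show ?thesis using real s by (simp add: ennreal_divide_zero)
    next
      case False
      then have "i * r \<le> s" using mult real i s by (simp add: ennreal_mult[symmetric] ennreal_le_iff)
      then have "i \<le> s / r" using False real by (simp add: pos_le_divide_eq)
      then show ?thesis using False real s by (simp add: divide_ennreal ennreal_leI)
    qed
  next
    case top
    have "i = 0"
    proof (rule ccontr)
      assume "i \<noteq> 0"
      then have "ennreal i * ?S = top" unfolding top using i by (simp add: ennreal_mult_top)
      then show False using mult by (simp add: top_unique)
    qed
    then show ?thesis by simp
  qed
qed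

context stabilised_fem
begin

lemma L2_star_square: "v \<in> V \<Longrightarrow> (L2_star_norm \<Gamma> \<nu> Th v)\<^sup>2 = B v v"
  using semi_inner_nonneg[OF semi_B, of v] by (simp add: L2_star_norm_def ip_star_def)

lemma H1_star_square: "v \<in> V \<Longrightarrow> (H1s v)\<^sup>2 = K v v"
  using semi_inner_nonneg[OF semi_K, of v] by (simp add: H1_star_norm_K)

lemma seminorm_square: "v \<in> V \<Longrightarrow> (H1s0 v)\<^sup>2 = a v v"
  using semi_inner_nonneg[OF semi_a, of v] by (simp add: H1_star_seminorm_def)

lemma form_integrable:
  assumes "semi_inner_on V Q" "u \<in> L2_time V T" "v \<in> L2_time V T"
  shows "set_integrable lborel {0<..<T} (\<lambda>t. Q (u t) (v t))"
proof -
  obtain n e where e: "orthonormal_basis V B n e" using basis_exists[OF inner] by blast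
  show ?thesis by (rule form_time_integrable[OF V_lin semi_B e assms])
qed

lemma test_norm_eq:
  assumes "v0 \<in> V" "v1 \<in> L2_time V T"
  shows "ten T (v0, v1) = sqrt (B v0 v0 + (LINT t:{0<..<T}|lborel. K (v1 t) (v1 t)))"
proof -
  have "(LINT t:{0<..<T}|lborel. (H1s (v1 t))\<^sup>2) = (LINT t:{0<..<T}|lborel. K (v1 t) (v1 t))"
    by (rule set_lebesgue_integral_cong) (use L2_time_in[OF assms(2)] in \<open>auto simp: H1_star_square\<close>)
  then show ?thesis by (simp add: test_norm_def L2_star_square[OF assms(1)])
qed

lemma K_time_nonneg:
  assumes "v1 \<in> L2_time V T"
  shows "0 \<le> (LINT t:{0<..<T}|lborel. K (v1 t) (v1 t))"
  unfolding set_lebesgue_integral_def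
  by (rule Bochner_Integration.integral_nonneg)
     (use semi_inner_nonneg[OF semi_K L2_time_in[OF assms]] in \<open>auto simp: indicator_def\<close>)

text \<open>A quotient by a vanishing norm would have the value \<open>0\<close>; this is excluded here for the test
  functions of interest.\<close>
lemma test_norm_pos:
  assumes v0: "v0 \<in> V" and v1: "v1 \<in> L2_time V T" and T: "0 < T" and u: "u \<in> trial_space V T"
    and b: "bf T u (v0, v1) \<noteq> 0"
  shows "(v0, v1) \<in> nonzero_tests V T" "0 < ten T (v0, v1)"
proof -
  let ?I = "{0<..<T}"
  define g where "g = time_deriv V T u"
  have gL: "g \<in> L2_time V T" unfolding g_def by (rule weak_time_deriv_L2[OF time_deriv_weak[OF u]])
  have uL: "u \<in> L2_time V T" by (rule trial_space_L2_time[OF u])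
  have u0: "u 0 \<in> V" using trial_space_in[OF u, of 0] T by simp
  have not_zero: "\<not> (v0 = (\<lambda>x. 0) \<and> (AE t in lborel. t \<in> ?I \<longrightarrow> v1 t = (\<lambda>x. 0)))"
  proof
    assume z: "v0 = (\<lambda>x. 0) \<and> (AE t in lborel. t \<in> ?I \<longrightarrow> v1 t = (\<lambda>x. 0))"
    have zero: "Q w (\<lambda>x. 0) = 0" if "semi_inner_on V Q" "w \<in> V" for Q w
      by (rule linear_functional_zero[OF V_lin semi_inner_right[OF V_lin that]])
    have "B (u 0) v0 = 0" using z zero[OF semi_B u0] by simp
    moreover have "(LINT t:?I|lborel. B (g t) (v1 t) + a (u t) (v1 t)) = 0"
      unfolding set_lebesgue_integral_def
    proof (rule integral_eq_zero_AE)
      show "AE t in lborel. indicator ?I t *\<^sub>R (B (g t) (v1 t) + a (u t) (v1 t)) = 0"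
        using z[THEN conjunct2]
      proof eventually_elim
        case (elim t)
        show ?case
          using elim zero[OF semi_B L2_time_in[OF gL, of t]] zero[OF semi_a L2_time_in[OF uL, of t]]
          by (cases "t \<in> ?I") auto
      qed
    qed
    ultimately show False using b by (simp add: b_form_def g_def)
  qed
  then show "(v0, v1) \<in> nonzero_tests V T"
    using v0 v1 by (simp add: nonzero_tests_def test_space_def)
  have B0: "0 \<le> B v0 v0" by (rule semi_inner_nonneg[OF semi_B v0])
  have "B v0 v0 + (LINT t:?I|lborel. K (v1 t) (v1 t)) \<noteq> 0"
  proof
    assume "B v0 v0 + (LINT t:?I|lborel. K (v1 t) (v1 t)) = 0"
    then have 1: "B v0 v0 = 0" and 2: "(LINT t:?I|lborel. K (v1 t) (v1 t)) = 0"
      using B0 K_time_nonneg[OF v1] by linarith+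
    have "v0 = (\<lambda>x. 0)" using 1 B_pos[OF v0] by force
    moreover have "AE t in lborel. indicator ?I t *\<^sub>R K (v1 t) (v1 t) = 0"
    proof (rule integral_nonneg_eq_0_iff_AE[THEN iffD1])
      show "integrable lborel (\<lambda>t. indicator ?I t *\<^sub>R K (v1 t) (v1 t))"
        using form_integrable[OF semi_K v1 v1] unfolding set_integrable_def .
      show "AE t in lborel. 0 \<le> indicator ?I t *\<^sub>R K (v1 t) (v1 t)"
        using semi_inner_nonneg[OF semi_K L2_time_in[OF v1]] by (intro AE_I2) (auto simp: indicator_def)
      show "(LINT t|lborel. indicator ?I t *\<^sub>R K (v1 t) (v1 t)) = 0"
        using 2 unfolding set_lebesgue_integral_def .
    qed
    then have "AE t in lborel. t \<in> ?I \<longrightarrow> v1 t = (\<lambda>x. 0)"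
    proof eventually_elim
      case (elim t)
      then show ?case using K_pos[OF L2_time_in[OF v1, of t]] by force
    qed
    ultimately show False using not_zero by blast
  qed
  then show "0 < ten T (v0, v1)"
    unfolding test_norm_eq[OF v0 v1] using B0 K_time_nonneg[OF v1] by simp
qed

lemma trial_norm_nonneg: "0 \<le> trn T u"
proof -
  have "0 \<le> (LINT t:{0<..<T}|lborel. (Hm1s (time_deriv V T u t))\<^sup>2 +
      (H1s0 (u t))\<^sup>2)"
    unfolding set_lebesgue_integral_def by (intro Bochner_Integration.integral_nonneg) auto
  then show ?thesis by (simp add: trial_norm_def)
qed

lemma trial_norm_square:
  assumes T: "0 < T" and u: "u \<in> trial_space V T"
  shows "(trn T u)\<^sup>2 = B (u 0) (u 0) + (LINT t:{0<..<T}|lborel.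
       (Hm1s (time_deriv V T u t))\<^sup>2 + a (u t) (u t))"
proof -
  have u0: "u 0 \<in> V" using trial_space_in[OF u, of 0] T by simp
  have "(LINT t:{0<..<T}|lborel. (Hm1s (time_deriv V T u t))\<^sup>2 + (H1s0 (u t))\<^sup>2)
      = (LINT t:{0<..<T}|lborel. (Hm1s (time_deriv V T u t))\<^sup>2 + a (u t) (u t))"
    by (rule set_lebesgue_integral_cong) (use trial_space_in[OF u] in \<open>auto simp: seminorm_square\<close>)
  moreover have "0 \<le> (LINT t:{0<..<T}|lborel. (Hm1s (time_deriv V T u t))\<^sup>2 + (H1s0 (u t))\<^sup>2)"
    unfolding set_lebesgue_integral_def by (intro Bochner_Integration.integral_nonneg) auto
  ultimately show ?thesis
    using semi_inner_nonneg[OF semi_B u0] by (simp add: trial_norm_def L2_star_square[OF u0])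
qed

text \<open>The abstract estimate in the norms of the method. The last conclusion is the only one that needs the
  norm of the projection and the inverse parameter to be finite.\<close>
lemma lower_bound_test:
  assumes T: "0 < T" and u: "u \<in> nonzero_trials V T"
  obtains v X where "v \<in> nonzero_tests V T" "0 < X" "X / 2 \<le> bf T u v"
    "0 < ten T v" "ten T v \<le> sqrt 2 * (1 + 2 * T) * sqrt X"
    "sqrt X \<le> trn T u"
    "\<And>p c. PS = ennreal p \<Longrightarrow> 0 \<le> p \<Longrightarrow>
       CI = ennreal c \<Longrightarrow> 0 \<le> c \<Longrightarrow>
       trn T u \<le> (p + c) * sqrt X"
proof -
  let ?I = "{0<..<T}" and ?H = "Hm1s"
  have uT: "u \<in> trial_space V T" and nz: "\<exists>t\<in>{0..T}. u t \<noteq> (\<lambda>x. 0)"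
    using u by (auto simp: nonzero_trials_def)
  define g where "g = time_deriv V T u"
  have g: "weak_time_deriv V T u g" unfolding g_def by (rule time_deriv_weak[OF uT])
  have gL: "g \<in> L2_time V T" by (rule weak_time_deriv_L2[OF g])
  have uL: "u \<in> L2_time V T" by (rule trial_space_L2_time[OF uT])
  have u0: "u 0 \<in> V" using trial_space_in[OF uT, of 0] T by simp
  have gV: "g t \<in> V" and uV: "u t \<in> V" if "t \<in> ?I" for t
    using that L2_time_in[OF gL, of t] L2_time_in[OF uL, of t] by auto
  obtain n e where e: "orthonormal_basis V B n e" using basis_exists[OF inner] by blast
  define X where "X = B (u 0) (u 0) + (LINT t:?I|lborel. K (R (g t)) (R (g t)) + a (u t) (u t))"
  define v1 where "v1 = (\<lambda>t x. u t x + R (g t) x)"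
  note est = discrete_inf_sup_estimate[where V = V and B = B and a = a and K = K and R = R and T = T
      and u = u and g = g and e = e and n = n, OF V_lin inner e semi_a semi_K a_le_K K_le_B_a R_in R_eq R_linear T uT g nz,
      folded X_def]
  have X0: "0 < X" by (rule est(1))
  have v1L: "v1 \<in> L2_time V T" unfolding v1_def by (rule est(2))
  have b: "X / 2 \<le> bf T u (u 0, v1)" using est(3) by (simp add: b_form_def g_def v1_def)
  have bne: "bf T u (u 0, v1) \<noteq> 0" using b X0 by linarith
  have test: "(u 0, v1) \<in> nonzero_tests V T" "0 < ten T (u 0, v1)"
    by (rule test_norm_pos[OF u0 v1L T uT bne])+
  have "ten T (u 0, v1) \<le> sqrt (2 * (1 + 2 * T)\<^sup>2 * X)"
    unfolding test_norm_eq[OF u0 v1L] unfolding v1_def using est(4) by (rule real_sqrt_le_mono)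
  also have "\<dots> = sqrt 2 * (1 + 2 * T) * sqrt X" using T by (simp add: real_sqrt_mult)
  finally have tn: "ten T (u 0, v1) \<le> sqrt 2 * (1 + 2 * T) * sqrt X" .
  have Rg: "(\<lambda>t. R (g t)) \<in> L2_time V T" by (rule L2_time_map[where R = R, OF gL R_in R_linear])
  have intX: "set_integrable lborel ?I (\<lambda>t. K (R (g t)) (R (g t)) + a (u t) (u t))"
    by (intro set_integral_add form_integrable semi_K semi_a Rg uL)
  have intH: "set_integrable lborel ?I (\<lambda>t. (?H (g t))\<^sup>2 + a (u t) (u t))"
    by (intro set_integral_add form_integrable semi_a uL Hm1_star_time_integrable gL)
  have tr: "(trn T u)\<^sup>2 = B (u 0) (u 0) + (LINT t:?I|lborel. (?H (g t))\<^sup>2 + a (u t) (u t))"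
    using trial_norm_square[OF T uT] by (simp add: g_def)
  have "X \<le> (trn T u)\<^sup>2"
    unfolding X_def tr
  proof (intro add_left_mono set_integral_mono[OF intX intH])
    fix t assume t: "t \<in> ?I"
    show "K (R (g t)) (R (g t)) + a (u t) (u t) \<le> (?H (g t))\<^sup>2 + a (u t) (u t)"
      using power_mono[OF dual_le_Hm1_star[OF gV[OF t]] dual_nonneg[OF gV[OF t]], of 2] dual_square[OF gV[OF t]] by simp
  qed
  then have lower: "sqrt X \<le> trn T u" using trial_norm_nonneg by (simp add: real_le_lsqrt)
  have upper: "trn T u \<le> (p + c) * sqrt X"
    if pc: "PS = ennreal p" "0 \<le> p" "CI = ennreal c" "0 \<le> c" for p c
  proof -
    note le = Hm1_star_le_dual[OF pc]
    \<comment> \<open>Comparing the two dual norms of a nonzero function shows that the constant is at least one.\<close>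
    obtain w where w: "w \<in> V" "w \<noteq> (\<lambda>x. 0)" using nontrivial lin_space_zero[OF V_lin] by blast
    have "dual w \<le> (p + c) * dual w" using dual_le_Hm1_star[OF w(1)] le[OF w(1)] by linarith
    then have pc1: "1 \<le> p + c" using dual_pos[OF w] by simp
    then have sq1: "1 \<le> (p + c)\<^sup>2" by (simp add: one_le_power)
    have "(trn T u)\<^sup>2 \<le> B (u 0) (u 0) + (LINT t:?I|lborel. (p + c)\<^sup>2 * (K (R (g t)) (R (g t)) + a (u t) (u t)))"
      unfolding tr
    proof (intro add_left_mono set_integral_mono[OF intH set_integrable_mult_right[OF intX]])
      fix t assume t: "t \<in> ?I"
      have "(?H (g t))\<^sup>2 \<le> ((p + c) * dual (g t))\<^sup>2"
        by (rule power_mono[OF le[OF gV[OF t]] Hm1_star_nonneg[OF gV[OF t]]])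
      then have "(?H (g t))\<^sup>2 \<le> (p + c)\<^sup>2 * K (R (g t)) (R (g t))"
        using dual_square[OF gV[OF t]] by (simp add: power_mult_distrib)
      moreover have "1 * a (u t) (u t) \<le> (p + c)\<^sup>2 * a (u t) (u t)"
        by (rule mult_right_mono[OF sq1 semi_inner_nonneg[OF semi_a uV[OF t]]])
      ultimately show "(?H (g t))\<^sup>2 + a (u t) (u t) \<le> (p + c)\<^sup>2 * (K (R (g t)) (R (g t)) + a (u t) (u t))"
        by (simp add: distrib_left)
    qed
    also have "\<dots> \<le> (p + c)\<^sup>2 * X"
      unfolding X_def distrib_left[of "(p + c)\<^sup>2" "B (u 0) (u 0)"] set_integral_mult_right
      using mult_right_mono[OF sq1 semi_inner_nonneg[OF semi_B u0]] by simp
    also have "\<dots> = ((p + c) * sqrt X)\<^sup>2" using X0 by (simp add: power_mult_distrib)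
    finally show ?thesis by (rule power2_le_imp_le) (use pc1 X0 in simp)
  qed
  show ?thesis using that[OF test(1) X0 b test(2) tn lower] upper by blast
qed

lemma inf_sup_lower:
  assumes T: "0 < T"
  shows "enn2ereal (ennreal (1 / (sqrt 8 * (1 + 2 * T))) /
           (PS + CI)) \<le> isc T"
  unfolding inf_sup_constant_def
proof (rule INF_greatest)
  fix u assume u: "u \<in> nonzero_trials V T"
  let ?p = "PS" and ?c = "CI"
  obtain v X where v: "v \<in> nonzero_tests V T" "0 < X" "X / 2 \<le> bf T u v"
    "0 < ten T v" "ten T v \<le> sqrt 2 * (1 + 2 * T) * sqrt X"
    "sqrt X \<le> trn T u"
    and up: "\<And>p c. ?p = ennreal p \<Longrightarrow> 0 \<le> p \<Longrightarrow> ?c = ennreal c \<Longrightarrow> 0 \<le> c \<Longrightarrow>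
       trn T u \<le> (p + c) * sqrt X"
    using lower_bound_test[OF T u] by metis
  let ?N = "trn T u * ten T v"
  have trp: "0 < trn T u" using v(2,6) by (smt (verit) real_sqrt_gt_zero)
  have Np: "0 < ?N" using trp v(4) by simp
  have "enn2ereal (ennreal (1 / (sqrt 8 * (1 + 2 * T))) / (?p + ?c)) \<le> ereal (bf T u v / ?N)"
  proof (cases "?p + ?c = \<infinity>")
    case True
    have "0 \<le> bf T u v / ?N" using v(2,3) Np by simp
    then show ?thesis unfolding True by (simp add: zero_ennreal.rep_eq)
  next
    case False
    then obtain p c where p: "?p = ennreal p" "0 \<le> p" and c: "?c = ennreal c" "0 \<le> c"
      by (cases ?p; cases ?c) auto
    define \<kappa> where "\<kappa> = p + c"
    have trk: "trn T u \<le> \<kappa> * sqrt X" unfolding \<kappa>_def by (rule up[OF p c])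
    have "0 < \<kappa> * sqrt X" using trp trk by linarith
    then have k: "0 < \<kappa>" using v(2) by (simp add: zero_less_mult_iff)
    have "?N \<le> (\<kappa> * sqrt X) * (sqrt 2 * (1 + 2 * T) * sqrt X)"
      using trk v(5) trp v(4) by (intro mult_mono) auto
    also have "\<dots> = \<kappa> * (sqrt 2 * (1 + 2 * T)) * X"
      using v(2) by (simp add: mult_ac flip: real_sqrt_mult)
    finally have N: "?N \<le> \<kappa> * (sqrt 2 * (1 + 2 * T)) * X" .
    have s8: "sqrt 8 = 2 * sqrt 2" using real_sqrt_mult[of 4 2] by simp
    have "1 / (sqrt 8 * (1 + 2 * T)) / \<kappa> * ?N \<le> 1 / (sqrt 8 * (1 + 2 * T)) / \<kappa> * (\<kappa> * (sqrt 2 * (1 + 2 * T)) * X)"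
      using N k T by (intro mult_left_mono) auto
    also have "\<dots> = X / 2"
    proof -
      define s where "s = sqrt 2 * (1 + 2 * T)"
      have "s \<noteq> 0" using T by (simp add: s_def)
      moreover have "sqrt 8 * (1 + 2 * T) = 2 * s" by (simp add: s8 s_def)
      ultimately show ?thesis unfolding s_def[symmetric] using k by simp
    qed
    also have "\<dots> \<le> bf T u v" by (rule v(3))
    finally have "1 / (sqrt 8 * (1 + 2 * T)) / \<kappa> \<le> bf T u v / ?N"
      using Np by (simp only: pos_le_divide_eq)
    moreover have "?p + ?c = ennreal \<kappa>" unfolding p(1) c(1) \<kappa>_def using p(2) c(2) by simp
    moreover have "0 \<le> 1 / (sqrt 8 * (1 + 2 * T))" using T by simp
    ultimately show ?thesis using k T by (simp add: divide_ennreal enn2ereal_ennreal del: divide_divide_eq_left)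
  qed
  then show "enn2ereal (ennreal (1 / (sqrt 8 * (1 + 2 * T))) / (?p + ?c))
      \<le> (SUP v\<in>nonzero_tests V T. ereal (bf T u v / (trn T u * ten T v)))"
    by (rule SUP_upper2[OF v(1)])
qed

text \<open>For a monomial \<open>t\<^sup>m\<close> of high degree the time derivative dominates, so that the trial function
  \<open>t\<^sup>m w\<close> sees only the ratio of the discrete dual norm of \<open>w\<close> and its norm in the dual of \<open>H\<^sup>1\<close>.\<close>
lemma upper_bound_trial:
  assumes T: "0 < T" and z: "z \<in> H1" "h1 z \<noteq> 0" and pos: "0 < h1 (P z)"
  shows "isc T \<le> ereal (sqrt 2 / (h1 (P z) / h1 z))"
proof -
  let ?I = "{0<..<T}" and ?H = "Hm1s"
  define y where "y = P z"
  have y: "y \<in> V" unfolding y_def by (rule proj(1)[OF z(1)])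
  have hz: "0 < h1 z" using z h1_nonneg[OF z(1)] by simp
  define N where "N = sqrt (K y y)"
  have Ny: "h1 y \<le> N" unfolding N_def by (rule h1_le_K[OF y])
  have N0: "0 < N" using pos Ny by (simp add: y_def)
  have NN: "N * N = K y y" using semi_inner_nonneg[OF semi_K y] by (simp add: N_def)
  obtain n e where e: "orthonormal_basis V B n e" using basis_exists[OF inner] by blast
  \<comment> \<open>The element of \<open>V\<close> with \<open>R w = y\<close>.\<close>
  define w where "w = (\<lambda>x. \<Sum>i<n. K y (e i) * e i x)"
  note rw = riesz_representation[OF V_lin semi_B e semi_inner_right[OF V_lin semi_K y], folded w_def]
  have w: "w \<in> V" by (rule rw(1))
  have Bw: "B w x = K y x" if "x \<in> V" for x by (rule rw(2)[OF that])
  have w0: "w \<noteq> (\<lambda>x. 0)"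
  proof
    assume "w = (\<lambda>x. 0)"
    then have "K y y = 0" using Bw[OF y] linear_functional_zero[OF V_lin semi_inner_left[OF semi_B y]] by simp
    then show False using NN N0 by simp
  qed
  define \<alpha> where "\<alpha> = sqrt (a w w)"
  have \<alpha>0: "0 \<le> \<alpha>" using semi_inner_nonneg[OF semi_a w] by (simp add: \<alpha>_def)
  \<comment> \<open>Since \<open>t\<^sup>m \<le> T t\<^sup>m\<^sup>-\<^sup>1\<close>, this choice bounds the contribution of \<open>a\<close> by \<open>sqrt 2 - 1\<close> times that of
      the time derivative.\<close>
  obtain m0 :: nat where m0: "T * \<alpha> / ((sqrt 2 - 1) * N) < real m0" using reals_Archimedean2 by blast
  define m where "m = Suc m0"
  have s2: "0 < sqrt 2 - 1" by simp
  have "T * \<alpha> / ((sqrt 2 - 1) * N) < real m" using m0 by (simp add: m_def)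
  then have big: "T * \<alpha> \<le> (sqrt 2 - 1) * (real m * N)"
    using s2 N0 by (simp add: pos_divide_less_eq mult_ac)
  have m: "0 < m" by (simp add: m_def)
  define u where "u = (\<lambda>t x. t ^ m * w x)"
  define g where "g = (\<lambda>t x. (real m * t ^ (m - 1)) * w x)"
  define \<phi> where "\<phi> t = real m * t ^ (m - 1)" for t :: real
  have uT: "u \<in> trial_space V T" and gw: "weak_time_deriv V T u g"
    unfolding u_def g_def by (rule monomial_weak_time_deriv[OF V_lin w T m])+
  have gL: "g \<in> L2_time V T" by (rule weak_time_deriv_L2[OF gw])
  have uL: "u \<in> L2_time V T" by (rule trial_space_L2_time[OF uT])
  define d where "d = time_deriv V T u"
  have dw: "weak_time_deriv V T u d" unfolding d_def by (rule time_deriv_weak[OF uT])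
  have dL: "d \<in> L2_time V T" by (rule weak_time_deriv_L2[OF dw])
  have dg: "AE t in lborel. t \<in> ?I \<longrightarrow> d t = g t"
    by (rule weak_time_deriv_unique[OF V_lin semi_B e uT dw gw])
  have u0: "u 0 = (\<lambda>x. 0)" using m by (simp add: u_def zero_power)
  have "u T \<noteq> (\<lambda>x. 0)" using w0 T by (simp add: u_def fun_eq_iff)
  then have unz: "u \<in> nonzero_trials V T" using uT T by (auto simp: nonzero_trials_def intro!: bexI[of _ T])
  have \<phi>0: "0 \<le> \<phi> t" if "0 < t" for t using that by (simp add: \<phi>_def)
  have c\<phi>: "continuous_on {0..T} \<phi>" unfolding \<phi>_def by (intro continuous_intros)
  have \<phi>2: "set_integrable lborel ?I (\<lambda>t. (\<phi> t)\<^sup>2)"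
    by (intro set_integrable_continuous_open_interval continuous_intros c\<phi>)
  define J where "J = (LINT t:?I|lborel. (\<phi> t)\<^sup>2)"
  have J0: "0 \<le> J" unfolding J_def set_lebesgue_integral_def by (intro Bochner_Integration.integral_nonneg) auto
  let ?tr = "trn T u"
  note tr0 = trial_norm_nonneg[of T u]
  \<comment> \<open>The dual norm of \<open>g t\<close> is bounded from below by its pairing with \<open>z\<close>, which is \<open>\<phi> t\<close> times
      \<open>ip w z = B (P z) w = K y y\<close>.\<close>
  define q where "q = N * N / h1 z"
  have q0: "0 \<le> q" using N0 hz by (simp add: q_def)
  have Hlow: "\<phi> t * q \<le> ?H (g t)" if t: "t \<in> ?I" for t
  proof -
    have gV: "g t \<in> V" using t L2_time_in[OF gL, of t] by auto
    have "ip (g t) z = \<phi> t * ip w z"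
      unfolding g_def \<phi>_def
      by (rule linear_functional_scale[OF H1_lin semi_inner_left[OF semi_ip_H1 z(1)] V_in_H1[OF w]])
    moreover have "ip w z = N * N"
      using proj(2)[OF z(1) w] semi_inner_sym[OF semi_ip_H1 z(1) V_in_H1[OF w]] semi_inner_sym[OF semi_B y w] Bw[OF y] NN
      by (simp add: y_def)
    ultimately have "\<phi> t * (N * N) \<le> hm (g t) * h1 z"
      using hm_upper[OF V_in_H1[OF gV] z(1)] by simp
    then have "\<phi> t * q \<le> hm (g t)" using hz by (simp add: q_def pos_divide_le_eq)
    also have "\<dots> \<le> ?H (g t)"
      using semi_inner_nonneg[OF semi_stab gV, of "-1"] hm_nonneg[OF V_in_H1[OF gV]]
      by (simp add: Hm1_star_norm_def hm_def real_le_rsqrt)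
    finally show ?thesis .
  qed
  have "q\<^sup>2 * J \<le> ?tr\<^sup>2"
  proof -
    have "q\<^sup>2 * J = (LINT t:?I|lborel. q\<^sup>2 * (\<phi> t)\<^sup>2)" by (simp add: J_def)
    also have "\<dots> \<le> (LINT t:?I|lborel. (?H (d t))\<^sup>2 + a (u t) (u t))"
      unfolding set_lebesgue_integral_def
    proof (rule integral_mono_AE)
      show "integrable lborel (\<lambda>t. indicator ?I t *\<^sub>R (q\<^sup>2 * (\<phi> t)\<^sup>2))"
        using set_integrable_mult_right[OF \<phi>2, of "q\<^sup>2"] unfolding set_integrable_def by simp
      have "set_integrable lborel ?I (\<lambda>t. (?H (d t))\<^sup>2 + a (u t) (u t))"
        by (intro set_integral_add form_integrable semi_a uL Hm1_star_time_integrable dL)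
      then show "integrable lborel (\<lambda>t. indicator ?I t *\<^sub>R ((?H (d t))\<^sup>2 + a (u t) (u t)))"
        unfolding set_integrable_def .
      show "AE t in lborel. indicator ?I t *\<^sub>R (q\<^sup>2 * (\<phi> t)\<^sup>2) \<le> indicator ?I t *\<^sub>R ((?H (d t))\<^sup>2 + a (u t) (u t))"
        using dg
      proof eventually_elim
        case (elim t)
        show ?case
        proof (cases "t \<in> ?I")
          case True
          have "0 \<le> \<phi> t * q" using \<phi>0[of t] q0 True by simp
          then have "(\<phi> t * q)\<^sup>2 \<le> (?H (g t))\<^sup>2" using Hlow[OF True] by (intro power_mono)
          moreover have "0 \<le> a (u t) (u t)" using True L2_time_in[OF uL, of t] semi_inner_nonneg[OF semi_a] by auto
          ultimately show ?thesis using elim True by (simp add: power_mult_distrib mult.commute)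
        qed simp
      qed
    qed
    also have "\<dots> = ?tr\<^sup>2" using trial_norm_square[OF T uT] linear_functional_zero[OF V_lin semi_inner_left[OF semi_B lin_space_zero[OF V_lin]]] by (simp add: u0 d_def)
    finally show ?thesis .
  qed
  then have "sqrt (q\<^sup>2 * J) \<le> ?tr" using tr0 by (simp add: real_le_lsqrt)
  then have trlow: "q * sqrt J \<le> ?tr" using q0 by (simp add: real_sqrt_mult)
  have ratio: "bf T u v / (?tr * ten T v) \<le> sqrt 2 / (h1 (P z) / h1 z)"
    if v: "v \<in> nonzero_tests V T" for v
  proof -
    obtain v0 v1 where vv: "v = (v0, v1)" by (cases v)
    have v0: "v0 \<in> V" and v1: "v1 \<in> L2_time V T"
      using v by (auto simp: vv nonzero_tests_def test_space_def)
    let ?te = "ten T (v0, v1)"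
    define \<psi> where "\<psi> t = indicator ?I t *\<^sub>R sqrt (K (v1 t) (v1 t))" for t :: real
    define \<zeta> where "\<zeta> t = indicator ?I t *\<^sub>R \<phi> t" for t :: real
    have v1V: "v1 t \<in> V" if "t \<in> ?I" for t using that L2_time_in[OF v1, of t] by auto
    have Kint: "set_integrable lborel ?I (\<lambda>t. K (v1 t) (v1 t))" by (rule form_integrable[OF semi_K v1 v1])
    have \<psi>sq: "\<psi> t * \<psi> t = indicator ?I t *\<^sub>R K (v1 t) (v1 t)" for t
      using semi_inner_nonneg[OF semi_K v1V] by (auto simp: \<psi>_def indicator_def)
    have \<psi>L: "\<psi> \<in> L2_space lborel"
    proof -
      have "(\<lambda>t. sqrt (indicator ?I t *\<^sub>R K (v1 t) (v1 t))) \<in> borel_measurable lborel"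
        using Kint unfolding set_integrable_def by measurable
      then have "\<psi> \<in> borel_measurable lborel"
        by (rule measurable_cong[THEN iffD1, rotated]) (auto simp: \<psi>_def indicator_def)
      moreover have "integrable lborel (\<lambda>t. \<psi> t * \<psi> t)" using Kint unfolding set_integrable_def \<psi>sq .
      ultimately show ?thesis by (simp add: L2_space_def power2_eq_square)
    qed
    have \<zeta>sq: "\<zeta> t * \<zeta> t = indicator ?I t *\<^sub>R (\<phi> t)\<^sup>2" for t by (simp add: \<zeta>_def indicator_def power2_eq_square)
    have \<zeta>L: "\<zeta> \<in> L2_space lborel"
    proof -
      have "\<zeta> \<in> borel_measurable lborel"
        unfolding \<zeta>_def \<phi>_def by measurable
      moreover have "integrable lborel (\<lambda>t. \<zeta> t * \<zeta> t)" using \<phi>2 unfolding set_integrable_def \<zeta>sq .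
      ultimately show ?thesis by (simp add: L2_space_def power2_eq_square)
    qed
    have bint: "set_integrable lborel ?I (\<lambda>t. B (d t) (v1 t) + a (u t) (v1 t))"
      by (intro set_integral_add form_integrable semi_B semi_a dL uL v1)
    have "bf T u (v0, v1) = (LINT t:?I|lborel. B (d t) (v1 t) + a (u t) (v1 t))"
      using linear_functional_zero[OF V_lin semi_inner_left[OF semi_B v0]] by (simp add: b_form_def u0 d_def)
    also have "\<dots> \<le> (LINT t|lborel. sqrt 2 * N * (\<zeta> t * \<psi> t))"
      unfolding set_lebesgue_integral_def
    proof (rule integral_mono_AE)
      show "integrable lborel (\<lambda>t. indicator ?I t *\<^sub>R (B (d t) (v1 t) + a (u t) (v1 t)))"
        using bint unfolding set_integrable_def .
      show "integrable lborel (\<lambda>t. sqrt 2 * N * (\<zeta> t * \<psi> t))"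
        using L2_space_mult_integrable[OF \<zeta>L \<psi>L] by simp
      show "AE t in lborel. indicator ?I t *\<^sub>R (B (d t) (v1 t) + a (u t) (v1 t)) \<le> sqrt 2 * N * (\<zeta> t * \<psi> t)"
        using dg
      proof eventually_elim
        case (elim t)
        show ?case
        proof (cases "t \<in> ?I")
          case True
          note vV = v1V[OF True]
          define k where "k = sqrt (K (v1 t) (v1 t))"
          have k0: "0 \<le> k" using semi_inner_nonneg[OF semi_K vV] by (simp add: k_def)
          have t: "0 < t" "t < T" using True by auto
          have "B (d t) (v1 t) = \<phi> t * K y (v1 t)"
            using elim True Bw[OF vV] linear_functional_scale[OF V_lin semi_inner_left[OF semi_B vV] w, of "\<phi> t"]
            by (simp add: g_def \<phi>_def)
          also have "\<dots> \<le> \<phi> t * (N * k)"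
            using K_Cauchy_Schwarz[OF y vV] \<phi>0[OF t(1)] by (intro mult_left_mono) (auto simp: N_def k_def)
          finally have 1: "B (d t) (v1 t) \<le> \<phi> t * (N * k)" .
          have "a (u t) (v1 t) = t ^ m * a w (v1 t)"
            unfolding u_def by (rule linear_functional_scale[OF V_lin semi_inner_left[OF semi_a vV] w])
          also have "\<dots> \<le> t ^ m * (\<alpha> * k)"
          proof (rule mult_left_mono)
            have "a w (v1 t) \<le> \<alpha> * sqrt (a (v1 t) (v1 t))"
              using semi_inner_Cauchy_Schwarz[OF V_lin semi_a w vV] by (simp add: \<alpha>_def)
            also have "\<dots> \<le> \<alpha> * k"
              unfolding k_def using \<alpha>0 a_le_K[OF vV] by (intro mult_left_mono real_sqrt_le_mono)
            finally show "a w (v1 t) \<le> \<alpha> * k" .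
          qed (use t in simp)
          also have "\<dots> \<le> t ^ (m - 1) * (T * \<alpha> * k)"
          proof -
            have "t ^ m = t ^ (m - 1) * t" by (simp add: m_def)
            moreover have "t * (\<alpha> * k) \<le> T * (\<alpha> * k)" using t \<alpha>0 k0 by (intro mult_right_mono) auto
            ultimately show ?thesis using t by (simp add: mult.assoc mult_left_mono)
          qed
          also have "\<dots> \<le> t ^ (m - 1) * ((sqrt 2 - 1) * (real m * N) * k)"
            using big k0 t by (intro mult_left_mono mult_right_mono) auto
          also have "\<dots> = (sqrt 2 - 1) * (\<phi> t * (N * k))" by (simp add: \<phi>_def)
          finally have 2: "a (u t) (v1 t) \<le> (sqrt 2 - 1) * (\<phi> t * (N * k))" .
          have "B (d t) (v1 t) + a (u t) (v1 t) \<le> \<phi> t * (N * k) + (sqrt 2 - 1) * (\<phi> t * (N * k))" using 1 2 by linarith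
          also have "\<dots> = sqrt 2 * N * (\<phi> t * k)" by (simp add: algebra_simps)
          finally show ?thesis using True by (simp add: \<zeta>_def \<psi>_def k_def)
        qed (simp add: \<zeta>_def \<psi>_def)
      qed
    qed
    also have "\<dots> = sqrt 2 * N * (LINT t|lborel. \<zeta> t * \<psi> t)" by simp
    also have "\<dots> \<le> sqrt 2 * N * (sqrt J * ?te)"
    proof (rule mult_left_mono)
      have "(LINT t|lborel. \<zeta> t * \<psi> t) \<le> sqrt (LINT t|lborel. \<zeta> t * \<zeta> t) * sqrt (LINT t|lborel. \<psi> t * \<psi> t)"
        using semi_inner_Cauchy_Schwarz[OF lin_space_L2_space semi_inner_L2_space \<zeta>L \<psi>L] by linarith
      also have "\<dots> = sqrt J * sqrt (LINT t:?I|lborel. K (v1 t) (v1 t))"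
        unfolding \<zeta>sq \<psi>sq J_def set_lebesgue_integral_def ..
      also have "\<dots> \<le> sqrt J * ?te"
        unfolding test_norm_eq[OF v0 v1] using J0 semi_inner_nonneg[OF semi_B v0]
        by (intro mult_left_mono real_sqrt_le_mono) auto
      finally show "(LINT t|lborel. \<zeta> t * \<psi> t) \<le> sqrt J * ?te" .
    qed (use N0 in simp)
    finally have b: "bf T u (v0, v1) \<le> sqrt 2 * N * (sqrt J * ?te)" .
    have te0: "0 \<le> ?te" unfolding test_norm_eq[OF v0 v1] using semi_inner_nonneg[OF semi_B v0] K_time_nonneg[OF v1] by simp
    have Nq: "N = (h1 z / N) * q" using N0 hz by (simp add: q_def)
    have "sqrt 2 * N * (sqrt J * ?te) = sqrt 2 * (h1 z / N) * (q * sqrt J * ?te)"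
      by (subst Nq) simp
    also have "\<dots> \<le> sqrt 2 * (h1 z / N) * (?tr * ?te)"
      using trlow te0 hz N0 by (intro mult_left_mono mult_right_mono) auto
    also have "\<dots> \<le> sqrt 2 * (h1 z / h1 (P z)) * (?tr * ?te)"
      using Ny pos hz tr0 te0 by (intro mult_right_mono mult_left_mono divide_left_mono) (auto simp: y_def N0)
    finally have b2: "bf T u v \<le> sqrt 2 / (h1 (P z) / h1 z) * (?tr * ?te)"
      using b by (simp add: vv)
    show ?thesis
    proof (cases "?tr * ?te = 0")
      case True
      show ?thesis unfolding vv True using pos hz by simp
    next
      case False
      then have "0 < ?tr * ?te" using tr0 te0 by (simp add: less_le)
      then show ?thesis using b2 unfolding vv by (simp only: pos_divide_le_eq)
    qed
  qed
  have "isc T \<le>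
      (SUP v\<in>nonzero_tests V T. ereal (bf T u v / (?tr * ten T v)))"
    unfolding inf_sup_constant_def by (rule INF_lower[OF unz])
  also have "\<dots> \<le> ereal (sqrt 2 / (h1 (P z) / h1 z))"
    by (rule SUP_least) (use ratio in simp)
  finally show ?thesis .
qed

lemma inf_sup_upper:
  assumes T: "0 < T"
  shows "isc T \<le> enn2ereal (ennreal (sqrt 2) / proj_norm_H1 \<Gamma> \<nu> Th V)"
proof -
  let ?c = "isc T" and ?Z = "{z \<in> H1. h1 z \<noteq> 0}"
  have nonneg: "0 \<le> ?c" using inf_sup_lower[OF T] enn2ereal_nonneg order_trans by blast
  have up: "?c \<le> ereal (sqrt 2 / (h1 (P z) / h1 z))" if "z \<in> ?Z" "0 < h1 (P z) / h1 z" for z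
  proof (rule upper_bound_trial[OF T])
    show "z \<in> H1" "h1 z \<noteq> 0" using that by auto
    then show "0 < h1 (P z)" using that(2) h1_nonneg[of z] by (simp add: zero_less_divide_iff)
  qed
  show ?thesis
  proof (cases "\<exists>z\<in>?Z. 0 < h1 (P z) / h1 z")
    case True
    then obtain z where "z \<in> ?Z" "0 < h1 (P z) / h1 z" by blast
    from up[OF this] nonneg obtain i where i: "?c = ereal i" "0 \<le> i" by (cases ?c) auto
    have "ennreal i \<le> ennreal (sqrt 2) / (SUP z\<in>?Z. ennreal (h1 (P z) / h1 z))"
    proof (rule ennreal_le_divide_SUP[OF i(2)])
      show "0 < sqrt 2" by simp
      show "i \<le> sqrt 2 / (h1 (P z) / h1 z)" if "z \<in> ?Z" "0 < h1 (P z) / h1 z" for z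
        using up[OF that] unfolding i(1) by simp
    qed
    then have "enn2ereal (ennreal i) \<le> enn2ereal (ennreal (sqrt 2) / proj_norm_H1 \<Gamma> \<nu> Th V)"
      unfolding proj_norm_H1_def by (simp only: less_eq_ennreal.rep_eq)
    then show ?thesis using i by (simp add: enn2ereal_ennreal)
  next
    case False
    then have "h1 (P z) / h1 z \<le> 0" if "z \<in> ?Z" for z using that by (auto simp: not_less)
    then have "(SUP z\<in>?Z. ennreal (h1 (P z) / h1 z)) \<le> 0"
      by (intro SUP_least) (simp add: ennreal_neg)
    then have "proj_norm_H1 \<Gamma> \<nu> Th V = 0" by (simp add: proj_norm_H1_def)
    then have "ennreal (sqrt 2) / proj_norm_H1 \<Gamma> \<nu> Th V = top" by (simp add: ennreal_divide_zero)
    then show ?thesis by (simp add: top_ennreal.rep_eq)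
  qed
qed

end

theorem theorem3p9:
  fixes \<Gamma> :: "'a::euclidean_space set" and \<nu> :: "'a \<Rightarrow> 'a"
    and M Th :: "'a set set" and V :: "('a \<Rightarrow> real) set" and C T :: real
  assumes "closed_C2_hypersurface \<Gamma>"
    and "unit_normal_field \<Gamma> \<nu>"
    and "mesh_surrounding \<Gamma> M"
    and "Th = active_mesh \<Gamma> M"
    and "resolves_geometry \<Gamma> \<nu> Th C"
    and "fe_space \<Gamma> \<nu> Th V"
    and "V \<noteq> {\<lambda>x. 0}"
    and "inner_product_on V (ip_star \<Gamma> \<nu> Th)"
    and "0 < T"
  shows "enn2ereal (ennreal (1 / (sqrt 8 * (1 + 2 * T))) /
           (proj_norm_H1_star \<Gamma> \<nu> Th V + inverse_parameter \<Gamma> \<nu> Th V))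
           \<le> inf_sup_constant \<Gamma> \<nu> Th V T \<and>
         inf_sup_constant \<Gamma> \<nu> Th V T
           \<le> enn2ereal (ennreal (sqrt 2) / proj_norm_H1 \<Gamma> \<nu> Th V)"
proof -
  interpret stabilised_fem \<Gamma> \<nu> M Th V C by unfold_locales (fact assms)+
  show ?thesis using inf_sup_lower[OF assms(9)] inf_sup_upper[OF assms(9)] by blast
qed

end
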